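(* An ample polytope (in $Y_{\mathbb{R}} = Y\otimes_{\mathbb Z}\mathbb{R}$, with vertices in $Y$) is diagonally split for some $q\ge2$ if and only if the root system is of type $A_1$, $A_2$, $A_3$, or $B_2\,(=C_2)$. For $A_1$ and $A_2$, ample polytopes are diagonally split for all $q\ge2$, and for $A_3$ and $B_2$, ample polytopes are diagonally split for odd but not even $q\ge2$.
   Context: Let $\Phi$ be an irreducible, reduced (finite, crystallographic) root system of rank $n$, with set of roots $\Delta$, root lattice $Y$ and coweight lattice $Y^\vee$ (the dual lattice of $Y$). Let $F$ be the Weyl fan in $Y^\vee \otimes_{\mathbb Z} \mathbb{R}$ (cut out by the root hyperplanes) and $F_n$ the set of its maximal cones (Weyl chambers). For adjacent chambers $\sigma,\sigma'$, $\alpha_{\sigma,\sigma'}\in\Delta$ is the unique root positive on $\sigma$ and negative on $\sigma'$. An ample polytope (with vertices in $Y$) is a convex polytope $P \subset Y\otimes_{\mathbb Z}\mathbb{R}$ whose vertices are given by a set $\{\mu_\sigma : \sigma\in F_n\} \subset Y$ such that for adjacent $\sigma,\sigma'$, $\mu_\sigma - \mu_{\sigma'} = r_{\sigma,\sigma'}\alpha_{\sigma,\sigma'}$ with $r_{\sigma,\sigma'} \in \mathbb{Z}_{>0}$. Diagonal splitting: let $\Gamma$ be a lattice with dual lattice $\Gamma^\vee$, $\Gamma_{\mathbb R}=\Gamma\otimes_{\mathbb Z}\mathbb{R}$, and $P\subseteq\Gamma_{\mathbb R}$ a lattice polytope (vertices in $\Gamma$). Let $v_1,\dots,v_k\in\Gamma^\vee$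 be the primitive lattice generators of the inward normal rays of the facets of $P$, and set $$\mathbb{F}_P^\circ := \{u\in\Gamma_{\mathbb R} : -1<\langle u,v_i\rangle<1,\ \forall i=1,\dots,k\}.$$ For an integer $q\ge2$, $P$ is diagonally split for $q$ if and only if every element $z\in(\frac1q\Gamma)/\Gamma$ has a representative $\tilde z\in\mathbb{F}_P^\circ\cap\frac1q\Gamma$. Here this is applied with $\Gamma=Y$. *)

theory Defs
  imports "HOL-Analysis.Analysis" "HOL-Computational_Algebra.Group_Closure"
begin

text \<open>The ambient Euclidean space plays the role of \<open>Y \<otimes> \<real>\<close>. The inner product is
  the one with respect to which the reflections are orthogonal; it is also used to identify
  \<open>Y\<^sup>\<or> \<otimes> \<real>\<close>, the dual space, with the same Euclidean space, the pairing
  being \<open>\<bullet>\<close>.\<close>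

section \<open>Root systems\<close>

definition reflection :: "'a::real_inner \<Rightarrow> 'a \<Rightarrow> 'a" where
  "reflection \<alpha> x = x - (2 * (x \<bullet> \<alpha>) / (\<alpha> \<bullet> \<alpha>)) *\<^sub>R \<alpha>"

definition cartan_number :: "'a::real_inner \<Rightarrow> 'a \<Rightarrow> real" where
  "cartan_number \<alpha> \<beta> = 2 * (\<alpha> \<bullet> \<beta>) / (\<beta> \<bullet> \<beta>)"

definition root_system :: "'a::euclidean_space set \<Rightarrow> bool" where
  "root_system \<Delta> \<longleftrightarrow>
     finite \<Delta> \<and> 0 \<notin> \<Delta> \<and> span \<Delta> = UNIV \<and>
     (\<forall>\<alpha>\<in>\<Delta>. reflection \<alpha> ` \<Delta> = \<Delta>) \<and>
     (\<forall>\<alpha>\<in>\<Delta>. \<forall>\<beta>\<in>\<Delta>. cartan_number \<alpha> \<beta> \<in> \<int>)"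

definition reduced_roots :: "'a::real_vector set \<Rightarrow> bool" where
  "reduced_roots \<Delta> \<longleftrightarrow> (\<forall>\<alpha>\<in>\<Delta>. \<forall>c. c *\<^sub>R \<alpha> \<in> \<Delta> \<longrightarrow> c = 1 \<or> c = -1)"

definition irreducible_roots :: "'a::real_inner set \<Rightarrow> bool" where
  "irreducible_roots \<Delta> \<longleftrightarrow> \<Delta> \<noteq> {} \<and>
     \<not> (\<exists>\<Delta>1 \<Delta>2. \<Delta>1 \<noteq> {} \<and> \<Delta>2 \<noteq> {} \<and> \<Delta> = \<Delta>1 \<union> \<Delta>2 \<and>
          (\<forall>\<alpha>\<in>\<Delta>1. \<forall>\<beta>\<in>\<Delta>2. \<alpha> \<bullet> \<beta> = 0))"

definition is_base :: "'a::real_vector set \<Rightarrow> nat \<Rightarrow> (nat \<Rightarrow> 'a) \<Rightarrow> bool" where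
  "is_base \<Delta> n b \<longleftrightarrow>
     inj_on b {..<n} \<and> b ` {..<n} \<subseteq> \<Delta> \<and> independent (b ` {..<n}) \<and>
     (\<forall>\<alpha>\<in>\<Delta>. \<exists>c :: nat \<Rightarrow> nat.
        \<alpha> = (\<Sum>i<n. real (c i) *\<^sub>R b i) \<or> \<alpha> = - (\<Sum>i<n. real (c i) *\<^sub>R b i))"

definition has_cartan_matrix :: "'a::real_inner set \<Rightarrow> nat \<Rightarrow> (nat \<Rightarrow> nat \<Rightarrow> int) \<Rightarrow> bool" where
  "has_cartan_matrix \<Delta> n C \<longleftrightarrow>
     (\<exists>b. is_base \<Delta> n b \<and> (\<forall>i<n. \<forall>j<n. cartan_number (b i) (b j) = of_int (C i j)))"

definition cartan_A :: "nat \<Rightarrow> nat \<Rightarrow> int" where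
  "cartan_A i j = (if i = j then 2 else if i = j + 1 \<or> j = i + 1 then -1 else 0)"

text \<open>For \<open>n \<ge> 2\<close>; simple roots are indexed by \<open>0, \<dots>, n - 1\<close> and the last one is
  the short one, so its coroot pairs to \<open>-2\<close> with the preceding simple root.\<close>

definition cartan_B :: "nat \<Rightarrow> nat \<Rightarrow> nat \<Rightarrow> int" where
  "cartan_B n i j = (if i + 2 = n \<and> j + 1 = n then -2 else cartan_A i j)"

definition type_A :: "nat \<Rightarrow> 'a::real_inner set \<Rightarrow> bool" where
  "type_A n \<Delta> \<longleftrightarrow> has_cartan_matrix \<Delta> n cartan_A"

definition type_B :: "nat \<Rightarrow> 'a::real_inner set \<Rightarrow> bool" where
  "type_B n \<Delta> \<longleftrightarrow> has_cartan_matrix \<Delta> n (cartan_B n)"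

definition root_lattice :: "'a::euclidean_space set \<Rightarrow> 'a set" where
  "root_lattice \<Delta> = group_closure \<Delta>"

section \<open>Weyl chambers and ample polytopes\<close>

definition weyl_chambers :: "'a::euclidean_space set \<Rightarrow> 'a set set" where
  "weyl_chambers \<Delta> = closure ` components (UNIV - (\<Union>\<alpha>\<in>\<Delta>. {v. \<alpha> \<bullet> v = 0}))"

definition adjacent :: "'a::euclidean_space set \<Rightarrow> 'a set \<Rightarrow> bool" where
  "adjacent \<sigma> \<sigma>' \<longleftrightarrow> (\<sigma> \<inter> \<sigma>') facet_of \<sigma> \<and> (\<sigma> \<inter> \<sigma>') facet_of \<sigma>'"

text \<open>Chambers are closed cones, on whose walls roots may vanish; signs are therefore
  taken on the interiors.\<close>

definition separating_root :: "'a::euclidean_space set \<Rightarrow> 'a set \<Rightarrow> 'a set \<Rightarrow> 'a" where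
  "separating_root \<Delta> \<sigma> \<sigma>' =
     (THE \<alpha>. \<alpha> \<in> \<Delta> \<and> (\<forall>v\<in>interior \<sigma>. \<alpha> \<bullet> v > 0) \<and> (\<forall>v\<in>interior \<sigma>'. \<alpha> \<bullet> v < 0))"

definition ample_polytope :: "'a::euclidean_space set \<Rightarrow> 'a set \<Rightarrow> bool" where
  "ample_polytope \<Delta> P \<longleftrightarrow> polytope P \<and>
     (\<exists>\<mu> :: 'a set \<Rightarrow> 'a.
        {x. x extreme_point_of P} = \<mu> ` weyl_chambers \<Delta> \<and>
        \<mu> ` weyl_chambers \<Delta> \<subseteq> root_lattice \<Delta> \<and>
        (\<forall>\<sigma>\<in>weyl_chambers \<Delta>. \<forall>\<sigma>'\<in>weyl_chambers \<Delta>. adjacent \<sigma> \<sigma>' \<longrightarrow>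
           (\<exists>r::int. r > 0 \<and> \<mu> \<sigma> - \<mu> \<sigma>' = of_int r *\<^sub>R separating_root \<Delta> \<sigma> \<sigma>')))"

section \<open>Diagonal splittings\<close>

definition dual_lattice :: "'a::euclidean_space set \<Rightarrow> 'a set" where
  "dual_lattice \<Gamma> = {v. \<forall>y\<in>\<Gamma>. y \<bullet> v \<in> \<int>}"

definition primitive_in :: "'a::real_vector set \<Rightarrow> 'a \<Rightarrow> bool" where
  "primitive_in L v \<longleftrightarrow> v \<in> L \<and> v \<noteq> 0 \<and> (\<forall>k::nat. k \<ge> 2 \<longrightarrow> v /\<^sub>R real k \<notin> L)"

text \<open>Intended for full-dimensional \<open>P\<close>, where each facet has exactly one inward normal
  ray; ample polytopes are full-dimensional.\<close>

definition inward_normal_generators :: "'a::euclidean_space set \<Rightarrow> 'a set \<Rightarrow> 'a set" where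
  "inward_normal_generators \<Gamma> P =
     {v. primitive_in (dual_lattice \<Gamma>) v \<and>
         (\<exists>f b. f facet_of P \<and> (\<forall>x\<in>P. x \<bullet> v \<ge> b) \<and> f = {x\<in>P. x \<bullet> v = b})}"

definition open_splitting_polytope :: "'a::euclidean_space set \<Rightarrow> 'a set \<Rightarrow> 'a set" where
  "open_splitting_polytope \<Gamma> P =
     {u. \<forall>v\<in>inward_normal_generators \<Gamma> P. -1 < u \<bullet> v \<and> u \<bullet> v < 1}"

definition fractional_lattice :: "nat \<Rightarrow> 'a::real_vector set \<Rightarrow> 'a set" where
  "fractional_lattice q \<Gamma> = (\<lambda>y. y /\<^sub>R real q) ` \<Gamma>"

text \<open>An element of \<open>(1/q)\<Gamma> / \<Gamma>\<close> is an equivalence class, i.e. a coset of \<open>\<Gamma>\<close>.\<close>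

definition diagonally_split :: "'a::euclidean_space set \<Rightarrow> 'a set \<Rightarrow> nat \<Rightarrow> bool" where
  "diagonally_split \<Gamma> P q \<longleftrightarrow>
     (\<forall>z \<in> fractional_lattice q \<Gamma> // {(x, y). x - y \<in> \<Gamma>}.
        \<exists>u\<in>z. u \<in> open_splitting_polytope \<Gamma> P \<inter> fractional_lattice q \<Gamma>)"

end

theory Submission
  imports Defs
begin

text \<open>The facet normals of an ample polytope are the Weyl conjugates of the fundamental coweights,
  whatever the polytope, because its vertex at a chamber maximizes every functional in that chamber.
  Hence the open splitting polytope consists of the vectors whose coordinates with respect to every
  simple system lie in \<open>(-1, 1)\<close>. A class supported on some simple roots only has representatives
  supported on these roots, and few of them, so sequences of simple reflections that produce a
  coordinate of absolute value at least \<open>1\<close> refute splitting. The class of \<open>\<lfloor>q/2\<rfloor> \<beta>/q\<close> excludes triple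
  edges, and double edges if \<open>q\<close> is even; for even \<open>q\<close>, the class of \<open>(\<alpha> + \<gamma>)/2\<close> excludes paths
  \<open>\<alpha>, \<beta>, \<gamma>\<close>; for \<open>q = 2p + 1\<close>, the class of \<open>(p \<alpha> - \<beta>)/q\<close> on a simple edge, extended by \<open>p \<delta>/q\<close>
  in the case of a path of four simple roots, excludes every larger connected diagram but \<open>A\<^sub>3\<close>.
  Conversely, in the listed types the conjugates of the fundamental coweights are explicit, and
  suitably rounded coordinates work.\<close>

section \<open>Reflections and simple systems\<close>

text \<open>The Weyl group is never formed. A chamber is represented by its simple system, a gallery
  towards a fixed chamber by \<open>simple_system_induct\<close>, and an orbit by a set stable under
  simple reflections. The box is stable under root reflections, so one simple system suffices for
  refutations: reflect a representative and read off one coordinate. The difficulty is that each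
  coordinate of a class has up to two candidates in (-1, 1). The numerators are chosen to make this
  harmless: \<open>q div 2\<close> admits only numerators of absolute value at least
  \<open>q div 2\<close>; for q = 2p + 1 the residues p and -1 admit p or -p-1 and 2p or -1, and
  every pair that survives in the box is brought by at most two reflections to (p \<alpha> + b
  \<beta>)/q with b >= p + 1. The obstructions built on this vector all end with p + b >= q. The
  classification of root systems is not invoked. Connectedness alone supplies a path of three simple
  roots once there are three of them, and any fourth root then completes a branch or a path of
  four.\<close>

lemma reflection_eq: "reflection \<alpha> x = x - cartan_number x \<alpha> *\<^sub>R \<alpha>"
  by (simp add: reflection_def cartan_number_def)

lemma cartan_number_add: "cartan_number (x + y) \<alpha> = cartan_number x \<alpha> + cartan_number y \<alpha>"
  and cartan_number_scaleR: "cartan_number (c *\<^sub>R x) \<alpha> = c * cartan_number x \<alpha>"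
  by (simp_all add: cartan_number_def inner_add_left add_divide_distrib)

lemma cartan_number_self: "\<alpha> \<noteq> 0 \<Longrightarrow> cartan_number \<alpha> \<alpha> = 2"
  by (simp add: cartan_number_def)

lemma linear_reflection: "linear (reflection \<alpha>)"
  by (intro linearI)
    (simp_all add: reflection_eq cartan_number_add cartan_number_scaleR algebra_simps)

lemma reflection_reflection [simp]: "reflection \<alpha> (reflection \<alpha> x) = x"
  by (cases "\<alpha> = 0") (simp_all add: reflection_def inner_diff_left algebra_simps)

lemma reflection_self [simp]: "reflection \<alpha> \<alpha> = - \<alpha>"
  by (cases "\<alpha> = 0") (simp_all add: reflection_def scaleR_2)

lemma reflection_uminus_left [simp]: "reflection (- \<alpha>) = reflection \<alpha>"
  by (rule ext) (simp add: reflection_def)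

lemma reflection_eq_self: "x \<bullet> \<alpha> = 0 \<Longrightarrow> reflection \<alpha> x = x"
  by (simp add: reflection_def)

lemma reflection_uminus_right: "reflection \<alpha> (- x) = - reflection \<alpha> x"
  by (simp add: reflection_def)

lemma inner_reflection_left: "reflection \<alpha> x \<bullet> y = x \<bullet> reflection \<alpha> y"
  by (simp add: reflection_def inner_diff_left inner_diff_right inner_commute)

lemma inner_reflection_reflection: "reflection \<alpha> x \<bullet> reflection \<alpha> y = x \<bullet> y"
  by (simp add: inner_reflection_left)

lemma bij_reflection: "bij (reflection \<alpha>)"
  by (rule o_bij[of "reflection \<alpha>"]) auto

lemma inj_reflection: "inj (reflection \<alpha>)"
  using bij_reflection bij_is_inj by blast

lemma reflection_image_image: "reflection \<alpha> ` reflection \<alpha> ` S = S"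
  by (simp add: image_image)

lemma reflection_conjugate:
  "reflection (reflection \<alpha> \<beta>) x = reflection \<alpha> (reflection \<beta> (reflection \<alpha> x))"
proof -
  have "cartan_number x (reflection \<alpha> \<beta>) = cartan_number (reflection \<alpha> x) \<beta>"
    by (simp add: cartan_number_def inner_reflection_reflection inner_reflection_left)
  then show ?thesis
    using linear_reflection[of \<alpha>]
    by (simp add: reflection_eq[of "reflection \<alpha> \<beta>"] reflection_eq[of \<beta>] linear_diff linear_cmul)
qed

lemma representation_linear_image:
  fixes f :: "'a::euclidean_space \<Rightarrow> 'a"
  assumes f: "linear f" "inj f" and S: "independent S" "span S = UNIV"
  shows "representation (f ` S) (f u) (f b) = representation S u b"
proof -
  have fin: "finite S"
    using S(1) by (rule finiteI_independent)
  have ind: "independent (f ` S)"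
    using f S(1) linear_independent_injective_image[of f S] inj_on_subset by blast
  define g where "g c = (if c \<in> f ` S then representation S u (the_inv f c) else 0)" for c
  have "representation (f ` S) (f u) = g"
  proof (rule representation_eqI[OF ind])
    have "u \<in> span S"
      using S(2) by simp
    then show "f u \<in> span (f ` S)"
      using f(1) by (simp add: linear_span_image)
    show "c \<in> f ` S" if "g c \<noteq> 0" for c
      using that by (auto simp: g_def split: if_splits)
    show "finite {c. g c \<noteq> 0}"
      by (rule finite_subset[of _ "f ` S"]) (use fin in \<open>auto simp: g_def\<close>)
    have "(\<Sum>c | g c \<noteq> 0. g c *\<^sub>R c) = (\<Sum>c\<in>f ` S. g c *\<^sub>R c)"
      by (rule sum.mono_neutral_left) (use fin in \<open>auto simp: g_def\<close>)
    also have "\<dots> = (\<Sum>b\<in>S. representation S u b *\<^sub>R f b)"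
      using f(2) by (subst sum.reindex) (auto simp: g_def the_inv_f_f inj_on_subset[OF f(2)] intro!: sum.cong)
    also have "\<dots> = f (\<Sum>b\<in>S. representation S u b *\<^sub>R b)"
      using f(1) by (simp add: linear_sum linear_cmul)
    also have "(\<Sum>b\<in>S. representation S u b *\<^sub>R b) = u"
      using S fin by (intro sum_representation_eq) auto
    finally show "(\<Sum>c | g c \<noteq> 0. g c *\<^sub>R c) = f u" .
  qed
  then have "representation (f ` S) (f u) (f b) = g (f b)"
    by simp
  also have "\<dots> = representation S u b"
    using f(2) representation_ne_zero[of S u b] by (auto simp: g_def the_inv_f_f inj_image_mem_iff)
  finally show ?thesis .
qed

section \<open>Simple systems and coordinates with respect to them\<close>

abbreviation coef :: "'a::euclidean_space set \<Rightarrow> 'a \<Rightarrow> 'a \<Rightarrow> real" where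
  "coef \<equiv> representation"

text \<open>A base of the root system as an unindexed set. Coordinates vanish at every
  \<open>b\<close> outside \<open>S\<close>, so the quantifiers over all \<open>b\<close> really
  speak of the simple roots only.\<close>

definition simple_system :: "'a::euclidean_space set \<Rightarrow> 'a set \<Rightarrow> bool" where
  "simple_system \<Delta> S \<longleftrightarrow> S \<subseteq> \<Delta> \<and> independent S \<and> span S = UNIV \<and>
     (\<forall>\<alpha>\<in>\<Delta>. (\<forall>b. coef S \<alpha> b \<in> \<nat>) \<or> (\<forall>b. - coef S \<alpha> b \<in> \<nat>))"

definition positive_roots :: "'a::euclidean_space set \<Rightarrow> 'a set \<Rightarrow> 'a set" where
  "positive_roots \<Delta> S = {\<alpha>\<in>\<Delta>. \<forall>b. coef S \<alpha> b \<ge> 0}"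

text \<open>The linear functional \<open>coef S _ b\<close> as a vector.\<close>

definition dual_vector :: "'a::euclidean_space set \<Rightarrow> 'a \<Rightarrow> 'a" where
  "dual_vector S b = (\<Sum>e\<in>Basis. coef S e b *\<^sub>R e)"

text \<open>Separating the positive from the negative coefficients of a relation gives one vector
  written in two ways, x = y with x \<bullet> y \<le> 0. So it is 0, and pairing with
  \<open>r\<close> kills each coefficient.\<close>

lemma independent_if_obtuse:
  fixes S :: "'a::real_inner set"
  assumes "finite S" and "\<And>a b. a \<in> S \<Longrightarrow> b \<in> S \<Longrightarrow> a \<noteq> b \<Longrightarrow> a \<bullet> b \<le> 0"
    and "\<And>a. a \<in> S \<Longrightarrow> 0 < a \<bullet> r"
  shows "independent S"
proof (rule independent_if_scalars_zero[OF assms(1)])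
  fix c a assume sum0: "(\<Sum>x\<in>S. c x *\<^sub>R x) = 0" and "a \<in> S"
  define x where "x = (\<Sum>a\<in>S. max (c a) 0 *\<^sub>R a)"
  define y where "y = (\<Sum>a\<in>S. max (- c a) 0 *\<^sub>R a)"
  have "x - y = (\<Sum>a\<in>S. c a *\<^sub>R a)"
    unfolding x_def y_def sum_subtractf[symmetric]
    by (rule sum.cong) (auto simp: max_def algebra_simps)
  then have "x = y"
    using sum0 by simp
  have "x \<bullet> y = (\<Sum>a\<in>S. \<Sum>b\<in>S. (max (c a) 0 * max (- c b) 0) * (a \<bullet> b))"
  proof -
    have "x \<bullet> y = (\<Sum>a\<in>S. max (c a) 0 * (a \<bullet> y))"
      by (simp add: x_def inner_sum_left)
    also have "\<dots> = (\<Sum>a\<in>S. \<Sum>b\<in>S. (max (c a) 0 * max (- c b) 0) * (a \<bullet> b))"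
      by (simp add: y_def inner_sum_right sum_distrib_left mult.assoc)
    finally show ?thesis .
  qed
  also have "\<dots> \<le> 0"
  proof (intro sum_nonpos)
    fix a b assume "a \<in> S" "b \<in> S"
    show "(max (c a) 0 * max (- c b) 0) * (a \<bullet> b) \<le> 0"
    proof (cases "a = b")
      case False
      then show ?thesis
        using assms(2)[OF \<open>a \<in> S\<close> \<open>b \<in> S\<close>] by (simp add: mult_nonneg_nonpos)
    qed (auto simp: max_def)
  qed
  finally have "x = 0" "y = 0"
    using \<open>x = y\<close> inner_gt_zero_iff[of y] by (metis not_le)+
  have "max (c a) 0 = 0"
  proof -
    have "(\<Sum>a\<in>S. max (c a) 0 * (a \<bullet> r)) = x \<bullet> r"
      by (simp add: x_def inner_sum_left)
    then have "\<forall>a\<in>S. max (c a) 0 * (a \<bullet> r) = 0"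
      using \<open>x = 0\<close> assms by (subst sum_nonneg_eq_0_iff[symmetric]) (auto simp: less_imp_le)
    then show ?thesis
      using \<open>a \<in> S\<close> assms(3) by fastforce
  qed
  moreover have "max (- c a) 0 = 0"
  proof -
    have "(\<Sum>a\<in>S. max (- c a) 0 * (a \<bullet> r)) = y \<bullet> r"
      by (simp add: y_def inner_sum_left)
    then have "\<forall>a\<in>S. max (- c a) 0 * (a \<bullet> r) = 0"
      using \<open>y = 0\<close> assms by (subst sum_nonneg_eq_0_iff[symmetric]) (auto simp: less_imp_le)
    then show ?thesis
      using \<open>a \<in> S\<close> assms(3) by fastforce
  qed
  ultimately show "c a = 0"
    by (simp add: max_def split: if_splits)
qed

section \<open>Roots and the existence of simple systems\<close>

locale reduced_root_system =
  fixes \<Delta> :: "'a::euclidean_space set"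
  assumes root_system: "root_system \<Delta>" and reduced: "reduced_roots \<Delta>"
begin

lemma finite_roots: "finite \<Delta>"
  and zero_notin_roots: "0 \<notin> \<Delta>"
  and span_roots: "span \<Delta> = UNIV"
  using root_system by (auto simp: root_system_def)

lemma reflection_roots: "\<alpha> \<in> \<Delta> \<Longrightarrow> reflection \<alpha> ` \<Delta> = \<Delta>"
  using root_system by (auto simp: root_system_def)

lemma reflection_root: "\<alpha> \<in> \<Delta> \<Longrightarrow> \<beta> \<in> \<Delta> \<Longrightarrow> reflection \<alpha> \<beta> \<in> \<Delta>"
  using reflection_roots by blast

lemma cartan_number_int: "\<alpha> \<in> \<Delta> \<Longrightarrow> \<beta> \<in> \<Delta> \<Longrightarrow> cartan_number \<alpha> \<beta> \<in> \<int>"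
  using root_system by (auto simp: root_system_def)

lemma root_multiple: "\<alpha> \<in> \<Delta> \<Longrightarrow> c *\<^sub>R \<alpha> \<in> \<Delta> \<Longrightarrow> c = 1 \<or> c = -1"
  using reduced by (auto simp: reduced_roots_def)

lemma uminus_root: "\<alpha> \<in> \<Delta> \<Longrightarrow> - \<alpha> \<in> \<Delta>"
  using reflection_root[of \<alpha> \<alpha>] by simp

lemma cartan_number_root_self: "\<alpha> \<in> \<Delta> \<Longrightarrow> cartan_number \<alpha> \<alpha> = 2"
  using zero_notin_roots by (intro cartan_number_self) auto

text \<open>The two Cartan numbers are positive integers with product below 4, so one of them is 1
  and the corresponding reflection produces the difference up to sign. The product is strictly below
  4 because equality in Cauchy-Schwarz would make \<beta> a positive multiple of \<alpha>, hence
  equal to \<alpha> by reducedness.\<close>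

lemma diff_root:
  assumes "\<alpha> \<in> \<Delta>" "\<beta> \<in> \<Delta>" "\<alpha> \<noteq> \<beta>" "\<alpha> \<bullet> \<beta> > 0"
  shows "\<alpha> - \<beta> \<in> \<Delta>"
proof -
  have nz: "\<alpha> \<noteq> 0" "\<beta> \<noteq> 0"
    using assms zero_notin_roots by auto
  obtain j k :: int where jk: "cartan_number \<alpha> \<beta> = j" "cartan_number \<beta> \<alpha> = k"
    using cartan_number_int[of \<alpha> \<beta>] cartan_number_int[of \<beta> \<alpha>] assms by (auto elim!: Ints_cases)
  have "cartan_number \<alpha> \<beta> > 0" "cartan_number \<beta> \<alpha> > 0"
    using assms nz by (auto simp: cartan_number_def inner_commute)
  then have pos: "j > 0" "k > 0"
    using jk by auto
  have "(\<alpha> \<bullet> \<beta>)\<^sup>2 \<noteq> (\<alpha> \<bullet> \<alpha>) * (\<beta> \<bullet> \<beta>)"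
  proof
    assume "(\<alpha> \<bullet> \<beta>)\<^sup>2 = (\<alpha> \<bullet> \<alpha>) * (\<beta> \<bullet> \<beta>)"
    then have "\<bar>\<alpha> \<bullet> \<beta>\<bar> = norm \<alpha> * norm \<beta>"
      using real_sqrt_abs[of "\<alpha> \<bullet> \<beta>"] by (simp add: norm_eq_sqrt_inner real_sqrt_mult)
    then have eq: "norm \<alpha> *\<^sub>R \<beta> = norm \<beta> *\<^sub>R \<alpha>"
      using assms(4) by (simp add: norm_cauchy_schwarz_eq)
    have "\<beta> = (norm \<beta> / norm \<alpha>) *\<^sub>R \<alpha>"
    proof -
      have "\<beta> = (1 / norm \<alpha>) *\<^sub>R (norm \<alpha> *\<^sub>R \<beta>)"
        using nz by simp
      also have "\<dots> = (norm \<beta> / norm \<alpha>) *\<^sub>R \<alpha>"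
        unfolding eq by simp
      finally show ?thesis .
    qed
    moreover have "0 < norm \<beta> / norm \<alpha>"
      using nz by simp
    ultimately show False
      using root_multiple[of \<alpha> "norm \<beta> / norm \<alpha>"] assms(1-3)
      by (metis neg_0_less_iff_less not_one_less_zero scaleR_one)
  qed
  moreover have "(\<alpha> \<bullet> \<beta>)\<^sup>2 \<le> (\<alpha> \<bullet> \<alpha>) * (\<beta> \<bullet> \<beta>)"
    by (rule Cauchy_Schwarz_ineq)
  ultimately have "4 * (\<alpha> \<bullet> \<beta>)\<^sup>2 < 4 * ((\<alpha> \<bullet> \<alpha>) * (\<beta> \<bullet> \<beta>))"
    by simp
  then have "cartan_number \<alpha> \<beta> * cartan_number \<beta> \<alpha> < 4"
    using nz by (simp add: cartan_number_def inner_commute power2_eq_square field_simps)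
  then have "j * k < 4"
    unfolding jk by (metis of_int_less_iff of_int_mult of_int_numeral)
  have "j = 1 \<or> k = 1"
  proof (rule ccontr)
    assume "\<not> ?thesis"
    then have "2 * 2 \<le> j * k"
      using pos by (intro mult_mono) auto
    then show False
      using \<open>j * k < 4\<close> by simp
  qed
  then show ?thesis
  proof
    assume "j = 1"
    then have "reflection \<beta> \<alpha> = \<alpha> - \<beta>"
      using jk by (simp add: reflection_eq)
    then show ?thesis
      using reflection_root[OF assms(2,1)] by simp
  next
    assume "k = 1"
    then have "- reflection \<alpha> \<beta> = \<alpha> - \<beta>"
      using jk by (simp add: reflection_eq)
    then show ?thesis
      using uminus_root[OF reflection_root[OF assms(1,2)]] by simp
  qed
qed

text \<open>\<open>S\<close> consists of the roots positive at \<open>r\<close> that are not sums of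
  two such roots. Distinct members form obtuse angles: otherwise their difference is a root, and
  either it or its negative decomposes one of the two.\<close>

lemma exists_simple_system:
  assumes reg: "\<And>\<alpha>. \<alpha> \<in> \<Delta> \<Longrightarrow> \<alpha> \<bullet> r \<noteq> 0"
  obtains S where "simple_system \<Delta> S" "\<And>\<beta>. \<beta> \<in> S \<Longrightarrow> 0 < \<beta> \<bullet> r"
proof -
  define P where "P = {\<alpha>\<in>\<Delta>. 0 < \<alpha> \<bullet> r}"
  define S where "S = {\<alpha>\<in>P. \<not> (\<exists>\<beta>\<in>P. \<exists>\<gamma>\<in>P. \<alpha> = \<beta> + \<gamma>)}"
  have fin: "finite P" "finite S"
    using finite_roots by (auto simp: P_def S_def)
  have P_cases: "\<alpha> \<in> P \<or> - \<alpha> \<in> P" if "\<alpha> \<in> \<Delta>" for \<alpha>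
    using that reg[OF that] uminus_root[OF that] by (auto simp: P_def)
  have "a \<bullet> b \<le> 0" if "a \<in> S" "b \<in> S" "a \<noteq> b" for a b
  proof (rule ccontr)
    assume "\<not> ?thesis"
    then have "a - b \<in> \<Delta>"
      using that by (intro diff_root) (auto simp: S_def P_def)
    from P_cases[OF this] show False
    proof
      assume "a - b \<in> P"
      moreover have "a = (a - b) + b" by simp
      ultimately show False
        using that unfolding S_def by blast
    next
      assume "- (a - b) \<in> P"
      moreover have "b = - (a - b) + a" by simp
      ultimately show False
        using that unfolding S_def by blast
    qed
  qed
  then have ind: "independent S"
    using fin by (rule_tac independent_if_obtuse[where r = r]) (auto simp: S_def P_def)
  have nat: "\<alpha> \<in> span S \<and> (\<forall>b. coef S \<alpha> b \<in> \<nat>)" if "\<alpha> \<in> P" for \<alpha>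
    using that
  \<comment> \<open>The value \<alpha> \<bullet> r is real and gives no well-founded induction by
    itself; the number of positive roots with a smaller value does.\<close>
  proof (induction "card {\<beta>\<in>P. \<beta> \<bullet> r < \<alpha> \<bullet> r}" arbitrary: \<alpha> rule: less_induct)
    case less
    show ?case
    proof (cases "\<alpha> \<in> S")
      case True
      then show ?thesis
        using ind by (simp add: span_base representation_basis)
    next
      case False
      then obtain \<beta> \<gamma> where *: "\<beta> \<in> P" "\<gamma> \<in> P" "\<alpha> = \<beta> + \<gamma>"
        using less.prems by (auto simp: S_def)
      then have lt: "\<beta> \<bullet> r < \<alpha> \<bullet> r" "\<gamma> \<bullet> r < \<alpha> \<bullet> r"
        by (auto simp: P_def inner_add_left)
      have "card {\<delta>\<in>P. \<delta> \<bullet> r < \<beta> \<bullet> r} < card {\<delta>\<in>P. \<delta> \<bullet> r < \<alpha> \<bullet> r}"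
        "card {\<delta>\<in>P. \<delta> \<bullet> r < \<gamma> \<bullet> r} < card {\<delta>\<in>P. \<delta> \<bullet> r < \<alpha> \<bullet> r}"
        using lt * fin by (auto intro!: psubset_card_mono)
      then show ?thesis
        using less.hyps[of \<beta>] less.hyps[of \<gamma>] * ind
        by (auto simp: representation_add span_add)
    qed
  qed
  have "\<Delta> \<subseteq> span S"
  proof
    fix \<alpha> assume "\<alpha> \<in> \<Delta>"
    from P_cases[OF this] show "\<alpha> \<in> span S"
      using nat[of \<alpha>] nat[of "- \<alpha>"] span_neg[of "- \<alpha>" S] by auto
  qed
  then have span: "span S = UNIV"
    using span_roots span_mono[of \<Delta> "span S"] by (metis span_span top.extremum_uniqueI)
  have "simple_system \<Delta> S"
    unfolding simple_system_def
  proof (intro conjI ballI)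
    show "S \<subseteq> \<Delta>"
      by (auto simp: S_def P_def)
    fix \<alpha> assume "\<alpha> \<in> \<Delta>"
    from P_cases[OF this] show "(\<forall>b. coef S \<alpha> b \<in> \<nat>) \<or> (\<forall>b. - coef S \<alpha> b \<in> \<nat>)"
      using nat[of \<alpha>] nat[of "- \<alpha>"] ind span by (auto simp: representation_neg)
  qed (use ind span in auto)
  then show ?thesis
    by (rule that) (auto simp: S_def P_def)
qed

end

lemma simple_system_basis:
  assumes "simple_system \<Delta> S"
  shows "S \<subseteq> \<Delta>" "independent S" "span S = UNIV" "finite S"
  using assms finiteI_independent[of S] by (auto simp: simple_system_def)

lemma
  assumes "simple_system \<Delta> S"
  shows coef_add: "coef S (u + v) b = coef S u b + coef S v b"
    and coef_diff: "coef S (u - v) b = coef S u b - coef S v b"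
    and coef_uminus: "coef S (- u) b = - coef S u b"
    and coef_scaleR: "coef S (c *\<^sub>R u) b = c * coef S u b"
    and coef_sum: "coef S (\<Sum>i\<in>I. f i) b = (\<Sum>i\<in>I. coef S (f i) b)"
  using simple_system_basis[OF assms]
  by (simp_all add: representation_add representation_diff representation_neg
      representation_scale representation_sum)

lemma coef_simple:
  assumes "simple_system \<Delta> S" "a \<in> S"
  shows "coef S a b = (if b = a then 1 else 0)"
  using simple_system_basis[OF assms(1)] assms(2) by (simp add: representation_basis)

lemma sum_coef:
  assumes "simple_system \<Delta> S"
  shows "(\<Sum>b\<in>S. coef S u b *\<^sub>R b) = u"
  using simple_system_basis[OF assms] by (intro sum_representation_eq) auto

lemma inner_sum_coef:
  assumes "simple_system \<Delta> S"
  shows "u \<bullet> v = (\<Sum>b\<in>S. coef S u b * (b \<bullet> v))"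
  by (subst sum_coef[OF assms, of u, symmetric]) (simp add: inner_sum_left)

lemma inner_dual_vector:
  assumes "simple_system \<Delta> S"
  shows "u \<bullet> dual_vector S b = coef S u b"
proof -
  have "coef S u b = coef S (\<Sum>e\<in>Basis. (u \<bullet> e) *\<^sub>R e) b"
    by (simp add: euclidean_representation)
  also have "\<dots> = (\<Sum>e\<in>Basis. (u \<bullet> e) * coef S e b)"
    by (simp add: coef_sum[OF assms] coef_scaleR[OF assms])
  finally show ?thesis
    by (simp add: dual_vector_def inner_sum_right mult.commute)
qed

lemma inner_simple_dual_vector:
  assumes "simple_system \<Delta> S" "a \<in> S"
  shows "a \<bullet> dual_vector S b = (if b = a then 1 else 0)"
  by (simp add: inner_dual_vector[OF assms(1)] coef_simple[OF assms])

lemma simple_system_vector_eqI: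
  assumes S: "simple_system \<Delta> S" and "\<And>b. b \<in> S \<Longrightarrow> b \<bullet> u = b \<bullet> v"
  shows "u = v"
proof -
  have "(u - v) \<bullet> (u - v) = (\<Sum>b\<in>S. coef S (u - v) b * (b \<bullet> (u - v)))"
    by (rule inner_sum_coef[OF S])
  also have "\<dots> = 0"
    using assms(2) by (intro sum.neutral) (simp add: inner_diff_right)
  finally show ?thesis
    by simp
qed

lemma sum_dual_vector:
  assumes "simple_system \<Delta> S"
  shows "(\<Sum>b\<in>S. (b \<bullet> v) *\<^sub>R dual_vector S b) = v"
proof (rule simple_system_vector_eqI[OF assms])
  fix a assume "a \<in> S"
  then show "a \<bullet> (\<Sum>b\<in>S. (b \<bullet> v) *\<^sub>R dual_vector S b) = a \<bullet> v"
    using simple_system_basis[OF assms]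
    by (simp add: inner_sum_right inner_simple_dual_vector[OF assms] if_distrib cong: if_cong)
qed

lemma card_simple_system:
  fixes S :: "'a::euclidean_space set"
  assumes "simple_system \<Delta> S"
  shows "card S = DIM('a)"
  using simple_system_basis[OF assms] dim_eq_card[of S UNIV] by simp

lemma coef_root_cases:
  assumes "simple_system \<Delta> S" "\<alpha> \<in> \<Delta>"
  shows "(\<forall>b. coef S \<alpha> b \<in> \<nat>) \<or> (\<forall>b. - coef S \<alpha> b \<in> \<nat>)"
  using assms by (auto simp: simple_system_def)

section \<open>Positive roots and simple reflections\<close>

context reduced_root_system
begin

lemma positive_root_cases:
  assumes "simple_system \<Delta> S" "\<alpha> \<in> \<Delta>"
  shows "\<alpha> \<in> positive_roots \<Delta> S \<or> - \<alpha> \<in> positive_roots \<Delta> S"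
proof -
  have nonneg: "x \<ge> 0" if "x \<in> \<nat>" for x :: real
    using that by (auto elim: Nats_cases)
  from coef_root_cases[OF assms] show ?thesis
  proof
    assume "\<forall>b. - coef S \<alpha> b \<in> \<nat>"
    then have "0 \<le> - coef S \<alpha> b" for b
      using nonneg by blast
    then show ?thesis
      using uminus_root[OF assms(2)] by (simp add: positive_roots_def coef_uminus[OF assms(1)])
  qed (use assms nonneg in \<open>auto simp: positive_roots_def\<close>)
qed

lemma uminus_notin_positive_roots:
  assumes "simple_system \<Delta> S" "\<alpha> \<in> positive_roots \<Delta> S"
  shows "- \<alpha> \<notin> positive_roots \<Delta> S"
proof
  assume "- \<alpha> \<in> positive_roots \<Delta> S"
  then have "coef S \<alpha> b \<le> 0" "coef S \<alpha> b \<ge> 0" for b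
    using assms by (auto simp: positive_roots_def coef_uminus[OF assms(1)])
  then have "coef S \<alpha> b = 0" for b
    by (meson antisym)
  then have "\<alpha> = 0"
    using sum_coef[OF assms(1), of \<alpha>] by simp
  then show False
    using assms zero_notin_roots by (auto simp: positive_roots_def)
qed

lemma simple_subset_positive:
  assumes "simple_system \<Delta> S"
  shows "S \<subseteq> positive_roots \<Delta> S"
  using simple_system_basis[OF assms] by (auto simp: positive_roots_def coef_simple[OF assms])

lemma positive_if_coef_pos:
  assumes "simple_system \<Delta> S" "\<alpha> \<in> \<Delta>" "coef S \<alpha> b > 0"
  shows "\<alpha> \<in> positive_roots \<Delta> S"
proof (rule ccontr)
  assume "\<alpha> \<notin> positive_roots \<Delta> S"
  then have "- \<alpha> \<in> positive_roots \<Delta> S"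
    using positive_root_cases[OF assms(1,2)] by simp
  then have "coef S (- \<alpha>) b \<ge> 0"
    by (simp add: positive_roots_def)
  then show False
    using assms(3) by (simp add: coef_uminus[OF assms(1)])
qed

lemma coef_reflection_image:
  assumes "simple_system \<Delta> S"
  shows "coef (reflection \<alpha> ` S) (reflection \<alpha> u) (reflection \<alpha> b) = coef S u b"
  using simple_system_basis[OF assms]
  by (intro representation_linear_image linear_reflection inj_reflection)

lemma coef_reflection_image':
  assumes "simple_system \<Delta> S"
  shows "coef (reflection \<alpha> ` S) u b = coef S (reflection \<alpha> u) (reflection \<alpha> b)"
  using coef_reflection_image[OF assms, of \<alpha> "reflection \<alpha> u" "reflection \<alpha> b"] by simp

lemma simple_system_reflection:
  assumes "simple_system \<Delta> S" "\<alpha> \<in> \<Delta>"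
  shows "simple_system \<Delta> (reflection \<alpha> ` S)"
  unfolding simple_system_def
proof (intro conjI ballI)
  note S = simple_system_basis[OF assms(1)]
  show "reflection \<alpha> ` S \<subseteq> \<Delta>"
    using S(1) assms(2) reflection_root by auto
  show "independent (reflection \<alpha> ` S)"
    using linear_independent_injective_image[OF linear_reflection S(2)] inj_reflection
      inj_on_subset by blast
  show "span (reflection \<alpha> ` S) = UNIV"
    using S(3) bij_reflection[of \<alpha>]
    by (simp add: linear_span_image[OF linear_reflection] bij_is_surj)
  fix \<beta> assume "\<beta> \<in> \<Delta>"
  then show "(\<forall>b. coef (reflection \<alpha> ` S) \<beta> b \<in> \<nat>) \<or> (\<forall>b. - coef (reflection \<alpha> ` S) \<beta> b \<in> \<nat>)"
    using coef_root_cases[OF assms(1) reflection_root[OF assms(2), of \<beta>]]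
    by (auto simp: coef_reflection_image'[OF assms(1)])
qed

lemma positive_roots_reflection_iff:
  assumes "simple_system \<Delta> S" "\<alpha> \<in> \<Delta>"
  shows "\<beta> \<in> positive_roots \<Delta> (reflection \<alpha> ` S) \<longleftrightarrow> reflection \<alpha> \<beta> \<in> positive_roots \<Delta> S"
proof -
  have "\<beta> \<in> \<Delta> \<longleftrightarrow> reflection \<alpha> \<beta> \<in> \<Delta>"
    using reflection_root[OF assms(2), of \<beta>] reflection_root[OF assms(2), of "reflection \<alpha> \<beta>"]
    by auto
  moreover have "(\<forall>b. 0 \<le> coef (reflection \<alpha> ` S) \<beta> b) \<longleftrightarrow> (\<forall>b. 0 \<le> coef S (reflection \<alpha> \<beta>) b)"
    by (metis coef_reflection_image'[OF assms(1)] reflection_reflection)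
  ultimately show ?thesis
    by (simp add: positive_roots_def)
qed

text \<open>Reflections are self-adjoint and carry the coordinates along, hence also the dual basis.
  This is why all facet normals are conjugates of the fundamental coweights.\<close>

lemma dual_vector_reflection:
  assumes "simple_system \<Delta> S" "\<alpha> \<in> \<Delta>"
  shows "dual_vector (reflection \<alpha> ` S) (reflection \<alpha> b) = reflection \<alpha> (dual_vector S b)"
proof (rule simple_system_vector_eqI[OF assms(1)])
  fix a
  have "a \<bullet> dual_vector (reflection \<alpha> ` S) (reflection \<alpha> b) = coef S (reflection \<alpha> a) b"
    by (simp add: inner_dual_vector[OF simple_system_reflection[OF assms]]
        coef_reflection_image'[OF assms(1)])
  also have "\<dots> = a \<bullet> reflection \<alpha> (dual_vector S b)"
    by (simp add: inner_dual_vector[OF assms(1)] flip: inner_reflection_left)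
  finally show "a \<bullet> dual_vector (reflection \<alpha> ` S) (reflection \<alpha> b) = \<dots>" .
qed

text \<open>Otherwise a - b would be a root with one coordinate 1 and another -1.\<close>

lemma simple_inner_nonpos:
  assumes S: "simple_system \<Delta> S" and "a \<in> S" "b \<in> S" "a \<noteq> b"
  shows "a \<bullet> b \<le> 0"
proof (rule ccontr)
  assume "\<not> ?thesis"
  then have root: "a - b \<in> \<Delta>"
    using assms simple_system_basis(1)[OF S] by (intro diff_root) auto
  have *: "coef S (a - b) a = 1" "coef S (a - b) b = - 1"
    using assms by (auto simp: coef_diff[OF S] coef_simple[OF S])
  then have "a - b \<in> positive_roots \<Delta> S"
    by (intro positive_if_coef_pos[OF S root, of a]) simp
  then have "0 \<le> coef S (a - b) b"
    by (simp add: positive_roots_def)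
  then show False
    using * by simp
qed

text \<open>In the expansion of \<alpha> \<bullet> \<alpha> > 0 along \<open>S\<close> all
  coefficients are nonnegative, so some summand has two positive factors.\<close>

lemma simple_with_pos_inner:
  assumes S: "simple_system \<Delta> S" and "\<alpha> \<in> positive_roots \<Delta> S"
  obtains \<beta> where "\<beta> \<in> S" "coef S \<alpha> \<beta> > 0" "\<alpha> \<bullet> \<beta> > 0"
proof -
  have "\<exists>\<beta>\<in>S. coef S \<alpha> \<beta> > 0 \<and> \<alpha> \<bullet> \<beta> > 0"
  proof (rule ccontr)
    assume *: "\<not> ?thesis"
    have "\<alpha> \<bullet> \<alpha> = (\<Sum>b\<in>S. coef S \<alpha> b * (b \<bullet> \<alpha>))"
      by (rule inner_sum_coef[OF S])
    also have "\<dots> \<le> 0"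
    proof (rule sum_nonpos)
      fix b assume "b \<in> S"
      have "coef S \<alpha> b \<ge> 0"
        using assms(2) by (simp add: positive_roots_def)
      then show "coef S \<alpha> b * (b \<bullet> \<alpha>) \<le> 0"
        using * \<open>b \<in> S\<close> by (cases "coef S \<alpha> b = 0")
          (auto simp: inner_commute not_less mult_nonneg_nonpos)
    qed
    finally have "\<alpha> = 0"
      by (metis inner_gt_zero_iff not_le)
    then show False
      using assms(2) zero_notin_roots by (auto simp: positive_roots_def)
  qed
  then show ?thesis
    using that by blast
qed

text \<open>Otherwise \<alpha> would be a nonnegative multiple of the root \<beta>, and reducedness
  would force \<alpha> = \<beta>.\<close>

lemma positive_root_other_coef:
  assumes S: "simple_system \<Delta> S" and \<alpha>: "\<alpha> \<in> positive_roots \<Delta> S" and \<beta>: "\<beta> \<in> S" "\<alpha> \<noteq> \<beta>"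
  obtains \<gamma> where "\<gamma> \<in> S" "\<gamma> \<noteq> \<beta>" "coef S \<alpha> \<gamma> > 0"
proof -
  have "\<exists>\<gamma>\<in>S - {\<beta>}. coef S \<alpha> \<gamma> > 0"
  proof (rule ccontr)
    assume "\<not> ?thesis"
    then have zero: "coef S \<alpha> \<gamma> = 0" if "\<gamma> \<in> S - {\<beta>}" for \<gamma>
      using that \<alpha> unfolding positive_roots_def by (metis (mono_tags, lifting) mem_Collect_eq not_le order.antisym)
    have "\<alpha> = (\<Sum>b\<in>S. coef S \<alpha> b *\<^sub>R b)"
      by (simp add: sum_coef[OF S])
    also have "\<dots> = (\<Sum>b\<in>{\<beta>}. coef S \<alpha> b *\<^sub>R b)"
      using zero \<beta> simple_system_basis[OF S] by (intro sum.mono_neutral_right) auto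
    finally have eq: "\<alpha> = coef S \<alpha> \<beta> *\<^sub>R \<beta>"
      by simp
    then have "coef S \<alpha> \<beta> = 1 \<or> coef S \<alpha> \<beta> = -1"
      using root_multiple[of \<beta> "coef S \<alpha> \<beta>"] \<alpha> \<beta> simple_system_basis(1)[OF S]
      by (auto simp: positive_roots_def)
    moreover have "coef S \<alpha> \<beta> \<ge> 0"
      using \<alpha> by (simp add: positive_roots_def)
    ultimately show False
      using eq \<beta>(2) by auto
  qed
  then show ?thesis
    using that by blast
qed

lemma coef_reflection_simple:
  assumes "simple_system \<Delta> S" "\<beta> \<in> S"
  shows "coef S (reflection \<beta> u) \<gamma> = (if \<gamma> = \<beta> then coef S u \<gamma> - cartan_number u \<beta> else coef S u \<gamma>)"
  by (simp add: reflection_eq coef_diff[OF assms(1)] coef_scaleR[OF assms(1)] coef_simple[OF assms])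

text \<open>The reflection changes only the coordinate at \<beta>. Another coordinate is positive
  and survives, and one positive coordinate settles the sign of a root.\<close>

lemma reflection_simple_positive:
  assumes S: "simple_system \<Delta> S" and \<alpha>: "\<alpha> \<in> positive_roots \<Delta> S" and \<beta>: "\<beta> \<in> S" "\<alpha> \<noteq> \<beta>"
  shows "reflection \<beta> \<alpha> \<in> positive_roots \<Delta> S"
proof -
  obtain \<gamma> where "\<gamma> \<in> S" "\<gamma> \<noteq> \<beta>" "coef S \<alpha> \<gamma> > 0"
    by (rule positive_root_other_coef[OF assms])
  then have "coef S (reflection \<beta> \<alpha>) \<gamma> > 0"
    by (simp add: coef_reflection_simple[OF S \<beta>(1)])
  moreover have "reflection \<beta> \<alpha> \<in> \<Delta>"
    using reflection_root simple_system_basis(1)[OF S] \<alpha> \<beta> by (auto simp: positive_roots_def)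
  ultimately show ?thesis
    using positive_if_coef_pos[OF S] by blast
qed

text \<open>This recovers \<open>S\<close> from its positive roots. In the backward direction, a
  simple \<beta> with \<alpha> \<bullet> \<beta> > 0 could be split off from a nonsimple \<alpha>,
  leaving a positive root.\<close>

lemma simple_iff_indecomposable:
  assumes S: "simple_system \<Delta> S"
  shows "\<alpha> \<in> S \<longleftrightarrow> \<alpha> \<in> positive_roots \<Delta> S \<and>
    \<not> (\<exists>\<beta>\<in>positive_roots \<Delta> S. \<exists>\<gamma>\<in>positive_roots \<Delta> S. \<alpha> = \<beta> + \<gamma>)" (is "?l \<longleftrightarrow> ?r")
proof
  assume \<alpha>: ?l
  show ?r
  proof (intro conjI notI)
    show "\<alpha> \<in> positive_roots \<Delta> S"
      using simple_subset_positive[OF S] \<alpha> by auto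
    assume "\<exists>\<beta>\<in>positive_roots \<Delta> S. \<exists>\<gamma>\<in>positive_roots \<Delta> S. \<alpha> = \<beta> + \<gamma>"
    then obtain \<beta> \<gamma> where *: "\<beta> \<in> positive_roots \<Delta> S" "\<gamma> \<in> positive_roots \<Delta> S" "\<alpha> = \<beta> + \<gamma>"
      by blast
    \<comment> \<open>A positive root bounded coordinatewise by a simple root is that root. Both
      summands are so bounded, which leads to \<alpha> = \<alpha> + \<alpha>.\<close>
    have minor: "\<delta> = \<alpha>" if \<delta>: "\<delta> \<in> positive_roots \<Delta> S" and le: "\<And>b. coef S \<delta> b \<le> coef S \<alpha> b" for \<delta>
    proof (rule ccontr)
      assume "\<delta> \<noteq> \<alpha>"
      then obtain b where "b \<in> S" "b \<noteq> \<alpha>" "coef S \<delta> b > 0"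
        using positive_root_other_coef[OF S \<delta> \<alpha>] by blast
      then show False
        using le[of b] by (simp add: coef_simple[OF S \<alpha>])
    qed
    have le: "coef S \<beta> b \<le> coef S \<alpha> b" "coef S \<gamma> b \<le> coef S \<alpha> b" for b
      using * by (auto simp: coef_add[OF S] positive_roots_def)
    have "\<beta> = \<alpha>" "\<gamma> = \<alpha>"
      by (rule minor; use * le in blast)+
    then have "\<alpha> = \<alpha> + \<alpha>"
      using *(3) by metis
    then have "\<alpha> = 0"
      by simp
    then show False
      using \<alpha> zero_notin_roots simple_system_basis(1)[OF S] by blast
  qed
next
  assume r: ?r
  then obtain \<beta> where \<beta>: "\<beta> \<in> S" "coef S \<alpha> \<beta> > 0" "\<alpha> \<bullet> \<beta> > 0"
    using simple_with_pos_inner[OF S, of \<alpha>] by blast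
  show ?l
  proof (rule ccontr)
    assume "\<alpha> \<notin> S"
    then have ne: "\<alpha> \<noteq> \<beta>"
      using \<beta> by auto
    have root: "\<alpha> - \<beta> \<in> \<Delta>"
      using r \<beta> ne simple_system_basis(1)[OF S]
      by (intro diff_root) (auto simp: positive_roots_def)
    obtain \<gamma> where "\<gamma> \<in> S" "\<gamma> \<noteq> \<beta>" "coef S \<alpha> \<gamma> > 0"
      using positive_root_other_coef[OF S _ \<beta>(1) ne] r by blast
    then have "coef S (\<alpha> - \<beta>) \<gamma> > 0"
      by (simp add: coef_diff[OF S] coef_simple[OF S \<beta>(1)])
    then have "\<alpha> - \<beta> \<in> positive_roots \<Delta> S"
      by (rule positive_if_coef_pos[OF S root])
    moreover have "\<beta> \<in> positive_roots \<Delta> S"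
      using simple_subset_positive[OF S] \<beta> by auto
    moreover have "\<alpha> = (\<alpha> - \<beta>) + \<beta>"
      by simp
    ultimately show False
      using r by blast
  qed
qed

lemma simple_system_eqI:
  assumes "simple_system \<Delta> S" "simple_system \<Delta> T" "positive_roots \<Delta> S = positive_roots \<Delta> T"
  shows "S = T"
  by (rule set_eqI)
    (simp only: simple_iff_indecomposable[OF assms(1)] simple_iff_indecomposable[OF assms(2)] assms(3))

text \<open>Nonnegative combinations of \<open>T\<close> are nonnegative on \<open>S\<close>, so one
  set of positive roots contains the other. Each contains exactly one root of every pair of opposite
  roots, so they agree.\<close>

lemma simple_system_eq_if_subset_positive:
  assumes S: "simple_system \<Delta> S" and T: "simple_system \<Delta> T" and sub: "T \<subseteq> positive_roots \<Delta> S"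
  shows "S = T"
proof (rule simple_system_eqI[OF S T])
  have *: "positive_roots \<Delta> T \<subseteq> positive_roots \<Delta> S"
  proof
    fix \<alpha> assume \<alpha>: "\<alpha> \<in> positive_roots \<Delta> T"
    have "coef S \<alpha> b = (\<Sum>t\<in>T. coef T \<alpha> t * coef S t b)" for b
      by (subst sum_coef[OF T, of \<alpha>, symmetric]) (simp add: coef_sum[OF S] coef_scaleR[OF S])
    then show "\<alpha> \<in> positive_roots \<Delta> S"
      using \<alpha> sub unfolding positive_roots_def by (auto intro!: sum_nonneg)
  qed
  show "positive_roots \<Delta> S = positive_roots \<Delta> T"
  proof
    show "positive_roots \<Delta> S \<subseteq> positive_roots \<Delta> T"
    proof
      fix \<alpha> assume \<alpha>: "\<alpha> \<in> positive_roots \<Delta> S"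
      then have "\<alpha> \<in> positive_roots \<Delta> T \<or> - \<alpha> \<in> positive_roots \<Delta> T"
        by (intro positive_root_cases[OF T]) (auto simp: positive_roots_def)
      then show "\<alpha> \<in> positive_roots \<Delta> T"
        using * uminus_notin_positive_roots[OF S \<alpha>] by auto
    qed
  qed (rule *)
qed

text \<open>Induction on the number of root hyperplanes that separate the chamber of \<open>T\<close> from that
  of \<open>S\<close>.\<close>

lemma simple_system_induct:
  assumes S: "simple_system \<Delta> S" and base: "P S"
    and step: "\<And>T \<beta>. simple_system \<Delta> T \<Longrightarrow> \<beta> \<in> T \<Longrightarrow> - \<beta> \<in> positive_roots \<Delta> S \<Longrightarrow>
      P (reflection \<beta> ` T) \<Longrightarrow> P T"
    and "simple_system \<Delta> T"
  shows "P T"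
  using \<open>simple_system \<Delta> T\<close>
proof (induction "card (positive_roots \<Delta> S - positive_roots \<Delta> T)" arbitrary: T rule: less_induct)
  case less
  note T = \<open>simple_system \<Delta> T\<close>
  show ?case
  proof (cases "T \<subseteq> positive_roots \<Delta> S")
    case True
    then show ?thesis
      using simple_system_eq_if_subset_positive[OF S T] base by simp
  next
    case False
    then obtain \<beta> where \<beta>: "\<beta> \<in> T" "\<beta> \<notin> positive_roots \<Delta> S"
      by blast
    then have root: "\<beta> \<in> \<Delta>"
      using simple_system_basis(1)[OF T] by auto
    then have neg: "- \<beta> \<in> positive_roots \<Delta> S"
      using positive_root_cases[OF S] \<beta> by blast
    have pos: "\<beta> \<in> positive_roots \<Delta> T"
      using simple_subset_positive[OF T] \<beta> by auto
    let ?T = "reflection \<beta> ` T"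
    have sys: "simple_system \<Delta> ?T"
      by (rule simple_system_reflection[OF T root])
    \<comment> \<open>A root positive for both \<open>S\<close> and \<open>T\<close> differs from
      \<beta>, so the reflection keeps it positive for \<open>T\<close>. No new separating root
      arises, while - \<beta> ceases to separate.\<close>
    have "positive_roots \<Delta> S - positive_roots \<Delta> ?T \<subseteq> positive_roots \<Delta> S - positive_roots \<Delta> T"
      using reflection_simple_positive[OF T _ \<beta>(1)] \<beta>(2)
      by (auto simp: positive_roots_reflection_iff[OF T root]) metis
    moreover have "- \<beta> \<in> positive_roots \<Delta> S - positive_roots \<Delta> T"
      using neg uminus_notin_positive_roots[OF T pos] by auto
    moreover have "- \<beta> \<in> positive_roots \<Delta> ?T"
      using pos by (simp add: positive_roots_reflection_iff[OF T root] reflection_uminus_right)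
    ultimately have "card (positive_roots \<Delta> S - positive_roots \<Delta> ?T) <
        card (positive_roots \<Delta> S - positive_roots \<Delta> T)"
      by (intro psubset_card_mono) (auto simp: positive_roots_def finite_roots)
    then have "P ?T"
      using less.hyps sys by blast
    then show ?thesis
      using step[OF T \<beta>(1) neg] by blast
  qed
qed

end

section \<open>Weyl chambers\<close>

definition chamber :: "'a::euclidean_space set \<Rightarrow> 'a set" where
  "chamber S = {v. \<forall>b\<in>S. 0 \<le> b \<bullet> v}"

definition open_chamber :: "'a::euclidean_space set \<Rightarrow> 'a set" where
  "open_chamber S = {v. \<forall>b\<in>S. 0 < b \<bullet> v}"

context reduced_root_system
begin

lemma open_chamber_positive_root:
  assumes S: "simple_system \<Delta> S" and "v \<in> open_chamber S" "\<alpha> \<in> positive_roots \<Delta> S"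
  shows "0 < \<alpha> \<bullet> v"
proof -
  obtain b where b: "b \<in> S" "coef S \<alpha> b > 0"
    using simple_with_pos_inner[OF S assms(3)] by blast
  have "0 < (\<Sum>b\<in>S. coef S \<alpha> b * (b \<bullet> v))"
    using assms b simple_system_basis(4)[OF S]
    by (intro sum_pos2[where i = b]) (auto simp: open_chamber_def positive_roots_def less_imp_le)
  then show ?thesis
    by (simp add: inner_sum_coef[OF S, of \<alpha> v])
qed

lemma sum_dual_vectors_in_open_chamber:
  assumes S: "simple_system \<Delta> S"
  shows "(\<Sum>b\<in>S. dual_vector S b) \<in> open_chamber S"
  using simple_system_basis(4)[OF S]
  by (auto simp: open_chamber_def inner_sum_right inner_simple_dual_vector[OF S])

lemma open_chamber_topology:
  assumes S: "simple_system \<Delta> S"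
  shows "open (open_chamber S)" "convex (open_chamber S)"
proof -
  have "open_chamber S = (\<Inter>b\<in>S. {v. 0 < b \<bullet> v})"
    by (auto simp: open_chamber_def)
  then show "open (open_chamber S)" "convex (open_chamber S)"
    using simple_system_basis(4)[OF S]
    by (auto intro!: open_INT convex_INT open_halfspace_gt convex_halfspace_gt)
qed

lemma closure_open_chamber:
  assumes S: "simple_system \<Delta> S"
  shows "closure (open_chamber S) = chamber S"
proof
  have "chamber S = (\<Inter>b\<in>S. {v. 0 \<le> b \<bullet> v})"
    by (auto simp: chamber_def)
  then have "closed (chamber S)"
    by (auto intro!: closed_INT closed_halfspace_ge)
  moreover have "open_chamber S \<subseteq> chamber S"
    by (auto simp: open_chamber_def chamber_def less_imp_le)
  ultimately show "closure (open_chamber S) \<subseteq> chamber S"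
    by (simp add: closure_minimal)
  define r where "r = (\<Sum>b\<in>S. dual_vector S b)"
  show "chamber S \<subseteq> closure (open_chamber S)"
  proof
    fix v assume v: "v \<in> chamber S"
    have "(\<lambda>n. v + (1 / real (Suc n)) *\<^sub>R r) \<longlonglongrightarrow> v + 0 *\<^sub>R r"
      by (intro tendsto_intros LIMSEQ_Suc[OF lim_1_over_n])
    moreover have "v + (1 / real (Suc n)) *\<^sub>R r \<in> open_chamber S" for n
      using v sum_dual_vectors_in_open_chamber[OF S]
      by (auto simp: open_chamber_def chamber_def inner_add_right add_nonneg_pos simp flip: r_def)
    ultimately show "v \<in> closure (open_chamber S)"
      by (auto simp: closure_sequential simp del: of_nat_Suc intro!: exI[of _ "\<lambda>n. v + (1 / real (Suc n)) *\<^sub>R r"])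
  qed
qed

lemma interior_chamber:
  assumes S: "simple_system \<Delta> S"
  shows "interior (chamber S) = open_chamber S"
  using convex_interior_closure[OF open_chamber_topology(2)[OF S]] closure_open_chamber[OF S]
    open_chamber_topology(1)[OF S] by (simp add: interior_open)

text \<open>For maximality, a connected set that contains the open chamber and avoids the wall of
  each simple root cannot change the sign of that root, by the intermediate value theorem.\<close>

lemma open_chamber_component:
  assumes S: "simple_system \<Delta> S"
  shows "open_chamber S \<in> components (UNIV - (\<Union>\<alpha>\<in>\<Delta>. {v. \<alpha> \<bullet> v = 0}))"
  unfolding in_components_maximal
proof (intro conjI allI impI)
  let ?U = "UNIV - (\<Union>\<alpha>\<in>\<Delta>. {v. \<alpha> \<bullet> v = 0})"
  note ne = sum_dual_vectors_in_open_chamber[OF S]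
  show "open_chamber S \<noteq> {}"
    using ne by blast
  show "open_chamber S \<subseteq> ?U"
  proof
    fix v assume v: "v \<in> open_chamber S"
    have "\<alpha> \<bullet> v \<noteq> 0" if "\<alpha> \<in> \<Delta>" for \<alpha>
      using positive_root_cases[OF S that] open_chamber_positive_root[OF S v, of \<alpha>]
        open_chamber_positive_root[OF S v, of "- \<alpha>"] by auto
    then show "v \<in> ?U"
      by auto
  qed
  show "connected (open_chamber S)"
    using open_chamber_topology[OF S] convex_connected by blast
  fix D assume D: "D \<noteq> {} \<and> open_chamber S \<subseteq> D \<and> D \<subseteq> ?U \<and> connected D"
  have "D \<subseteq> open_chamber S"
  proof
    fix y assume "y \<in> D"
    have "0 < b \<bullet> y" if b: "b \<in> S" for b
    proof (rule ccontr)
      assume "\<not> 0 < b \<bullet> y"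
      moreover have "0 < b \<bullet> (\<Sum>b\<in>S. dual_vector S b)"
        using ne b by (simp add: open_chamber_def)
      ultimately obtain z where "z \<in> D" "b \<bullet> z = 0"
        using connected_ivt_hyperplane[of D y "\<Sum>b\<in>S. dual_vector S b" b 0] D ne \<open>y \<in> D\<close>
        by (auto simp: not_less less_imp_le)
      then show False
        using D b simple_system_basis(1)[OF S] by blast
    qed
    then show "y \<in> open_chamber S"
      by (simp add: open_chamber_def)
  qed
  then show "D = open_chamber S"
    using D by blast
qed

text \<open>A point of a component is regular and so defines a simple system. The open chamber of
  that system is a component through the same point, hence the same component.\<close>

lemma weyl_chambers_eq: "weyl_chambers \<Delta> = chamber ` {S. simple_system \<Delta> S}"
proof
  let ?U = "UNIV - (\<Union>\<alpha>\<in>\<Delta>. {v. \<alpha> \<bullet> v = 0})"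
  show "weyl_chambers \<Delta> \<subseteq> chamber ` {S. simple_system \<Delta> S}"
  proof
    fix \<sigma> assume "\<sigma> \<in> weyl_chambers \<Delta>"
    then obtain C where C: "C \<in> components ?U" "\<sigma> = closure C"
      by (auto simp: weyl_chambers_def)
    then obtain x where x: "x \<in> C" "x \<in> ?U"
      using in_components_nonempty[OF C(1)] in_components_subset[OF C(1)] by blast
    then obtain S where S: "simple_system \<Delta> S" "\<And>b. b \<in> S \<Longrightarrow> 0 < b \<bullet> x"
      using exists_simple_system[of x] by auto
    have "C = open_chamber S"
      using components_eq[OF C(1) open_chamber_component[OF S(1)]] x S(2)
      by (auto simp: open_chamber_def)
    then show "\<sigma> \<in> chamber ` {S. simple_system \<Delta> S}"
      using C closure_open_chamber[OF S(1)] S(1) by auto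
  qed
  show "chamber ` {S. simple_system \<Delta> S} \<subseteq> weyl_chambers \<Delta>"
    unfolding weyl_chambers_def using open_chamber_component closure_open_chamber by blast
qed

text \<open>Choose a regular point \<open>x\<close> at which all roots negative at \<open>w\<close>
  are still negative; it exists because the open set \<open>G\<close> is not covered by the null set
  \<open>H\<close>. No simple root of the chamber of \<open>x\<close> can then be negative at
  \<open>w\<close>.\<close>

lemma exists_chamber_containing: "\<exists>S. simple_system \<Delta> S \<and> w \<in> chamber S"
proof -
  define G where "G = (\<Inter>\<alpha>\<in>{\<alpha>\<in>\<Delta>. \<alpha> \<bullet> w < 0}. {x. \<alpha> \<bullet> x < 0})"
  define H where "H = (\<Union>\<alpha>\<in>\<Delta>. {v. \<alpha> \<bullet> v = 0})"
  have "open G"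
    unfolding G_def using finite_roots by (intro open_INT) (auto intro: open_halfspace_lt)
  moreover have "w \<in> G"
    by (auto simp: G_def)
  ultimately have "\<not> negligible G"
    by (metis empty_iff open_not_negligible)
  moreover have "negligible H"
    unfolding H_def using finite_roots zero_notin_roots
    by (intro negligible_Union) (auto intro!: negligible_hyperplane)
  ultimately obtain x where x: "x \<in> G" "x \<notin> H"
    using negligible_subset by blast
  then obtain S where S: "simple_system \<Delta> S" "\<And>b. b \<in> S \<Longrightarrow> 0 < b \<bullet> x"
    using exists_simple_system[of x] by (auto simp: H_def)
  have "0 \<le> b \<bullet> w" if "b \<in> S" for b
  proof (rule ccontr)
    assume "\<not> 0 \<le> b \<bullet> w"
    then have "b \<bullet> x < 0"
      using x(1) that simple_system_basis(1)[OF S(1)] by (auto simp: G_def)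
    then show False
      using S(2)[OF that] by simp
  qed
  then show ?thesis
    using S(1) by (auto simp: chamber_def)
qed

lemma aff_dim_chamber:
  assumes "simple_system \<Delta> S"
  shows "aff_dim (chamber S) = DIM('a)"
  using sum_dual_vectors_in_open_chamber[OF assms] interior_chamber[OF assms]
  by (intro aff_dim_nonempty_interior) auto

lemma convex_chamber: "convex (chamber S)"
proof -
  have "chamber S = (\<Inter>b\<in>S. {v. 0 \<le> b \<bullet> v})"
    by (auto simp: chamber_def)
  then show ?thesis
    by (auto intro!: convex_INT convex_halfspace_ge)
qed

text \<open>The dual vectors of the other simple roots lie in the face and span the whole hyperplane
  orthogonal to \<beta>, which gives codimension one.\<close>

lemma chamber_facet:
  assumes S: "simple_system \<Delta> S" and \<beta>: "\<beta> \<in> S"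
  shows "(chamber S \<inter> {v. \<beta> \<bullet> v = 0}) facet_of chamber S" (is "?F facet_of _")
proof -
  have face: "?F face_of chamber S"
    using \<beta> by (intro face_of_Int_supporting_hyperplane_ge convex_chamber) (auto simp: chamber_def)
  have zero: "0 \<in> ?F"
    by (simp add: chamber_def)
  have "{v. \<beta> \<bullet> v = 0} \<subseteq> span ?F"
  proof
    fix v assume v: "v \<in> {v. \<beta> \<bullet> v = 0}"
    have "(b \<bullet> v) *\<^sub>R dual_vector S b \<in> span ?F" if b: "b \<in> S" for b
    proof (cases "b = \<beta>")
      case False
      then have "dual_vector S b \<in> ?F"
        using b \<beta> by (auto simp: chamber_def inner_simple_dual_vector[OF S])
      then show ?thesis
        by (intro span_scale span_base)
    qed (use v in \<open>simp add: span_zero\<close>)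
    then have "(\<Sum>b\<in>S. (b \<bullet> v) *\<^sub>R dual_vector S b) \<in> span ?F"
      by (rule span_sum)
    then show "v \<in> span ?F"
      by (simp add: sum_dual_vector[OF S])
  qed
  then have "dim {v. \<beta> \<bullet> v = 0} \<le> dim ?F"
    by (metis dim_span dim_subset)
  moreover have "\<beta> \<noteq> 0"
    using \<beta> simple_system_basis(1)[OF S] zero_notin_roots by auto
  ultimately have "DIM('a) - 1 \<le> dim ?F"
    by (simp add: dim_hyperplane)
  moreover have "aff_dim ?F = int (dim ?F)"
    using zero by (intro aff_dim_zero hull_inc)
  moreover have "?F \<noteq> chamber S"
  proof -
    have "dual_vector S \<beta> \<in> chamber S" "\<beta> \<bullet> dual_vector S \<beta> = 1"
      using \<beta> by (auto simp: chamber_def inner_simple_dual_vector[OF S])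
    then show ?thesis
      by force
  qed
  then have "aff_dim ?F < aff_dim (chamber S)"
    by (intro face_of_aff_dim_lt convex_chamber face)
  ultimately show ?thesis
    using face zero aff_dim_chamber[OF S] by (auto simp: facet_of_def)
qed

lemma chamber_Int_reflection:
  assumes "\<beta> \<in> S"
  shows "chamber S \<inter> chamber (reflection \<beta> ` S) = chamber S \<inter> {v. \<beta> \<bullet> v = 0}"
proof
  show "chamber S \<inter> chamber (reflection \<beta> ` S) \<subseteq> chamber S \<inter> {v. \<beta> \<bullet> v = 0}"
  proof
    fix v assume v: "v \<in> chamber S \<inter> chamber (reflection \<beta> ` S)"
    then have "0 \<le> \<beta> \<bullet> v" "0 \<le> reflection \<beta> \<beta> \<bullet> v"
      using assms by (auto simp: chamber_def)
    then show "v \<in> chamber S \<inter> {v. \<beta> \<bullet> v = 0}"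
      using v by simp
  qed
  show "chamber S \<inter> {v. \<beta> \<bullet> v = 0} \<subseteq> chamber S \<inter> chamber (reflection \<beta> ` S)"
    by (auto simp: chamber_def inner_reflection_left reflection_eq_self inner_commute[of _ \<beta>])
qed

lemma adjacent_reflection:
  assumes S: "simple_system \<Delta> S" and \<beta>: "\<beta> \<in> S"
  shows "adjacent (chamber S) (chamber (reflection \<beta> ` S))"
proof -
  have \<beta>': "\<beta> \<in> \<Delta>"
    using \<beta> simple_system_basis(1)[OF S] by auto
  let ?T = "reflection \<beta> ` S"
  have T: "simple_system \<Delta> ?T" "- \<beta> \<in> ?T"
    using simple_system_reflection[OF S \<beta>'] \<beta> by (auto simp: image_iff intro!: bexI[of _ \<beta>])
  have "chamber ?T \<inter> chamber S = chamber ?T \<inter> {v. - \<beta> \<bullet> v = 0}"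
    using chamber_Int_reflection[OF T(2)] by (simp add: reflection_image_image)
  then show ?thesis
    using chamber_facet[OF S \<beta>] chamber_facet[OF T] chamber_Int_reflection[OF \<beta>]
    by (simp add: adjacent_def Int_commute)
qed

text \<open>The uniqueness demanded by \<open>THE\<close>: a separating root is positive for
  \<open>S\<close> and its reflection is negative for \<open>S\<close>, and \<beta> is the only
  positive root that its own reflection makes negative.\<close>

lemma separating_root_reflection:
  assumes S: "simple_system \<Delta> S" and \<beta>: "\<beta> \<in> S"
  shows "separating_root \<Delta> (chamber S) (chamber (reflection \<beta> ` S)) = \<beta>"
  unfolding separating_root_def
proof (rule the_equality)
  have \<beta>': "\<beta> \<in> \<Delta>"
    using \<beta> simple_system_basis(1)[OF S] by auto
  let ?T = "reflection \<beta> ` S"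
  have T: "simple_system \<Delta> ?T" "- \<beta> \<in> ?T"
    using simple_system_reflection[OF S \<beta>'] \<beta> by (auto simp: image_iff intro!: bexI[of _ \<beta>])
  note int = interior_chamber[OF S] interior_chamber[OF T(1)]
  have "\<beta> \<bullet> v < 0" if "v \<in> open_chamber ?T" for v
  proof -
    have "0 < (- \<beta>) \<bullet> v"
      using that T(2) unfolding open_chamber_def by blast
    then show ?thesis
      by simp
  qed
  then show "\<beta> \<in> \<Delta> \<and> (\<forall>v\<in>interior (chamber S). 0 < \<beta> \<bullet> v) \<and>
      (\<forall>v\<in>interior (chamber ?T). \<beta> \<bullet> v < 0)"
    using \<beta> \<beta>' unfolding int by (auto simp: open_chamber_def)
  fix \<alpha>
  assume *: "\<alpha> \<in> \<Delta> \<and> (\<forall>v\<in>interior (chamber S). 0 < \<alpha> \<bullet> v) \<and>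
      (\<forall>v\<in>interior (chamber ?T). \<alpha> \<bullet> v < 0)"
  have pos: "\<alpha> \<in> positive_roots \<Delta> S"
  proof (rule ccontr)
    assume "\<alpha> \<notin> positive_roots \<Delta> S"
    then have "- \<alpha> \<in> positive_roots \<Delta> S"
      using positive_root_cases[OF S] * by blast
    from open_chamber_positive_root[OF S sum_dual_vectors_in_open_chamber[OF S] this]
    show False
      using * sum_dual_vectors_in_open_chamber[OF S] by (fastforce simp: int)
  qed
  have "- \<alpha> \<in> positive_roots \<Delta> ?T"
  proof (rule ccontr)
    assume "- \<alpha> \<notin> positive_roots \<Delta> ?T"
    then have "\<alpha> \<in> positive_roots \<Delta> ?T"
      using positive_root_cases[OF T(1)] * by blast
    from open_chamber_positive_root[OF T(1) sum_dual_vectors_in_open_chamber[OF T(1)] this]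
    show False
      using * sum_dual_vectors_in_open_chamber[OF T(1)] by (fastforce simp: int)
  qed
  then have "- reflection \<beta> \<alpha> \<in> positive_roots \<Delta> S"
    by (simp add: positive_roots_reflection_iff[OF S \<beta>'] reflection_uminus_right)
  then show "\<alpha> = \<beta>"
    using reflection_simple_positive[OF S pos \<beta>] uminus_notin_positive_roots[OF S] by blast
qed

end

section \<open>Ample polytopes\<close>

lemma group_closure_of_int_scaleR:
  fixes x :: "'a::real_vector"
  assumes "x \<in> group_closure A"
  shows "of_int k *\<^sub>R x \<in> group_closure A"
proof (induction k rule: int_induct[of _ 0])
  case (step1 i)
  then show ?case
    using assms by (simp add: scaleR_left_distrib group_closure_add)
next
  case (step2 i)
  then show ?case
    using assms by (simp add: scaleR_left_diff_distrib group_closure.diff)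
qed simp

text \<open>Bounds the dimension of the polytope, and that of its faces, from below by the edge
  directions at a single vertex.\<close>

lemma aff_dim_ge_card_directions:
  fixes J :: "'a::euclidean_space set"
  assumes "independent J" "p \<in> A" "\<And>b. b \<in> J \<Longrightarrow> \<exists>r. r \<noteq> 0 \<and> p - r *\<^sub>R b \<in> A"
  shows "int (card J) \<le> aff_dim A"
proof -
  let ?X = "(\<lambda>x. x - p) ` A"
  have "J \<subseteq> span ?X"
  proof
    fix b assume "b \<in> J"
    then obtain r where r: "r \<noteq> 0" "p - r *\<^sub>R b \<in> A"
      using assms(3) by blast
    then have "(p - r *\<^sub>R b) - p \<in> span ?X"
      by (intro span_base) blast
    then have "(- 1 / r) *\<^sub>R ((p - r *\<^sub>R b) - p) \<in> span ?X"
      by (rule span_scale)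
    then show "b \<in> span ?X"
      using r(1) by simp
  qed
  then have "dim J \<le> dim ?X"
    by (metis dim_span dim_subset)
  then show ?thesis
    using assms(1) by (simp add: dim_eq_card_independent aff_dim_eq_dim_subtract[OF hull_inc[OF assms(2)]])
qed

context reduced_root_system
begin

text \<open>Vertices maximize coordinates whereas facet normals point inward. Passing to the
  opposite simple system absorbs this sign.\<close>

lemma simple_system_uminus:
  assumes S: "simple_system \<Delta> S"
  shows "simple_system \<Delta> (uminus ` S)"
    and "coef (uminus ` S) u b = coef S (- u) (- b)"
proof -
  note basis = simple_system_basis[OF S]
  have lin: "linear (uminus :: 'a \<Rightarrow> 'a)" and inj: "inj (uminus :: 'a \<Rightarrow> 'a)"
    by (simp_all add: linear_iff)
  show *: "coef (uminus ` S) u b = coef S (- u) (- b)" for u b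
    using representation_linear_image[OF lin inj basis(2,3), of "- u" "- b"] by simp
  show "simple_system \<Delta> (uminus ` S)"
    unfolding simple_system_def
  proof (intro conjI ballI)
    show "uminus ` S \<subseteq> \<Delta>"
      using basis(1) uminus_root by auto
    show "independent (uminus ` S)"
      using linear_independent_injective_image[OF lin basis(2)] inj inj_on_subset by blast
    show "span (uminus ` S) = UNIV"
      using basis(3) by (simp add: linear_span_image[OF lin] surj_uminus)
    fix \<alpha> assume "\<alpha> \<in> \<Delta>"
    then show "(\<forall>b. coef (uminus ` S) \<alpha> b \<in> \<nat>) \<or> (\<forall>b. - coef (uminus ` S) \<alpha> b \<in> \<nat>)"
      using coef_root_cases[OF S uminus_root, of \<alpha>] by (simp add: *) blast
  qed
qed

lemma dual_vector_uminus:
  assumes S: "simple_system \<Delta> S"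
  shows "dual_vector (uminus ` S) (- b) = - dual_vector S b"
proof (rule simple_system_vector_eqI[OF S])
  fix a
  have "a \<bullet> dual_vector (uminus ` S) (- b) = coef S (- a) b"
    by (simp add: inner_dual_vector[OF simple_system_uminus(1)[OF S]] simple_system_uminus(2)[OF S])
  then show "a \<bullet> dual_vector (uminus ` S) (- b) = a \<bullet> - dual_vector S b"
    using inner_dual_vector[OF S, of "- a" b] by simp
qed

lemma root_lattice_eq:
  assumes S: "simple_system \<Delta> S"
  shows "root_lattice \<Delta> = {u. \<forall>b\<in>S. coef S u b \<in> \<int>}"
proof
  have "coef S u b \<in> \<int>" if "u \<in> group_closure \<Delta>" for u b
    using that
  proof induction
    case (base s)
    then consider "s = 0" | "s \<in> \<Delta>" by blast
    then show ?case
    proof cases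
      case 2
      from coef_root_cases[OF S this] show ?thesis
        using Nats_subset_Ints Ints_minus[of "- coef S s b"] by auto
    qed (simp add: representation_zero)
  next
    case (diff s t)
    then show ?case
      by (simp add: coef_diff[OF S])
  qed
  then show "root_lattice \<Delta> \<subseteq> {u. \<forall>b\<in>S. coef S u b \<in> \<int>}"
    by (auto simp: root_lattice_def)
  show "{u. \<forall>b\<in>S. coef S u b \<in> \<int>} \<subseteq> root_lattice \<Delta>"
  proof
    fix u assume u: "u \<in> {u. \<forall>b\<in>S. coef S u b \<in> \<int>}"
    have "(\<Sum>b\<in>S'. coef S u b *\<^sub>R b) \<in> group_closure \<Delta>" if "S' \<subseteq> S" for S'
      using finite_subset[OF that simple_system_basis(4)[OF S]] that
    proof (induction S')
      case (insert b S')
      then obtain k where "coef S u b = of_int k"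
        using u insert.prems by (metis (mono_tags, lifting) Ints_cases insert_subset mem_Collect_eq)
      moreover have "b \<in> group_closure \<Delta>"
        using insert simple_system_basis(1)[OF S] by (auto intro: group_closure.base)
      ultimately have "coef S u b *\<^sub>R b \<in> group_closure \<Delta>"
        by (simp add: group_closure_of_int_scaleR)
      then show ?case
        using insert by (simp add: group_closure_add)
    qed simp
    from this[of S] show "u \<in> root_lattice \<Delta>"
      by (simp add: sum_coef[OF S] root_lattice_def)
  qed
qed

text \<open>The functional takes the value 1 at the lattice vector \<open>b\<close>, so no proper
  fraction of it is integral on the lattice.\<close>

lemma dual_vector_primitive:
  assumes S: "simple_system \<Delta> S" and b: "b \<in> S"
  shows "primitive_in (dual_lattice (root_lattice \<Delta>)) (dual_vector S b)"
  unfolding primitive_in_def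
proof (intro conjI allI impI)
  show "dual_vector S b \<in> dual_lattice (root_lattice \<Delta>)"
    using b by (auto simp: dual_lattice_def root_lattice_eq[OF S] inner_dual_vector[OF S])
  have one: "b \<bullet> dual_vector S b = 1"
    using b by (simp add: inner_simple_dual_vector[OF S])
  then show "dual_vector S b \<noteq> 0"
    by auto
  fix k :: nat assume k: "k \<ge> 2"
  show "dual_vector S b /\<^sub>R real k \<notin> dual_lattice (root_lattice \<Delta>)"
  proof
    assume "dual_vector S b /\<^sub>R real k \<in> dual_lattice (root_lattice \<Delta>)"
    moreover have "b \<in> root_lattice \<Delta>"
      by (auto simp: root_lattice_eq[OF S] coef_simple[OF S b])
    ultimately have "1 / real k \<in> \<int>"
      using one by (auto simp: dual_lattice_def inverse_eq_divide)
    then obtain j :: int where j: "1 / real k = of_int j"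
      by (auto elim: Ints_cases)
    have "0 < 1 / real k" "1 / real k < 1"
      using k by auto
    then show False
      unfolding j by simp
  qed
qed

end

section \<open>Vertices and facet normals of an ample polytope\<close>

locale ample_vertices = reduced_root_system \<Delta> for \<Delta> :: "'a::euclidean_space set" +
  fixes P :: "'a set" and \<nu> :: "'a set \<Rightarrow> 'a"
  assumes polytope: "polytope P"
    and vertices: "{x. x extreme_point_of P} = \<nu> ` {S. simple_system \<Delta> S}"
    and edge: "simple_system \<Delta> S \<Longrightarrow> b \<in> S \<Longrightarrow> \<exists>r>0. \<nu> S - \<nu> (reflection b ` S) = r *\<^sub>R b"
begin

lemma convex_P: "convex P"
  by (rule polytope_imp_convex[OF polytope])

lemma vertex_in: "simple_system \<Delta> S \<Longrightarrow> \<nu> S \<in> P"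
  using vertices extreme_point_of_def by blast

text \<open>Crossing the wall of \<beta> towards \<open>S\<close> adds a positive multiple of -
  \<beta>, a positive root of \<open>S\<close>. Every coordinate with respect to \<open>S\<close>
  therefore grows weakly along a gallery that ends at \<open>S\<close>.\<close>

lemma vertex_coef_max:
  assumes S: "simple_system \<Delta> S" and T: "simple_system \<Delta> T"
  shows "coef S (\<nu> T) b \<le> coef S (\<nu> S) b"
proof (rule simple_system_induct[OF S _ _ T, where P = "\<lambda>T. coef S (\<nu> T) b \<le> coef S (\<nu> S) b"])
  fix T \<beta>
  assume T: "simple_system \<Delta> T" "\<beta> \<in> T" and neg: "- \<beta> \<in> positive_roots \<Delta> S"
    and IH: "coef S (\<nu> (reflection \<beta> ` T)) b \<le> coef S (\<nu> S) b"
  obtain r where r: "r > 0" "\<nu> T - \<nu> (reflection \<beta> ` T) = r *\<^sub>R \<beta>"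
    using edge[OF T] by blast
  have "coef S (\<nu> T) b - coef S (\<nu> (reflection \<beta> ` T)) b = r * coef S \<beta> b"
    using arg_cong[OF r(2), of "\<lambda>u. coef S u b"] by (simp add: coef_diff[OF S] coef_scaleR[OF S])
  moreover have "coef S \<beta> b \<le> 0"
    using neg by (auto simp: positive_roots_def coef_uminus[OF S])
  ultimately show "coef S (\<nu> T) b \<le> coef S (\<nu> S) b"
    using IH r(1) mult_nonneg_nonpos[of r "coef S \<beta> b"] by linarith
qed simp

lemma coef_max:
  assumes S: "simple_system \<Delta> S" and x: "x \<in> P"
  shows "coef S x b \<le> coef S (\<nu> S) b"
proof -
  let ?H = "{x. dual_vector S b \<bullet> x \<le> dual_vector S b \<bullet> \<nu> S}"
  have "P = convex hull {x. x extreme_point_of P}"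
    using polytope by (intro Krein_Milman_Minkowski polytope_imp_compact polytope_imp_convex)
  also have "\<dots> \<subseteq> ?H"
  proof (rule hull_minimal)
    show "{x. x extreme_point_of P} \<subseteq> ?H"
      unfolding vertices using vertex_coef_max[OF S]
      by (auto simp: inner_dual_vector[OF S] inner_commute[of "dual_vector S b"])
  qed (rule convex_halfspace_le)
  finally show ?thesis
    using x by (auto simp: inner_dual_vector[OF S] inner_commute[of "dual_vector S b"])
qed

lemma aff_dim_P: "aff_dim P = DIM('a)"
proof -
  obtain S where S: "simple_system \<Delta> S"
    using exists_chamber_containing by blast
  have "int (card S) \<le> aff_dim P"
  proof (rule aff_dim_ge_card_directions[of S "\<nu> S" P])
    fix b assume b: "b \<in> S"
    then obtain r where r: "r > 0" "\<nu> S - \<nu> (reflection b ` S) = r *\<^sub>R b"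
      using edge[OF S] by blast
    then have "\<nu> S - r *\<^sub>R b = \<nu> (reflection b ` S)"
      by (simp add: algebra_simps)
    moreover have "simple_system \<Delta> (reflection b ` S)"
      using b simple_system_basis(1)[OF S] by (intro simple_system_reflection[OF S]) auto
    ultimately show "\<exists>r. r \<noteq> 0 \<and> \<nu> S - r *\<^sub>R b \<in> P"
      using r vertex_in by (intro exI[of _ r]) auto
  qed (use simple_system_basis[OF S] vertex_in[OF S] in auto)
  then show ?thesis
    using aff_dim_le_DIM[of P] card_simple_system[OF S] by simp
qed

text \<open>The edges at \<open>\<nu> S\<close> in the directions of the simple roots other than
  \<beta> keep the coordinate at \<beta> maximal. They provide n - 1 independent directions in the
  face, while the remaining edge leaves it.\<close>

lemma uminus_dual_vector_normal:
  assumes S: "simple_system \<Delta> S" and \<beta>: "\<beta> \<in> S"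
  shows "- dual_vector S \<beta> \<in> inward_normal_generators (root_lattice \<Delta>) P"
proof -
  let ?v = "- dual_vector S \<beta>" and ?c = "- coef S (\<nu> S) \<beta>"
  let ?f = "{x\<in>P. x \<bullet> ?v = ?c}"
  have ge: "?c \<le> x \<bullet> ?v" if "x \<in> P" for x
    using coef_max[OF S that, of \<beta>] by (simp add: inner_dual_vector[OF S])
  have face: "?f face_of P"
    using face_of_Int_supporting_hyperplane_ge[OF convex_P, of ?c ?v] ge
    by (simp add: Int_def inner_commute[of "dual_vector S \<beta>"])
  have reflected: "\<nu> (reflection b ` S) \<in> P \<and> (\<exists>r>0. \<nu> (reflection b ` S) = \<nu> S - r *\<^sub>R b)"
    if "b \<in> S" for b
  proof -
    obtain r where "r > 0" "\<nu> S - \<nu> (reflection b ` S) = r *\<^sub>R b"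
      using edge[OF S \<open>b \<in> S\<close>] by blast
    moreover have "simple_system \<Delta> (reflection b ` S)"
      using that simple_system_basis(1)[OF S] by (intro simple_system_reflection[OF S]) auto
    ultimately show ?thesis
      using vertex_in by (auto simp: algebra_simps intro!: exI[of _ r])
  qed
  have "\<nu> S \<in> ?f"
    using vertex_in[OF S] by (simp add: inner_dual_vector[OF S])
  moreover have "\<exists>r. r \<noteq> 0 \<and> \<nu> S - r *\<^sub>R b \<in> ?f" if "b \<in> S - {\<beta>}" for b
  proof -
    obtain r where "r > 0" "\<nu> S - r *\<^sub>R b \<in> P"
      using reflected[of b] \<open>b \<in> S - {\<beta>}\<close> by auto
    then show ?thesis
      using that by (intro exI[of _ r])
        (auto simp: inner_dual_vector[OF S] coef_diff[OF S] coef_scaleR[OF S] coef_simple[OF S])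
  qed
  ultimately have "int (card (S - {\<beta>})) \<le> aff_dim ?f"
    using simple_system_basis(2)[OF S] independent_mono[of S "S - {\<beta>}"]
    by (intro aff_dim_ge_card_directions) auto
  then have "int (DIM('a)) - 1 \<le> aff_dim ?f"
    using \<beta> simple_system_basis(4)[OF S] card_simple_system[OF S] by simp
  moreover have "?f \<noteq> P"
  proof -
    obtain r where "r > 0" "\<nu> S - r *\<^sub>R \<beta> \<in> P"
      using reflected[OF \<beta>] by auto
    then have "\<nu> S - r *\<^sub>R \<beta> \<in> P - ?f"
      by (simp add: inner_dual_vector[OF S] coef_diff[OF S] coef_scaleR[OF S] coef_simple[OF S \<beta>])
    then show ?thesis
      by blast
  qed
  then have "aff_dim ?f < aff_dim P"
    by (intro face_of_aff_dim_lt convex_P face)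
  ultimately have "?f facet_of P"
    using face \<open>\<nu> S \<in> ?f\<close> aff_dim_P by (auto simp: facet_of_def)
  moreover have "primitive_in (dual_lattice (root_lattice \<Delta>)) ?v"
    using dual_vector_primitive[OF simple_system_uminus(1)[OF S], of "- \<beta>"] \<beta>
    by (simp add: dual_vector_uminus[OF S])
  ultimately show ?thesis
    using ge unfolding inward_normal_generators_def by blast
qed

text \<open>If - v lies in the chamber of \<open>S\<close>, then \<open>v\<close> is minimal at
  \<open>\<nu> S\<close>, and its face lies in \<open>\<nu> S\<close> plus the span of the simple
  roots orthogonal to \<open>v\<close>. The dimension of a facet leaves just one simple root not
  orthogonal to \<open>v\<close>.\<close>

lemma normal_is_uminus_dual_vector:
  assumes "v \<in> inward_normal_generators (root_lattice \<Delta>) P"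
  obtains S \<beta> where "simple_system \<Delta> S" "\<beta> \<in> S" "v = - dual_vector S \<beta>"
proof -
  obtain f c where f: "f facet_of P" "\<And>x. x \<in> P \<Longrightarrow> c \<le> x \<bullet> v" "f = {x\<in>P. x \<bullet> v = c}"
    and prim: "primitive_in (dual_lattice (root_lattice \<Delta>)) v"
    using assms by (auto simp: inward_normal_generators_def)
  obtain S where S: "simple_system \<Delta> S" and "- v \<in> chamber S"
    using exists_chamber_containing by blast
  then have nonpos: "b \<bullet> v \<le> 0" if "b \<in> S" for b
    using that by (auto simp: chamber_def)
  note basis = simple_system_basis[OF S]
  \<comment> \<open>The increase of \<open>v\<close> from the vertex is a sum of products of two
    nonnegative factors, so on the facet each product vanishes separately.\<close>
  have expand: "x \<bullet> v - \<nu> S \<bullet> v = (\<Sum>b\<in>S. (coef S (\<nu> S) b - coef S x b) * - (b \<bullet> v))" for x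
    using inner_sum_coef[OF S, of "x - \<nu> S" v] by (simp add: inner_diff_left coef_diff[OF S] algebra_simps)
  have summand: "0 \<le> (coef S (\<nu> S) b - coef S x b) * - (b \<bullet> v)" if "x \<in> P" "b \<in> S" for x b
    using nonpos[OF that(2)] coef_max[OF S that(1), of b] by (intro mult_nonneg_nonneg) auto
  obtain x0 where x0: "x0 \<in> P" "x0 \<bullet> v = c"
    using f by (auto simp: facet_of_def)
  have "0 \<le> x0 \<bullet> v - \<nu> S \<bullet> v"
    unfolding expand using summand[OF x0(1)] by (intro sum_nonneg)
  then have c: "\<nu> S \<bullet> v = c"
    using f(2)[OF vertex_in[OF S]] x0 by simp
  define K where "K = {b\<in>S. b \<bullet> v \<noteq> 0}"
  have "(\<lambda>x. x - \<nu> S) ` f \<subseteq> span (S - K)"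
  proof clarify
    fix x assume "x \<in> f"
    then have x: "x \<in> P" "x \<bullet> v = c"
      using f(3) by auto
    have "(\<Sum>b\<in>S. (coef S (\<nu> S) b - coef S x b) * - (b \<bullet> v)) = 0"
      using expand[of x] x c by simp
    then have zero: "\<forall>b\<in>S. (coef S (\<nu> S) b - coef S x b) * - (b \<bullet> v) = 0"
      using summand[OF x(1)] basis(4) by (subst (asm) sum_nonneg_eq_0_iff) auto
    have "coef S (x - \<nu> S) b *\<^sub>R b \<in> span (S - K)" if "b \<in> S" for b
    proof (cases "b \<in> K")
      case True
      then have "coef S (x - \<nu> S) b = 0"
        using zero by (auto simp: K_def coef_diff[OF S])
      then show ?thesis
        by (simp add: span_zero)
    qed (use that in \<open>auto intro: span_scale span_base\<close>)
    then have "(\<Sum>b\<in>S. coef S (x - \<nu> S) b *\<^sub>R b) \<in> span (S - K)"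
      by (rule span_sum)
    then show "x - \<nu> S \<in> span (S - K)"
      by (simp add: sum_coef[OF S])
  qed
  then have "dim ((\<lambda>x. x - \<nu> S) ` f) \<le> card (S - K)"
    using basis(4) by (intro dim_le_card) auto
  moreover have "\<nu> S \<in> f"
    using f(3) c vertex_in[OF S] by simp
  then have "aff_dim f = int (dim ((\<lambda>x. x - \<nu> S) ` f))"
    by (intro aff_dim_eq_dim_subtract hull_inc)
  moreover have "aff_dim f = int (DIM('a)) - 1"
    using f(1) aff_dim_P by (simp add: facet_of_def)
  moreover have "card (S - K) = DIM('a) - card K" and "card K \<le> DIM('a)"
    using basis(4) card_simple_system[OF S] card_mono[of S K]
    by (auto simp: K_def card_Diff_subset)
  ultimately have "card K \<le> 1"
    by linarith
  moreover have "K \<noteq> {}"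
  proof
    assume "K = {}"
    then have "v = 0"
      by (intro simple_system_vector_eqI[OF S]) (auto simp: K_def)
    then show False
      using prim by (simp add: primitive_in_def)
  qed
  moreover have "finite K"
    using basis(4) by (simp add: K_def)
  ultimately have "card K = 1"
    by (metis One_nat_def Suc_leI card_gt_0_iff le_antisym)
  then obtain \<beta> where K: "K = {\<beta>}"
    by (auto simp: card_1_singleton_iff)
  then have \<beta>: "\<beta> \<in> S" "\<beta> \<bullet> v < 0"
    using nonpos[of \<beta>] unfolding K_def by (auto simp: set_eq_iff order.strict_iff_order)
  have v: "v = (\<beta> \<bullet> v) *\<^sub>R dual_vector S \<beta>"
  proof (rule simple_system_vector_eqI[OF S])
    fix b assume "b \<in> S"
    then show "b \<bullet> v = b \<bullet> ((\<beta> \<bullet> v) *\<^sub>R dual_vector S \<beta>)"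
      using K by (auto simp: inner_simple_dual_vector[OF S] K_def set_eq_iff)
  qed
  have "\<beta> \<in> root_lattice \<Delta>"
    by (auto simp: root_lattice_eq[OF S] coef_simple[OF S \<beta>(1)])
  then have "\<beta> \<bullet> v \<in> \<int>"
    using prim by (auto simp: primitive_in_def dual_lattice_def)
  then obtain j :: int where j: "\<beta> \<bullet> v = of_int j"
    by (auto elim: Ints_cases)
  \<comment> \<open>The vector \<open>v\<close> is \<open>k\<close> times a vector of the dual
    lattice, so primitivity forces k = 1.\<close>
  define k where "k = nat (- j)"
  have k: "\<beta> \<bullet> v = - real k" "k > 0"
    using j \<beta>(2) by (auto simp: k_def)
  have "v /\<^sub>R real k = - dual_vector S \<beta>"
    using v k by simp
  moreover have "- dual_vector S \<beta> \<in> dual_lattice (root_lattice \<Delta>)"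
    using dual_vector_primitive[OF simple_system_uminus(1)[OF S], of "- \<beta>"] \<beta>
    by (simp add: dual_vector_uminus[OF S] primitive_in_def)
  ultimately have "\<not> k \<ge> 2"
    using prim unfolding primitive_in_def by metis
  then have "k = 1"
    using k(2) by simp
  then have "v = - dual_vector S \<beta>"
    using v k(1) by simp
  then show ?thesis
    using that S \<beta>(1) by blast
qed

theorem inward_normal_generators_eq:
  "inward_normal_generators (root_lattice \<Delta>) P = {dual_vector S b | S b. simple_system \<Delta> S \<and> b \<in> S}"
proof (intro equalityI subsetI)
  fix v assume "v \<in> inward_normal_generators (root_lattice \<Delta>) P"
  then obtain S \<beta> where S: "simple_system \<Delta> S" "\<beta> \<in> S" "v = - dual_vector S \<beta>"
    by (rule normal_is_uminus_dual_vector)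
  then have "v = dual_vector (uminus ` S) (- \<beta>)" "- \<beta> \<in> uminus ` S"
    by (simp_all only: dual_vector_uminus[OF S(1)] imageI)
  then show "v \<in> {dual_vector S b | S b. simple_system \<Delta> S \<and> b \<in> S}"
    using simple_system_uminus(1)[OF S(1)] by blast
next
  fix v assume "v \<in> {dual_vector S b | S b. simple_system \<Delta> S \<and> b \<in> S}"
  then obtain S \<beta> where *: "simple_system \<Delta> S" "\<beta> \<in> S" "v = dual_vector S \<beta>"
    by blast
  then have "v = - dual_vector (uminus ` S) (- \<beta>)"
    by (simp only: dual_vector_uminus[OF *(1)] minus_minus)
  then show "v \<in> inward_normal_generators (root_lattice \<Delta>) P"
    using uminus_dual_vector_normal[OF simple_system_uminus(1)[OF *(1)], of "- \<beta>"] *(2)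
    by (simp only: imageI)
qed

end

context reduced_root_system
begin

text \<open>Indexing the vertices by simple systems instead of chambers turns adjacency into a
  simple reflection and the separating root into the simple root of the wall.\<close>

lemma ample_polytope_vertices:
  assumes "ample_polytope \<Delta> P"
  shows "\<exists>\<nu>. ample_vertices \<Delta> P \<nu>"
proof -
  obtain \<mu> where \<mu>: "polytope P" "{x. x extreme_point_of P} = \<mu> ` weyl_chambers \<Delta>"
    "\<And>\<sigma> \<sigma>'. \<sigma> \<in> weyl_chambers \<Delta> \<Longrightarrow> \<sigma>' \<in> weyl_chambers \<Delta> \<Longrightarrow> adjacent \<sigma> \<sigma>' \<Longrightarrow>
      \<exists>r::int. r > 0 \<and> \<mu> \<sigma> - \<mu> \<sigma>' = of_int r *\<^sub>R separating_root \<Delta> \<sigma> \<sigma>'"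
    using assms unfolding ample_polytope_def by (elim conjE exE) metis
  have "ample_vertices \<Delta> P (\<lambda>S. \<mu> (chamber S))"
  proof unfold_locales
    show "{x. x extreme_point_of P} = (\<lambda>S. \<mu> (chamber S)) ` {S. simple_system \<Delta> S}"
      using \<mu>(2) by (simp add: weyl_chambers_eq image_image)
    fix S b assume S: "simple_system \<Delta> S" and b: "b \<in> S"
    then have T: "simple_system \<Delta> (reflection b ` S)"
      using simple_system_basis(1)[OF S] by (intro simple_system_reflection) auto
    have "chamber S \<in> weyl_chambers \<Delta>" "chamber (reflection b ` S) \<in> weyl_chambers \<Delta>"
      using S T unfolding weyl_chambers_eq by blast+
    then obtain r :: int where "r > 0"
      "\<mu> (chamber S) - \<mu> (chamber (reflection b ` S)) = of_int r *\<^sub>R b"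
      using \<mu>(3)[OF _ _ adjacent_reflection[OF S b]]
      unfolding separating_root_reflection[OF S b] by blast
    then show "\<exists>r>0. \<mu> (chamber S) - \<mu> (chamber (reflection b ` S)) = r *\<^sub>R b"
      by (intro exI[of _ "of_int r"]) auto
  qed (rule \<mu>(1))
  then show ?thesis
    by blast
qed

end

section \<open>Diagonal splitting in terms of simple systems\<close>

definition splitting_box :: "'a::euclidean_space set \<Rightarrow> 'a set" where
  "splitting_box \<Delta> = {u. \<forall>S b. simple_system \<Delta> S \<longrightarrow> b \<in> S \<longrightarrow> \<bar>coef S u b\<bar> < 1}"

text \<open>A class of the fractional lattice modulo the lattice is given by the integral numerators
  of its coordinates in one fixed \<open>S\<close>; the box alone still refers to all simple
  systems.\<close>

definition box_split :: "'a::euclidean_space set \<Rightarrow> 'a set \<Rightarrow> nat \<Rightarrow> bool" where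
  "box_split \<Delta> S q \<longleftrightarrow>
     (\<forall>k :: 'a \<Rightarrow> int. \<exists>u\<in>splitting_box \<Delta>. \<forall>b\<in>S. coef S u b - of_int (k b) / real q \<in> \<int>)"

lemma cartan_number_reflection:
  "cartan_number (reflection \<gamma> u) \<beta> = cartan_number u \<beta> - cartan_number u \<gamma> * cartan_number \<gamma> \<beta>"
  using cartan_number_add[of u "- cartan_number u \<gamma> *\<^sub>R \<gamma>" \<beta>]
    cartan_number_scaleR[of "- cartan_number u \<gamma>" \<gamma> \<beta>]
  by (simp add: reflection_eq)

text \<open>Expresses the pairings of a reflected vector with simple roots through the old pairings
  and Cartan numbers, so that stability of an explicit set under reflections becomes a finite
  check.\<close>

lemma inner_reflection_right:
  "y \<bullet> reflection \<alpha> v = y \<bullet> v - (\<alpha> \<bullet> v) * cartan_number y \<alpha>"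
  by (simp add: reflection_def cartan_number_def inner_diff_right inner_commute)

text \<open>Lists the candidates for the numerator of a representative in the box; all case
  distinctions on representatives in the obstructions start from it.\<close>

lemma int_dvd_diff_cases:
  fixes m k q :: int
  assumes "q dvd m - k" "\<bar>m\<bar> < q" "0 \<le> k" "k < q"
  shows "m = k \<or> m = k - q"
proof -
  obtain j where j: "m - k = q * j"
    using assms(1) by (elim dvdE)
  have "q > 0"
    using assms by linarith
  have "q * j < q * 1" "q * (- 2) < q * j"
    using assms j by linarith+
  then have "j < 1" "- 2 < j"
    using mult_less_cancel_left_pos[OF \<open>q > 0\<close>] by blast+
  then have "j = 0 \<or> j = -1"
    by auto
  then show ?thesis
    using j by auto
qed

context reduced_root_system
begin

lemma open_splitting_polytope_eq:
  assumes "ample_polytope \<Delta> P"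
  shows "open_splitting_polytope (root_lattice \<Delta>) P = splitting_box \<Delta>"
proof -
  obtain \<nu> where "ample_vertices \<Delta> P \<nu>"
    using ample_polytope_vertices[OF assms] by blast
  then interpret ample_vertices \<Delta> P \<nu> .
  show ?thesis
    unfolding open_splitting_polytope_def splitting_box_def inward_normal_generators_eq
    by (auto simp: inner_dual_vector abs_less_iff)
      (metis inner_dual_vector minus_less_iff)+
qed

lemma root_lattice_uminus: "x \<in> root_lattice \<Delta> \<Longrightarrow> - x \<in> root_lattice \<Delta>"
  and root_lattice_add:
    "x \<in> root_lattice \<Delta> \<Longrightarrow> y \<in> root_lattice \<Delta> \<Longrightarrow> x + y \<in> root_lattice \<Delta>"
  and root_lattice_scaleR: "x \<in> root_lattice \<Delta> \<Longrightarrow> real n *\<^sub>R x \<in> root_lattice \<Delta>"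
  using group_closure_of_int_scaleR[of x \<Delta> "int n"]
  by (simp_all add: root_lattice_def group_closure_add)

lemma diagonally_split_iff_box_split:
  assumes P: "ample_polytope \<Delta> P" and S: "simple_system \<Delta> S" and q: "q > 0"
  shows "diagonally_split (root_lattice \<Delta>) P q \<longleftrightarrow> box_split \<Delta> S q"
proof
  let ?Y = "root_lattice \<Delta>" and ?R = "{(x, y). x - y \<in> root_lattice \<Delta>}"
  note basis = simple_system_basis[OF S]
  assume split: "diagonally_split ?Y P q"
  show "box_split \<Delta> S q"
    unfolding box_split_def
  proof
    fix k :: "'a \<Rightarrow> int"
    define y where "y = (\<Sum>b\<in>S. of_int (k b) *\<^sub>R b)"
    have coef_y: "coef S y b = of_int (k b)" if "b \<in> S" for b
      using that basis(4)
      by (simp add: y_def coef_sum[OF S] coef_scaleR[OF S] coef_simple[OF S] if_distrib cong: if_cong)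
    then have "y \<in> ?Y"
      by (simp add: root_lattice_eq[OF S])
    then have "?R `` {y /\<^sub>R real q} \<in> fractional_lattice q ?Y // ?R"
      unfolding fractional_lattice_def by (intro quotientI imageI)
    from bspec[OF split[unfolded diagonally_split_def] this]
    obtain u where "u \<in> ?R `` {y /\<^sub>R real q}" "u \<in> open_splitting_polytope ?Y P"
      by blast
    then have u: "u \<in> splitting_box \<Delta>" "y /\<^sub>R real q - u \<in> ?Y"
      by (simp_all add: open_splitting_polytope_eq[OF P])
    have "coef S u b - of_int (k b) / real q \<in> \<int>" if b: "b \<in> S" for b
    proof -
      have "coef S (y /\<^sub>R real q - u) b \<in> \<int>"
        using u(2) b by (simp add: root_lattice_eq[OF S])
      then have "- coef S (y /\<^sub>R real q - u) b \<in> \<int>"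
        by simp
      then show ?thesis
        by (simp add: coef_diff[OF S] coef_scaleR[OF S] coef_y[OF b] inverse_eq_divide)
    qed
    then show "\<exists>u\<in>splitting_box \<Delta>. \<forall>b\<in>S. coef S u b - of_int (k b) / real q \<in> \<int>"
      using u(1) by blast
  qed
next
  let ?Y = "root_lattice \<Delta>" and ?R = "{(x, y). x - y \<in> root_lattice \<Delta>}"
  assume split: "box_split \<Delta> S q"
  show "diagonally_split ?Y P q"
    unfolding diagonally_split_def
  proof
    fix z assume "z \<in> fractional_lattice q ?Y // ?R"
    then obtain y where y: "y \<in> ?Y" "z = ?R `` {y /\<^sub>R real q}"
      by (auto simp: fractional_lattice_def elim!: quotientE)
    have "\<forall>b. \<exists>k. b \<in> S \<longrightarrow> coef S y b = real_of_int k"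
      using y(1) by (auto simp: root_lattice_eq[OF S] elim!: Ints_cases)
    then obtain k where k: "\<And>b. b \<in> S \<Longrightarrow> coef S y b = real_of_int (k b)"
      by metis
    obtain u where u: "u \<in> splitting_box \<Delta>" "\<And>b. b \<in> S \<Longrightarrow> coef S u b - of_int (k b) / real q \<in> \<int>"
      using split unfolding box_split_def by blast
    then have mem: "u - y /\<^sub>R real q \<in> ?Y"
      by (simp add: root_lattice_eq[OF S] coef_diff[OF S] coef_scaleR[OF S] k inverse_eq_divide)
    have "- (u - y /\<^sub>R real q) \<in> ?Y"
      by (rule root_lattice_uminus[OF mem])
    then have "u \<in> z"
      by (simp add: y(2))
    \<comment> \<open>A representative must itself lie in the fractional lattice. This sum is q u
      written as a sum of two lattice vectors.\<close>
    have "y + real q *\<^sub>R (u - y /\<^sub>R real q) \<in> ?Y"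
      by (rule root_lattice_add[OF y(1) root_lattice_scaleR[OF mem]])
    moreover have "y + real q *\<^sub>R (u - y /\<^sub>R real q) = real q *\<^sub>R u"
      using q by (simp add: scaleR_right_diff_distrib)
    ultimately have "u \<in> fractional_lattice q ?Y"
      using q unfolding fractional_lattice_def by (intro image_eqI[of _ _ "real q *\<^sub>R u"]) auto
    then show "\<exists>u\<in>z. u \<in> open_splitting_polytope ?Y P \<inter> fractional_lattice q ?Y"
      using \<open>u \<in> z\<close> u(1) by (auto simp: open_splitting_polytope_eq[OF P])
  qed
qed

section \<open>Reflection invariance of the box and classes of small support\<close>

lemma splitting_box_coef:
  "u \<in> splitting_box \<Delta> \<Longrightarrow> simple_system \<Delta> S \<Longrightarrow> b \<in> S \<Longrightarrow> \<bar>coef S u b\<bar> < 1"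
  by (simp add: splitting_box_def)

text \<open>Reflecting the vector amounts to reflecting the simple system, and the box quantifies
  over all of these.\<close>

lemma splitting_box_reflection:
  assumes "u \<in> splitting_box \<Delta>" "\<alpha> \<in> \<Delta>"
  shows "reflection \<alpha> u \<in> splitting_box \<Delta>"
  unfolding splitting_box_def
proof (intro CollectI allI impI)
  fix S b assume S: "simple_system \<Delta> S" and b: "b \<in> S"
  have "\<bar>coef (reflection \<alpha> ` S) u (reflection \<alpha> b)\<bar> < 1"
    using simple_system_reflection[OF S assms(2)] b by (intro splitting_box_coef[OF assms(1)]) auto
  then show "\<bar>coef S (reflection \<alpha> u) b\<bar> < 1"
    by (simp add: coef_reflection_image'[OF S])
qed

text \<open>A representative of a class supported on \<open>J\<close> has integral coordinates of absolute value
  less than \<open>1\<close> outside \<open>J\<close>, so it is supported on \<open>J\<close> as well.\<close>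

lemma box_split_supported:
  assumes S: "simple_system \<Delta> S" and split: "box_split \<Delta> S q" and q: "q > 0" and "J \<subseteq> S"
  obtains m :: "'a \<Rightarrow> int"
  where "\<And>b. b \<in> J \<Longrightarrow> int q dvd m b - k b" "\<And>b. b \<in> J \<Longrightarrow> \<bar>m b\<bar> < int q"
    "(\<Sum>b\<in>J. (of_int (m b) / real q) *\<^sub>R b) \<in> splitting_box \<Delta>"
proof -
  define k' where "k' b = (if b \<in> J then k b else 0)" for b
  obtain u where u: "u \<in> splitting_box \<Delta>" "\<And>b. b \<in> S \<Longrightarrow> coef S u b - of_int (k' b) / real q \<in> \<int>"
    using split unfolding box_split_def by blast
  then have "\<forall>b. \<exists>n. b \<in> S \<longrightarrow> coef S u b - of_int (k' b) / real q = real_of_int n"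
    by (meson Ints_cases)
  then obtain n where n: "\<And>b. b \<in> S \<Longrightarrow> coef S u b - of_int (k' b) / real q = real_of_int (n b)"
    by metis
  define m where "m b = k' b + int q * n b" for b
  have coef_u: "coef S u b = of_int (m b) / real q" if "b \<in> S" for b
    using n[OF that] q by (simp add: m_def field_simps)
  have m_less: "\<bar>m b\<bar> < int q" if "b \<in> S" for b
  proof -
    have "\<bar>of_int (m b) / real q\<bar> < 1"
      using splitting_box_coef[OF u(1) S that] coef_u[OF that] by simp
    then have "\<bar>real_of_int (m b)\<bar> < real q"
      using q by (simp add: abs_divide)
    then show ?thesis
      by linarith
  qed
  have m_zero: "m b = 0" if "b \<in> S - J" for b
  proof -
    have "\<bar>int q * n b\<bar> < int q"
      using m_less[of b] that by (simp add: m_def k'_def)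
    then have "n b = 0"
      using q by (simp add: abs_mult)
    then show ?thesis
      using that by (simp add: m_def k'_def)
  qed
  have "u = (\<Sum>b\<in>S. coef S u b *\<^sub>R b)"
    by (simp add: sum_coef[OF S])
  also have "\<dots> = (\<Sum>b\<in>J. (of_int (m b) / real q) *\<^sub>R b)"
    using assms(4) m_zero coef_u simple_system_basis(4)[OF S]
    by (intro sum.mono_neutral_cong_right) auto
  finally have "(\<Sum>b\<in>J. (of_int (m b) / real q) *\<^sub>R b) \<in> splitting_box \<Delta>"
    using u(1) by simp
  moreover have "int q dvd m b - k b" if "b \<in> J" for b
    using that by (simp add: m_def k'_def)
  moreover have "\<bar>m b\<bar> < int q" if "b \<in> J" for b
    using m_less that assms(4) by blast
  ultimately show ?thesis
    using that by blast
qed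

text \<open>The candidates h and h - q for h = \<open>q div 2\<close> both have absolute value at
  least h. Reflecting in \<alpha> multiplies the numerator by the Cartan number, up to sign, and
  puts it at \<alpha>. The resulting bound rules out -3 for all q \<ge> 2, and -2 for even
  \<open>q\<close>.\<close>

lemma cartan_number_bound:
  assumes S: "simple_system \<Delta> S" and split: "box_split \<Delta> S q" and q: "q > 0"
    and ab: "\<alpha> \<in> S" "\<beta> \<in> S" "\<alpha> \<noteq> \<beta>"
  shows "\<bar>cartan_number \<beta> \<alpha>\<bar> * real (q div 2) < real q"
proof -
  obtain m where m: "int q dvd m \<beta> - int (q div 2)" "\<bar>m \<beta>\<bar> < int q"
    "(of_int (m \<beta>) / real q) *\<^sub>R \<beta> \<in> splitting_box \<Delta>"
    by (rule box_split_supported[OF S split q, of "{\<beta>}" "\<lambda>_. int (q div 2)"]) (use ab in auto)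
  have root: "\<alpha> \<in> \<Delta>"
    using simple_system_basis(1)[OF S] ab by auto
  have "m \<beta> = int (q div 2) \<or> m \<beta> = int (q div 2) - int q"
    using m q by (intro int_dvd_diff_cases) auto
  moreover have "2 * int (q div 2) \<le> int q"
    by linarith
  ultimately have "int (q div 2) \<le> \<bar>m \<beta>\<bar>"
    by linarith
  then have ge: "real (q div 2) \<le> \<bar>of_int (m \<beta>)\<bar>"
    by linarith
  have "\<bar>coef S (reflection \<alpha> ((of_int (m \<beta>) / real q) *\<^sub>R \<beta>)) \<alpha>\<bar> < 1"
    by (intro splitting_box_coef[OF splitting_box_reflection] m(3) root S ab)
  then have "\<bar>of_int (m \<beta>) / real q * cartan_number \<beta> \<alpha>\<bar> < 1"
    using ab by (simp add: coef_reflection_simple[OF S ab(1)] coef_scaleR[OF S] coef_simple[OF S ab(2)]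
        cartan_number_scaleR)
  then have "\<bar>of_int (m \<beta>)\<bar> * \<bar>cartan_number \<beta> \<alpha>\<bar> < real q"
    using q by (simp add: abs_mult field_simps)
  moreover have "real (q div 2) * \<bar>cartan_number \<beta> \<alpha>\<bar> \<le> \<bar>of_int (m \<beta>)\<bar> * \<bar>cartan_number \<beta> \<alpha>\<bar>"
    using ge by (intro mult_right_mono) auto
  ultimately show ?thesis
    by (simp add: mult.commute)
qed

lemma cartan_number_simple:
  assumes S: "simple_system \<Delta> S" and "a \<in> S" "b \<in> S"
  shows "cartan_number a b \<in> \<int>"
    and "a \<noteq> b \<Longrightarrow> cartan_number a b \<le> 0"
    and "a \<noteq> b \<Longrightarrow> a \<bullet> b \<noteq> 0 \<Longrightarrow> cartan_number a b \<le> - 1"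
    and "cartan_number a b = 0 \<longleftrightarrow> a \<bullet> b = 0"
    and "cartan_number a a = 2"
proof -
  have roots: "a \<in> \<Delta>" "b \<in> \<Delta>"
    using assms simple_system_basis(1)[OF S] by auto
  then have pos: "b \<bullet> b > 0"
    using zero_notin_roots by auto
  show int: "cartan_number a b \<in> \<int>"
    using cartan_number_int roots by blast
  show nonpos: "cartan_number a b \<le> 0" if "a \<noteq> b"
    using simple_inner_nonpos[OF S assms(2,3) that] pos
    by (simp add: cartan_number_def divide_nonpos_pos)
  show zero: "cartan_number a b = 0 \<longleftrightarrow> a \<bullet> b = 0"
    using pos by (simp add: cartan_number_def)
  show "cartan_number a b \<le> - 1" if "a \<noteq> b" "a \<bullet> b \<noteq> 0"
  proof -
    obtain j :: int where j: "cartan_number a b = of_int j"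
      using int by (auto elim: Ints_cases)
    then have "j < 0"
      using nonpos[OF that(1)] zero that(2) by (metis less_le of_int_0 of_int_le_0_iff)
    then show ?thesis
      using j by simp
  qed
  show "cartan_number a a = 2"
    using roots by (simp add: cartan_number_root_self)
qed

text \<open>For even \<open>q\<close>, the class of \<open>(\<alpha> + \<gamma>)/2\<close> has no representative in the box.\<close>

lemma odd_if_path:
  assumes S: "simple_system \<Delta> S" and split: "box_split \<Delta> S q" and q: "q > 0"
    and in_S: "\<alpha> \<in> S" "\<beta> \<in> S" "\<gamma> \<in> S" and ne: "\<alpha> \<noteq> \<beta>" "\<alpha> \<noteq> \<gamma>" "\<beta> \<noteq> \<gamma>"
    and edges: "\<alpha> \<bullet> \<gamma> = 0" "\<alpha> \<bullet> \<beta> \<noteq> 0" "\<gamma> \<bullet> \<beta> \<noteq> 0"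
  shows "odd q"
proof
  assume "even q"
  then obtain h where h: "q = 2 * h" by blast
  obtain m where m: "\<And>b. b \<in> {\<alpha>, \<gamma>} \<Longrightarrow> int q dvd m b - int h" "\<And>b. b \<in> {\<alpha>, \<gamma>} \<Longrightarrow> \<bar>m b\<bar> < int q"
    "(\<Sum>b\<in>{\<alpha>, \<gamma>}. (of_int (m b) / real q) *\<^sub>R b) \<in> splitting_box \<Delta>"
    by (rule box_split_supported[OF S split q, of "{\<alpha>, \<gamma>}" "\<lambda>_. int h"]) (use in_S in auto)
  define a c where "a = of_int (m \<alpha>) / real q" and "c = of_int (m \<gamma>) / real q"
  have half: "real_of_int (m b) / real q = 1/2 \<or> real_of_int (m b) / real q = -1/2" if "b \<in> {\<alpha>, \<gamma>}" for b
  proof -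
    have "m b = int h \<or> m b = int h - int q"
      using m(1,2)[OF that] h q by (intro int_dvd_diff_cases) auto
    then show ?thesis
      using h q by (auto simp: field_simps)
  qed
  have ac: "a = 1/2 \<or> a = -1/2" "c = 1/2 \<or> c = -1/2"
    using half by (auto simp: a_def c_def)
  define u where "u = a *\<^sub>R \<alpha> + c *\<^sub>R \<gamma>"
  have u: "u \<in> splitting_box \<Delta>"
    using m(3) ne by (simp add: u_def a_def c_def)
  have roots: "\<beta> \<in> \<Delta>" "\<gamma> \<in> \<Delta>"
    using simple_system_basis(1)[OF S] in_S by auto
  note C = cartan_number_simple[OF S]
  have Cs: "cartan_number \<alpha> \<beta> \<le> -1" "cartan_number \<gamma> \<beta> \<le> -1" "cartan_number \<alpha> \<gamma> = 0" "cartan_number \<gamma> \<gamma> = 2"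
    using C(3)[OF in_S(1,2) ne(1) edges(2)] C(3)[OF in_S(3,2) _ edges(3)] C(4)[OF in_S(1,3)] C(5)[OF in_S(3,3)]
      edges ne by auto
  \<comment> \<open>The reflection in \<gamma> flips the sign of \<open>c\<close>. For one of the
    two vectors the contributions of \<alpha> and \<gamma> therefore have equal signs, and they add
    up to at least 1/2 + 1/2.\<close>
  have "\<bar>coef S (reflection \<beta> u) \<beta>\<bar> < 1" "\<bar>coef S (reflection \<beta> (reflection \<gamma> u)) \<beta>\<bar> < 1"
    by (intro splitting_box_coef[OF _ S in_S(2)] splitting_box_reflection u roots)+
  then have "\<bar>a * cartan_number \<alpha> \<beta> + c * cartan_number \<gamma> \<beta>\<bar> < 1"
    "\<bar>a * cartan_number \<alpha> \<beta> - c * cartan_number \<gamma> \<beta>\<bar> < 1"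
    using ne Cs(3,4) by (simp_all add: u_def coef_reflection_simple[OF S] in_S coef_add[OF S] coef_scaleR[OF S]
        coef_simple[OF S] cartan_number_reflection cartan_number_add cartan_number_scaleR abs_minus_commute)
  then show False
    using ac Cs by (elim disjE; simp add: abs_less_iff; linarith)
qed


section \<open>Obstructions for odd \<open>q\<close>\<close>

lemma reflection_edge:
  assumes "cartan_number \<beta> \<alpha> = -1" "cartan_number \<alpha> \<alpha> = 2" "cartan_number w \<alpha> = 0"
  shows "reflection \<alpha> (x *\<^sub>R \<alpha> + y *\<^sub>R \<beta> + w) = (y - x) *\<^sub>R \<alpha> + y *\<^sub>R \<beta> + w"
proof -
  have "cartan_number (x *\<^sub>R \<alpha> + y *\<^sub>R \<beta> + w) \<alpha> = 2 * x - y"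
    using assms by (simp add: cartan_number_add cartan_number_scaleR)
  then have "reflection \<alpha> (x *\<^sub>R \<alpha> + y *\<^sub>R \<beta> + w) = (x - (2 * x - y)) *\<^sub>R \<alpha> + y *\<^sub>R \<beta> + w"
    by (simp only: reflection_eq scaleR_left_diff_distrib) simp
  then show ?thesis
    by simp
qed

text \<open>The class of \<open>(p \<alpha> - \<beta>)/q\<close>, for \<open>q = 2p + 1\<close> and a simple edge \<open>\<alpha>, \<beta>\<close>, is the common
  obstruction for all larger diagrams; \<open>w\<close> lives on simple roots orthogonal to the edge.\<close>

lemma edge_obstruction:
  assumes S: "simple_system \<Delta> S" and in_S: "\<alpha> \<in> S" "\<beta> \<in> S" "\<alpha> \<noteq> \<beta>"
    and C: "cartan_number \<alpha> \<beta> = -1" "cartan_number \<beta> \<alpha> = -1"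
    and w: "cartan_number w \<alpha> = 0" "cartan_number w \<beta> = 0" "coef S w \<alpha> = 0" "coef S w \<beta> = 0"
    and q: "int q = 2 * p + 1" "p \<ge> 1"
    and a: "int q dvd a - p" "\<bar>a\<bar> < int q" and b: "int q dvd b + 1" "\<bar>b\<bar> < int q"
    and box: "(of_int a / real q) *\<^sub>R \<alpha> + (of_int b / real q) *\<^sub>R \<beta> + w \<in> splitting_box \<Delta>"
  obtains b' where "b' \<ge> p + 1"
    "(of_int p / real q) *\<^sub>R \<alpha> + (of_int b' / real q) *\<^sub>R \<beta> + w \<in> splitting_box \<Delta>"
proof -
  define V where "V x y = (of_int x / real q) *\<^sub>R \<alpha> + (of_int y / real q) *\<^sub>R \<beta> + w" for x y :: int
  have roots: "\<alpha> \<in> \<Delta>" "\<beta> \<in> \<Delta>"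
    using simple_system_basis(1)[OF S] in_S by auto
  note self = cartan_number_root_self[OF roots(1)] cartan_number_root_self[OF roots(2)]
  have "q > 0"
    using q by linarith
  have s\<alpha>: "V (y - x) y \<in> splitting_box \<Delta>" if "V x y \<in> splitting_box \<Delta>" for x y
    using splitting_box_reflection[OF that roots(1)]
      reflection_edge[OF C(2) self(1) w(1), of "of_int x / real q" "of_int y / real q"]
    by (simp add: V_def diff_divide_distrib)
  have s\<beta>: "V x (x - y) \<in> splitting_box \<Delta>" if "V x y \<in> splitting_box \<Delta>" for x y
    using splitting_box_reflection[OF that roots(2)]
      reflection_edge[OF C(1) self(2) w(2), of "of_int y / real q" "of_int x / real q"]
    by (simp add: V_def diff_divide_distrib add.commute[of "_ *\<^sub>R \<alpha>"])
  have bound: "\<bar>x\<bar> < int q" if "V x y \<in> splitting_box \<Delta>" for x y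
  proof -
    have "\<bar>coef S (V x y) \<alpha>\<bar> < 1"
      by (rule splitting_box_coef[OF that S in_S(1)])
    then have "\<bar>real_of_int x\<bar> < real q"
      using \<open>q > 0\<close> in_S w
      by (simp add: V_def coef_add[OF S] coef_scaleR[OF S] coef_simple[OF S])
    then show ?thesis
      by linarith
  qed
  have "a = p \<or> a = p - int q"
    using a q by (intro int_dvd_diff_cases) auto
  then have a_cases: "a = p \<or> a = - p - 1"
    using q(1) by auto
  \<comment> \<open>The residue -1 is replaced by 2p = q - 1, which lies in the range required by
    \<open>int_dvd_diff_cases\<close>.\<close>
  have "int q dvd (b + 1) - int q"
    using b(1) by simp
  then have "int q dvd b - 2 * p"
    using q(1) by (simp add: algebra_simps)
  then have "b = 2 * p \<or> b = 2 * p - int q"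
    using b(2) q by (intro int_dvd_diff_cases) auto
  then have b_cases: "b = 2 * p \<or> b = - 1"
    using q(1) by auto
  have V: "V a b \<in> splitting_box \<Delta>"
    using box by (simp add: V_def)
  \<comment> \<open>Of the four candidate pairs, (p, 2p) is already of the desired form, and (-p-1,
    2p) is impossible since the reflection in \<alpha> yields the numerator 3p + 1 >= q. That
    reflection sends (-p-1, -1) to (p, -1), and the reflection in \<beta> sends this to (p,
    p+1).\<close>
  have "\<exists>b'\<ge>p + 1. V p b' \<in> splitting_box \<Delta>"
  proof (cases "b = 2 * p")
    case True
    have "a \<noteq> - p - 1"
      using bound[OF s\<alpha>[OF V]] True q by auto
    then show ?thesis
      using V True a_cases q by (intro exI[of _ b]) auto
  next
    case False
    then have b: "b = - 1"
      using b_cases by simp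
    have "V p (- 1) \<in> splitting_box \<Delta>"
      using a_cases V s\<alpha>[OF V] b by auto
    from s\<beta>[OF this] show ?thesis
      by auto
  qed
  then show ?thesis
    using that by (auto simp: V_def)
qed

lemma edge_obstruction_split:
  assumes S: "simple_system \<Delta> S" and split: "box_split \<Delta> S q"
    and in_S: "\<alpha> \<in> S" "\<beta> \<in> S" "\<alpha> \<noteq> \<beta>"
    and C: "cartan_number \<alpha> \<beta> = -1" "cartan_number \<beta> \<alpha> = -1"
    and q: "int q = 2 * p + 1" "p \<ge> 1"
  obtains b where "b \<ge> p + 1"
    "(of_int p / real q) *\<^sub>R \<alpha> + (of_int b / real q) *\<^sub>R \<beta> \<in> splitting_box \<Delta>"
proof -
  have "q > 0"
    using q by linarith
  obtain m where m: "\<And>b. b \<in> {\<alpha>, \<beta>} \<Longrightarrow> int q dvd m b - (if b = \<alpha> then p else - 1)"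
    "\<And>b. b \<in> {\<alpha>, \<beta>} \<Longrightarrow> \<bar>m b\<bar> < int q"
    "(\<Sum>b\<in>{\<alpha>, \<beta>}. (of_int (m b) / real q) *\<^sub>R b) \<in> splitting_box \<Delta>"
    by (rule box_split_supported[OF S split \<open>q > 0\<close>, of "{\<alpha>, \<beta>}" "\<lambda>b. if b = \<alpha> then p else - 1"])
      (use in_S in auto)
  have "int q dvd m \<beta> + 1"
    using m(1)[of \<beta>] in_S(3) by simp
  then obtain b where "b \<ge> p + 1"
    "(of_int p / real q) *\<^sub>R \<alpha> + (of_int b / real q) *\<^sub>R \<beta> + 0 \<in> splitting_box \<Delta>"
    using edge_obstruction[OF S in_S C _ _ _ _ q, of 0 "m \<alpha>" "m \<beta>"] m m(1)[of \<alpha>] in_S(3)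
    by (auto simp: cartan_number_def representation_zero)
  then show ?thesis
    using that by simp
qed

text \<open>Reflecting in \<gamma> and then in \<beta> turns the numerator b at \<beta> into p - b +
  M b, where M is the product of the two Cartan numbers of the second edge. With M \<ge> 2 this is
  at least p + b >= q.\<close>

lemma not_split_edge_beside_multiple_edge:
  assumes S: "simple_system \<Delta> S" and split: "box_split \<Delta> S q" and q: "odd q" "q \<ge> 2"
    and in_S: "\<alpha> \<in> S" "\<beta> \<in> S" "\<gamma> \<in> S" and ne: "\<alpha> \<noteq> \<beta>" "\<alpha> \<noteq> \<gamma>" "\<beta> \<noteq> \<gamma>"
    and C: "cartan_number \<alpha> \<beta> = -1" "cartan_number \<beta> \<alpha> = -1"
    and orth: "\<alpha> \<bullet> \<gamma> = 0" and mult: "cartan_number \<beta> \<gamma> * cartan_number \<gamma> \<beta> \<ge> 2"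
  shows False
proof -
  obtain p where p: "int q = 2 * p + 1" "p \<ge> 1"
    using q by (auto elim!: oddE)
  obtain b where b: "b \<ge> p + 1"
    and box: "(of_int p / real q) *\<^sub>R \<alpha> + (of_int b / real q) *\<^sub>R \<beta> \<in> splitting_box \<Delta>" (is "?u \<in> _")
    by (rule edge_obstruction_split[OF S split in_S(1,2) ne(1) C p])
  have roots: "\<beta> \<in> \<Delta>" "\<gamma> \<in> \<Delta>"
    using simple_system_basis(1)[OF S] in_S by auto
  have Cs: "cartan_number \<alpha> \<gamma> = 0" "cartan_number \<beta> \<beta> = 2"
    using cartan_number_simple(4,5)[OF S] in_S orth by auto
  let ?M = "cartan_number \<beta> \<gamma> * cartan_number \<gamma> \<beta>"
  have "\<bar>coef S (reflection \<beta> (reflection \<gamma> ?u)) \<beta>\<bar> < 1"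
    by (intro splitting_box_coef[OF _ S in_S(2)] splitting_box_reflection box roots)
  then have "\<bar>(of_int b / real q) * ?M + (of_int p - of_int b) / real q\<bar> < 1"
    using ne Cs C by (simp add: coef_reflection_simple[OF S] in_S coef_add[OF S] coef_scaleR[OF S]
        coef_simple[OF S] cartan_number_reflection cartan_number_add cartan_number_scaleR
        algebra_simps diff_divide_distrib)
  moreover have "(of_int b / real q) * 2 \<le> (of_int b / real q) * ?M"
    using mult b p by (intro mult_left_mono) auto
  ultimately have "(of_int b / real q) * 2 + (of_int p - of_int b) / real q < 1"
    by linarith
  then have "(real_of_int b + real_of_int p) / real q < 1"
    by (simp add: add_divide_distrib diff_divide_distrib)
  then have "real_of_int b + real_of_int p < real q"
    using q by (simp add: pos_divide_less_eq)
  then show False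
    using b p by linarith
qed

text \<open>Two edges from \<beta> to orthogonal roots act like one double edge: after the
  reflections in \<delta>, \<gamma> and \<beta>, the products of their Cartan numbers enter the
  coordinate at \<beta> as a sum of at least 2.\<close>

lemma not_split_branch:
  assumes S: "simple_system \<Delta> S" and split: "box_split \<Delta> S q" and q: "odd q" "q \<ge> 2"
    and in_S: "\<alpha> \<in> S" "\<beta> \<in> S" "\<gamma> \<in> S" "\<delta> \<in> S"
    and ne: "\<alpha> \<noteq> \<beta>" "\<alpha> \<noteq> \<gamma>" "\<alpha> \<noteq> \<delta>" "\<beta> \<noteq> \<gamma>" "\<beta> \<noteq> \<delta>" "\<gamma> \<noteq> \<delta>"
    and C: "cartan_number \<alpha> \<beta> = -1" "cartan_number \<beta> \<alpha> = -1"
    and orth: "\<alpha> \<bullet> \<gamma> = 0" "\<alpha> \<bullet> \<delta> = 0" "\<gamma> \<bullet> \<delta> = 0"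
    and edges: "\<beta> \<bullet> \<gamma> \<noteq> 0" "\<beta> \<bullet> \<delta> \<noteq> 0"
  shows False
proof -
  obtain p where p: "int q = 2 * p + 1" "p \<ge> 1"
    using q by (auto elim!: oddE)
  obtain b where b: "b \<ge> p + 1"
    and box: "(of_int p / real q) *\<^sub>R \<alpha> + (of_int b / real q) *\<^sub>R \<beta> \<in> splitting_box \<Delta>" (is "?u \<in> _")
    by (rule edge_obstruction_split[OF S split in_S(1,2) ne(1) C p])
  have roots: "\<beta> \<in> \<Delta>" "\<gamma> \<in> \<Delta>" "\<delta> \<in> \<Delta>"
    using simple_system_basis(1)[OF S] in_S by auto
  note C' = cartan_number_simple[OF S]
  have Cs: "cartan_number \<alpha> \<gamma> = 0" "cartan_number \<alpha> \<delta> = 0" "cartan_number \<gamma> \<delta> = 0" "cartan_number \<delta> \<gamma> = 0"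
    "cartan_number \<beta> \<beta> = 2"
    using C'(4,5) in_S orth by (auto simp: inner_commute)
  have le: "cartan_number \<beta> \<gamma> \<le> -1" "cartan_number \<gamma> \<beta> \<le> -1" "cartan_number \<beta> \<delta> \<le> -1" "cartan_number \<delta> \<beta> \<le> -1"
    using C'(3) in_S edges ne by (auto simp: inner_commute)
  let ?M = "cartan_number \<beta> \<gamma> * cartan_number \<gamma> \<beta> + cartan_number \<beta> \<delta> * cartan_number \<delta> \<beta>"
  have "1 \<le> (- cartan_number \<beta> \<gamma>) * (- cartan_number \<gamma> \<beta>)" "1 \<le> (- cartan_number \<beta> \<delta>) * (- cartan_number \<delta> \<beta>)"
    using le mult_mono[of 1 "- cartan_number \<beta> \<gamma>" 1 "- cartan_number \<gamma> \<beta>"]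
      mult_mono[of 1 "- cartan_number \<beta> \<delta>" 1 "- cartan_number \<delta> \<beta>"] by auto
  then have mult: "2 \<le> ?M"
    by simp
  have "\<bar>coef S (reflection \<beta> (reflection \<gamma> (reflection \<delta> ?u))) \<beta>\<bar> < 1"
    by (intro splitting_box_coef[OF _ S in_S(2)] splitting_box_reflection box roots)
  then have "\<bar>(of_int b / real q) * ?M + (of_int p - of_int b) / real q\<bar> < 1"
    using ne Cs C by (simp add: coef_reflection_simple[OF S] in_S coef_add[OF S] coef_scaleR[OF S]
        coef_simple[OF S] cartan_number_reflection cartan_number_add cartan_number_scaleR
        algebra_simps diff_divide_distrib add_divide_distrib)
  moreover have "(of_int b / real q) * 2 \<le> (of_int b / real q) * ?M"
    using mult b p by (intro mult_left_mono) auto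
  ultimately have "(of_int b / real q) * 2 + (of_int p - of_int b) / real q < 1"
    by linarith
  then have "(real_of_int b + real_of_int p) / real q < 1"
    by (simp add: add_divide_distrib diff_divide_distrib)
  then have "real_of_int b + real_of_int p < real q"
    using q by (simp add: pos_divide_less_eq)
  then show False
    using b p by linarith
qed

text \<open>Here \<gamma> receives a contribution of at least b/q from \<beta> and one of absolute
  value at least p/q from \<delta>, which is orthogonal to the edge \<alpha>, \<beta>.\<close>

lemma not_split_path4:
  assumes S: "simple_system \<Delta> S" and split: "box_split \<Delta> S q" and q: "odd q" "q \<ge> 2"
    and in_S: "\<alpha> \<in> S" "\<beta> \<in> S" "\<gamma> \<in> S" "\<delta> \<in> S"
    and ne: "\<alpha> \<noteq> \<beta>" "\<alpha> \<noteq> \<gamma>" "\<alpha> \<noteq> \<delta>" "\<beta> \<noteq> \<gamma>" "\<beta> \<noteq> \<delta>" "\<gamma> \<noteq> \<delta>"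
    and C: "cartan_number \<alpha> \<beta> = -1" "cartan_number \<beta> \<alpha> = -1"
    and orth: "\<alpha> \<bullet> \<gamma> = 0" "\<alpha> \<bullet> \<delta> = 0" "\<beta> \<bullet> \<delta> = 0"
    and edges: "\<beta> \<bullet> \<gamma> \<noteq> 0" "\<gamma> \<bullet> \<delta> \<noteq> 0"
  shows False
proof -
  obtain p where p: "int q = 2 * p + 1" "p \<ge> 1"
    using q by (auto elim!: oddE)
  have "q > 0"
    using q by simp
  have roots: "\<gamma> \<in> \<Delta>" "\<delta> \<in> \<Delta>"
    using simple_system_basis(1)[OF S] in_S by auto
  note C' = cartan_number_simple[OF S]
  have Cs: "cartan_number \<alpha> \<gamma> = 0" "cartan_number \<alpha> \<delta> = 0" "cartan_number \<beta> \<delta> = 0"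
    "cartan_number \<delta> \<alpha> = 0" "cartan_number \<delta> \<beta> = 0" "cartan_number \<delta> \<delta> = 2"
    using C'(4,5) in_S orth by (auto simp: inner_commute)
  have le: "cartan_number \<beta> \<gamma> \<le> -1" "cartan_number \<delta> \<gamma> \<le> -1"
    using C'(3) in_S edges ne by (auto simp: inner_commute)
  define k where "k b = (if b = \<beta> then - 1 else p)" for b :: 'a
  obtain m where m: "\<And>b. b \<in> {\<alpha>, \<beta>, \<delta>} \<Longrightarrow> int q dvd m b - k b"
    "\<And>b. b \<in> {\<alpha>, \<beta>, \<delta>} \<Longrightarrow> \<bar>m b\<bar> < int q"
    "(\<Sum>b\<in>{\<alpha>, \<beta>, \<delta>}. (of_int (m b) / real q) *\<^sub>R b) \<in> splitting_box \<Delta>"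
    by (rule box_split_supported[OF S split \<open>q > 0\<close>, of "{\<alpha>, \<beta>, \<delta>}" k]) (use in_S in auto)
  define d where "d = real_of_int (m \<delta>) / real q"
  have "m \<delta> = p \<or> m \<delta> = p - int q"
    using m(1,2)[of \<delta>] p ne by (intro int_dvd_diff_cases) (auto simp: k_def)
  then have "p \<le> \<bar>m \<delta>\<bar>"
    using p by auto
  then have "real_of_int p \<le> \<bar>real_of_int (m \<delta>)\<bar>"
    by linarith
  then have d: "of_int p / real q \<le> \<bar>d\<bar>"
    using \<open>q > 0\<close> by (simp add: d_def divide_right_mono)
  have w: "cartan_number (d *\<^sub>R \<delta>) \<alpha> = 0" "cartan_number (d *\<^sub>R \<delta>) \<beta> = 0"
    "coef S (d *\<^sub>R \<delta>) \<alpha> = 0" "coef S (d *\<^sub>R \<delta>) \<beta> = 0"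
    using Cs ne by (auto simp: cartan_number_scaleR coef_scaleR[OF S] coef_simple[OF S in_S(4)])
  have m\<beta>: "int q dvd m \<beta> + 1" and m\<alpha>: "int q dvd m \<alpha> - p"
    using m(1)[of \<beta>] m(1)[of \<alpha>] ne by (auto simp: k_def)
  have "(of_int (m \<alpha>) / real q) *\<^sub>R \<alpha> + (of_int (m \<beta>) / real q) *\<^sub>R \<beta> + d *\<^sub>R \<delta> \<in> splitting_box \<Delta>"
    using m(3) ne by (simp add: d_def add.assoc)
  then obtain b where b: "b \<ge> p + 1"
    and box: "(of_int p / real q) *\<^sub>R \<alpha> + (of_int b / real q) *\<^sub>R \<beta> + d *\<^sub>R \<delta> \<in> splitting_box \<Delta>" (is "?u \<in> _")
    using edge_obstruction[OF S in_S(1,2) ne(1) C w p m\<alpha> _ m\<beta>] m(2) by blast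
  \<comment> \<open>The sign of \<open>d\<close> is unknown, but the reflection in \<delta> flips it
    without changing the rest. In one of the two bounds the contributions reinforce each
    other.\<close>
  have "\<bar>coef S (reflection \<gamma> ?u) \<gamma>\<bar> < 1" "\<bar>coef S (reflection \<gamma> (reflection \<delta> ?u)) \<gamma>\<bar> < 1"
    by (intro splitting_box_coef[OF _ S in_S(3)] splitting_box_reflection box roots)+
  then have bounds: "\<bar>(of_int b / real q) * cartan_number \<beta> \<gamma> + d * cartan_number \<delta> \<gamma>\<bar> < 1"
    "\<bar>(of_int b / real q) * cartan_number \<beta> \<gamma> - d * cartan_number \<delta> \<gamma>\<bar> < 1"
    using ne Cs C by (simp_all add: coef_reflection_simple[OF S] in_S coef_add[OF S] coef_scaleR[OF S]
        coef_simple[OF S] cartan_number_reflection cartan_number_add cartan_number_scaleR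
        algebra_simps abs_minus_commute)
  have "of_int b / real q \<le> - ((of_int b / real q) * cartan_number \<beta> \<gamma>)"
    using mult_left_mono[OF le(1), of "of_int b / real q"] b p by simp
  moreover have "\<bar>d\<bar> \<le> \<bar>d * cartan_number \<delta> \<gamma>\<bar>"
    using mult_left_mono[of 1 "\<bar>cartan_number \<delta> \<gamma>\<bar>" "\<bar>d\<bar>"] le(2) by (simp add: abs_mult)
  ultimately have "of_int b / real q + of_int p / real q < 1"
    using bounds d by linarith
  then have "(real_of_int b + real_of_int p) / real q < 1"
    by (simp add: add_divide_distrib diff_divide_distrib)
  then have "real_of_int b + real_of_int p < real q"
    using q by (simp add: pos_divide_less_eq)
  then show False
    using b p by linarith
qed

section \<open>Classification of the diagrams that occur\<close>

text \<open>The vector \<open>x\<close> is \<beta> minus its orthogonal projection onto \<alpha>. It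
  is nonzero by independence, and its squared norm contains the required difference as a
  factor.\<close>

lemma cartan_number_product_less_4:
  assumes S: "simple_system \<Delta> S" and in_S: "\<alpha> \<in> S" "\<beta> \<in> S" "\<alpha> \<noteq> \<beta>"
  shows "cartan_number \<alpha> \<beta> * cartan_number \<beta> \<alpha> < 4"
proof -
  define x where "x = \<beta> - (cartan_number \<beta> \<alpha> / 2) *\<^sub>R \<alpha>"
  have pos: "\<alpha> \<bullet> \<alpha> > 0" "\<beta> \<bullet> \<beta> > 0"
    using simple_system_basis(1)[OF S] in_S zero_notin_roots by auto
  have "coef S x \<beta> = 1"
    using in_S by (simp add: x_def coef_diff[OF S] coef_scaleR[OF S] coef_simple[OF S])
  then have "x \<noteq> 0"
    by (auto simp: representation_zero)
  then have "0 < x \<bullet> x"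
    by simp
  also have "x \<bullet> x = (\<beta> \<bullet> \<beta>) * (1 - cartan_number \<alpha> \<beta> * cartan_number \<beta> \<alpha> / 4)"
    using pos by (simp add: x_def cartan_number_def inner_diff_left inner_diff_right inner_commute field_simps)
  finally show ?thesis
    using pos by (simp add: zero_less_mult_iff)
qed

text \<open>The same computation with the projection onto the plane of the orthogonal roots \<alpha>
  and \<gamma>. It prevents both edges of a path from being multiple.\<close>

lemma cartan_number_path_less_4:
  assumes S: "simple_system \<Delta> S" and in_S: "\<alpha> \<in> S" "\<beta> \<in> S" "\<gamma> \<in> S" and ne: "\<alpha> \<noteq> \<beta>" "\<gamma> \<noteq> \<beta>"
    and orth: "\<alpha> \<bullet> \<gamma> = 0"
  shows "cartan_number \<alpha> \<beta> * cartan_number \<beta> \<alpha> + cartan_number \<gamma> \<beta> * cartan_number \<beta> \<gamma> < 4"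
proof -
  define x where "x = \<beta> - (cartan_number \<beta> \<alpha> / 2) *\<^sub>R \<alpha> - (cartan_number \<beta> \<gamma> / 2) *\<^sub>R \<gamma>"
  have pos: "\<alpha> \<bullet> \<alpha> > 0" "\<beta> \<bullet> \<beta> > 0" "\<gamma> \<bullet> \<gamma> > 0"
    using simple_system_basis(1)[OF S] in_S zero_notin_roots by auto
  have "coef S x \<beta> = 1"
    using in_S ne by (simp add: x_def coef_diff[OF S] coef_scaleR[OF S] coef_simple[OF S])
  then have "x \<noteq> 0"
    by (auto simp: representation_zero)
  then have "0 < x \<bullet> x"
    by simp
  also have "x \<bullet> x = (\<beta> \<bullet> \<beta>) *
      (1 - (cartan_number \<alpha> \<beta> * cartan_number \<beta> \<alpha> + cartan_number \<gamma> \<beta> * cartan_number \<beta> \<gamma>) / 4)"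
  proof -
    have A: "cartan_number \<beta> \<alpha> / 2 * (\<alpha> \<bullet> \<alpha>) = \<alpha> \<bullet> \<beta>"
      and B: "cartan_number \<beta> \<gamma> / 2 * (\<gamma> \<bullet> \<gamma>) = \<gamma> \<bullet> \<beta>"
      and A': "(\<beta> \<bullet> \<beta>) * cartan_number \<alpha> \<beta> = 2 * (\<alpha> \<bullet> \<beta>)"
      and B': "(\<beta> \<bullet> \<beta>) * cartan_number \<gamma> \<beta> = 2 * (\<gamma> \<bullet> \<beta>)"
      using pos by (auto simp: cartan_number_def inner_commute)
    have "x \<bullet> x = \<beta> \<bullet> \<beta> + cartan_number \<beta> \<alpha> / 2 * (cartan_number \<beta> \<alpha> / 2 * (\<alpha> \<bullet> \<alpha>))
        + cartan_number \<beta> \<gamma> / 2 * (cartan_number \<beta> \<gamma> / 2 * (\<gamma> \<bullet> \<gamma>))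
        - cartan_number \<beta> \<alpha> * (\<alpha> \<bullet> \<beta>) - cartan_number \<beta> \<gamma> * (\<gamma> \<bullet> \<beta>)"
      using orth inner_commute[of \<beta> \<alpha>] inner_commute[of \<beta> \<gamma>] inner_commute[of \<gamma> \<alpha>]
      by (simp add: x_def inner_diff_left inner_diff_right algebra_simps)
    also have "\<dots> = \<beta> \<bullet> \<beta> - cartan_number \<beta> \<alpha> * ((\<beta> \<bullet> \<beta>) * cartan_number \<alpha> \<beta>) / 4
        - cartan_number \<beta> \<gamma> * ((\<beta> \<bullet> \<beta>) * cartan_number \<gamma> \<beta>) / 4"
      unfolding A B A' B' by simp
    finally show ?thesis
      by (simp add: algebra_simps add_divide_distrib)
  qed
  finally show ?thesis
    using pos by (simp add: zero_less_mult_iff)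
qed

text \<open>The product of the two Cartan numbers is four times the squared cosine of the angle; on
  an edge it is at least 1.\<close>

lemma sgn_inner_edge:
  assumes S: "simple_system \<Delta> S" and in_S: "\<alpha> \<in> S" "\<beta> \<in> S" "\<alpha> \<noteq> \<beta>"
  shows "sgn \<alpha> \<bullet> sgn \<beta> \<le> 0" and "\<alpha> \<bullet> \<beta> \<noteq> 0 \<Longrightarrow> sgn \<alpha> \<bullet> sgn \<beta> \<le> - 1/2"
proof -
  have pos: "norm \<alpha> > 0" "norm \<beta> > 0"
    using simple_system_basis(1)[OF S] in_S zero_notin_roots by auto
  have eq: "sgn \<alpha> \<bullet> sgn \<beta> = (\<alpha> \<bullet> \<beta>) / (norm \<alpha> * norm \<beta>)"
    by (simp add: sgn_div_norm inverse_eq_divide)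
  show nonpos: "sgn \<alpha> \<bullet> sgn \<beta> \<le> 0"
    unfolding eq using simple_inner_nonpos[OF S in_S] pos by (simp add: divide_nonpos_pos)
  assume "\<alpha> \<bullet> \<beta> \<noteq> 0"
  then have "cartan_number \<alpha> \<beta> \<le> -1" "cartan_number \<beta> \<alpha> \<le> -1"
    using cartan_number_simple(3)[OF S] in_S by (auto simp: inner_commute)
  then have "1 \<le> (- cartan_number \<alpha> \<beta>) * (- cartan_number \<beta> \<alpha>)"
    using mult_mono[of 1 "- cartan_number \<alpha> \<beta>" 1 "- cartan_number \<beta> \<alpha>"] by simp
  also have "\<dots> = (2 * (sgn \<alpha> \<bullet> sgn \<beta>))\<^sup>2"
    unfolding eq by (simp add: cartan_number_def dot_square_norm inner_commute power2_eq_square)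
  finally have "1 \<le> \<bar>2 * (sgn \<alpha> \<bullet> sgn \<beta>)\<bar>"
    using abs_le_square_iff[of 1 "2 * (sgn \<alpha> \<bullet> sgn \<beta>)"] by (simp only: abs_one power_one)
  then show "sgn \<alpha> \<bullet> sgn \<beta> \<le> - 1/2"
    using nonpos by simp
qed

lemma unit_sgn: "a \<noteq> 0 \<Longrightarrow> sgn a \<bullet> sgn a = 1" for a :: 'a
  by (simp add: dot_square_norm norm_sgn)

text \<open>With three edges, the sum of the unit vectors would have squared norm at most 3 - 3 = 0,
  against independence.\<close>

lemma simple_no_triangle:
  assumes S: "simple_system \<Delta> S" and in_S: "\<alpha> \<in> S" "\<beta> \<in> S" "\<gamma> \<in> S"
    and ne: "\<alpha> \<noteq> \<beta>" "\<alpha> \<noteq> \<gamma>" "\<beta> \<noteq> \<gamma>" and edges: "\<alpha> \<bullet> \<beta> \<noteq> 0" "\<beta> \<bullet> \<gamma> \<noteq> 0"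
  shows "\<alpha> \<bullet> \<gamma> = 0"
proof (rule ccontr)
  assume edge: "\<alpha> \<bullet> \<gamma> \<noteq> 0"
  have nz: "\<alpha> \<noteq> 0" "\<beta> \<noteq> 0" "\<gamma> \<noteq> 0"
    using simple_system_basis(1)[OF S] in_S zero_notin_roots by auto
  define x where "x = sgn \<alpha> + sgn \<beta> + sgn \<gamma>"
  have "coef S x \<alpha> = inverse (norm \<alpha>)"
    using in_S ne by (simp add: x_def sgn_div_norm coef_add[OF S] coef_scaleR[OF S] coef_simple[OF S])
  then have "x \<noteq> 0"
    using nz by (auto simp: representation_zero)
  then have "0 < x \<bullet> x"
    by simp
  also have "x \<bullet> x = 3 + 2 * (sgn \<alpha> \<bullet> sgn \<beta>) + 2 * (sgn \<beta> \<bullet> sgn \<gamma>) + 2 * (sgn \<alpha> \<bullet> sgn \<gamma>)"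
    using unit_sgn nz inner_commute[of "sgn \<beta>" "sgn \<alpha>"] inner_commute[of "sgn \<gamma>" "sgn \<beta>"]
      inner_commute[of "sgn \<gamma>" "sgn \<alpha>"]
    by (simp add: x_def inner_add_left inner_add_right)
  also have "\<dots> \<le> 0"
    using sgn_inner_edge(2)[OF S in_S(1,2) ne(1) edges(1)] sgn_inner_edge(2)[OF S in_S(2,3) ne(3) edges(2)]
      sgn_inner_edge(2)[OF S in_S(1,3) ne(2) edge] by linarith
  finally show False
    by simp
qed

text \<open>As for the triangle, now with 4 - 4 = 0; the two diagonals contribute nothing
  positive.\<close>

lemma simple_no_4_cycle:
  assumes S: "simple_system \<Delta> S" and in_S: "\<alpha> \<in> S" "\<beta> \<in> S" "\<gamma> \<in> S" "\<delta> \<in> S"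
    and ne: "\<alpha> \<noteq> \<beta>" "\<alpha> \<noteq> \<gamma>" "\<alpha> \<noteq> \<delta>" "\<beta> \<noteq> \<gamma>" "\<beta> \<noteq> \<delta>" "\<gamma> \<noteq> \<delta>"
    and edges: "\<alpha> \<bullet> \<beta> \<noteq> 0" "\<beta> \<bullet> \<gamma> \<noteq> 0" "\<gamma> \<bullet> \<delta> \<noteq> 0"
  shows "\<alpha> \<bullet> \<delta> = 0"
proof (rule ccontr)
  assume edge: "\<alpha> \<bullet> \<delta> \<noteq> 0"
  have nz: "\<alpha> \<noteq> 0" "\<beta> \<noteq> 0" "\<gamma> \<noteq> 0" "\<delta> \<noteq> 0"
    using simple_system_basis(1)[OF S] in_S zero_notin_roots by auto
  define x where "x = sgn \<alpha> + sgn \<beta> + sgn \<gamma> + sgn \<delta>"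
  have "coef S x \<alpha> = inverse (norm \<alpha>)"
    using in_S ne by (simp add: x_def sgn_div_norm coef_add[OF S] coef_scaleR[OF S] coef_simple[OF S])
  then have "x \<noteq> 0"
    using nz by (auto simp: representation_zero)
  then have "0 < x \<bullet> x"
    by simp
  also have "x \<bullet> x = 4 + 2 * (sgn \<alpha> \<bullet> sgn \<beta>) + 2 * (sgn \<beta> \<bullet> sgn \<gamma>) + 2 * (sgn \<gamma> \<bullet> sgn \<delta>)
      + 2 * (sgn \<alpha> \<bullet> sgn \<delta>) + 2 * (sgn \<alpha> \<bullet> sgn \<gamma>) + 2 * (sgn \<beta> \<bullet> sgn \<delta>)"
    using unit_sgn nz inner_commute[of "sgn \<beta>" "sgn \<alpha>"] inner_commute[of "sgn \<gamma>" "sgn \<beta>"]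
      inner_commute[of "sgn \<gamma>" "sgn \<alpha>"] inner_commute[of "sgn \<delta>" "sgn \<gamma>"]
      inner_commute[of "sgn \<delta>" "sgn \<beta>"] inner_commute[of "sgn \<delta>" "sgn \<alpha>"]
    by (simp add: x_def inner_add_left inner_add_right)
  also have "\<dots> \<le> 0"
    using sgn_inner_edge(2)[OF S in_S(1,2) ne(1) edges(1)] sgn_inner_edge(2)[OF S in_S(2,3) ne(4) edges(2)]
      sgn_inner_edge(2)[OF S in_S(3,4) ne(6) edges(3)] sgn_inner_edge(2)[OF S in_S(1,4) ne(3) edge]
      sgn_inner_edge(1)[OF S in_S(1,3) ne(2)] sgn_inner_edge(1)[OF S in_S(2,4) ne(5)] by linarith
  finally show False
    by simp
qed

end

section \<open>Cartan matrices, simple systems and connectedness\<close>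

lemma has_cartan_matrixI:
  assumes S: "simple_system \<Delta> S" and b: "bij_betw b {..<n} S"
    and C: "\<And>i j. i < n \<Longrightarrow> j < n \<Longrightarrow> cartan_number (b i) (b j) = of_int (C i j)"
  shows "has_cartan_matrix \<Delta> n C"
proof -
  note basis = simple_system_basis[OF S]
  have inj: "inj_on b {..<n}" and img: "b ` {..<n} = S"
    using b by (auto simp: bij_betw_def)
  have expand: "\<alpha> = (\<Sum>i<n. coef S \<alpha> (b i) *\<^sub>R b i)" for \<alpha>
    using sum_coef[OF S, of \<alpha>] sum.reindex[OF inj, of "\<lambda>c. coef S \<alpha> c *\<^sub>R c"] img by simp
  have nat: "\<exists>c :: nat \<Rightarrow> nat. \<alpha> = (\<Sum>i<n. real (c i) *\<^sub>R b i)" if "\<forall>c. coef S \<alpha> c \<in> \<nat>" for \<alpha>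
  proof -
    have "\<forall>i. \<exists>k. coef S \<alpha> (b i) = real k"
      using that by (meson Nats_cases)
    then obtain c where "\<And>i. coef S \<alpha> (b i) = real (c i)"
      by metis
    then show ?thesis
      using expand[of \<alpha>] by (intro exI[of _ c]) simp
  qed
  have "is_base \<Delta> n b"
    unfolding is_base_def
  proof (intro conjI ballI)
    fix \<alpha> assume "\<alpha> \<in> \<Delta>"
    from coef_root_cases[OF S this]
    show "\<exists>c :: nat \<Rightarrow> nat. \<alpha> = (\<Sum>i<n. real (c i) *\<^sub>R b i) \<or> \<alpha> = - (\<Sum>i<n. real (c i) *\<^sub>R b i)"
    proof
      assume "\<forall>c. - coef S \<alpha> c \<in> \<nat>"
      then have "\<forall>c. coef S (- \<alpha>) c \<in> \<nat>"
        by (simp add: coef_uminus[OF S])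
      from nat[OF this] show ?thesis
        by (metis minus_minus)
    qed (use nat in blast)
  qed (use basis inj img in auto)
  then show ?thesis
    using C unfolding has_cartan_matrix_def by blast
qed

context reduced_root_system
begin

lemma has_cartan_matrixD:
  assumes "has_cartan_matrix \<Delta> n C"
  obtains b where "simple_system \<Delta> (b ` {..<n})" "inj_on b {..<n}"
    "\<And>i j. i < n \<Longrightarrow> j < n \<Longrightarrow> cartan_number (b i) (b j) = of_int (C i j)"
proof -
  obtain b where b: "is_base \<Delta> n b" "\<And>i j. i < n \<Longrightarrow> j < n \<Longrightarrow> cartan_number (b i) (b j) = of_int (C i j)"
    using assms by (auto simp: has_cartan_matrix_def)
  let ?S = "b ` {..<n}"
  have ind: "independent ?S" and sub: "?S \<subseteq> \<Delta>" and inj: "inj_on b {..<n}"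
    using b(1) by (auto simp: is_base_def)
  have sum_span: "(\<Sum>i<n. real (c i) *\<^sub>R b i) \<in> span ?S" for c :: "nat \<Rightarrow> nat"
    by (intro span_sum span_scale span_base) auto
  have "\<Delta> \<subseteq> span ?S"
  proof
    fix \<alpha> assume "\<alpha> \<in> \<Delta>"
    then obtain c :: "nat \<Rightarrow> nat"
      where "\<alpha> = (\<Sum>i<n. real (c i) *\<^sub>R b i) \<or> \<alpha> = - (\<Sum>i<n. real (c i) *\<^sub>R b i)"
      using b(1) unfolding is_base_def by blast
    then show "\<alpha> \<in> span ?S"
      using sum_span span_neg by blast
  qed
  then have span: "span ?S = UNIV"
    using span_roots span_mono[of \<Delta> "span ?S"] by (metis span_span top.extremum_uniqueI)
  have coef_nat: "coef ?S (\<Sum>i<n. real (c i) *\<^sub>R b i) x \<in> \<nat>" for c :: "nat \<Rightarrow> nat" and x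
  proof -
    have "coef ?S (\<Sum>i<n. real (c i) *\<^sub>R b i) x = (\<Sum>i<n. coef ?S (real (c i) *\<^sub>R b i) x)"
      using span by (subst representation_sum[OF ind]) auto
    also have "\<dots> = (\<Sum>i<n. real (c i) * (if x = b i then 1 else 0))"
      using span by (intro sum.cong) (simp_all add: representation_scale[OF ind] representation_basis[OF ind])
    also have "\<dots> = real (\<Sum>i<n. c i * (if x = b i then 1 else 0))"
      by (simp add: if_distrib cong: if_cong)
    finally show ?thesis
      by (metis of_nat_in_Nats)
  qed
  have "simple_system \<Delta> ?S"
    unfolding simple_system_def
  proof (intro conjI ballI)
    fix \<alpha> assume "\<alpha> \<in> \<Delta>"
    then obtain c :: "nat \<Rightarrow> nat"
      where "\<alpha> = (\<Sum>i<n. real (c i) *\<^sub>R b i) \<or> \<alpha> = - (\<Sum>i<n. real (c i) *\<^sub>R b i)"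
      using b(1) unfolding is_base_def by blast
    then show "(\<forall>x. coef ?S \<alpha> x \<in> \<nat>) \<or> (\<forall>x. - coef ?S \<alpha> x \<in> \<nat>)"
    proof
      assume "\<alpha> = (\<Sum>i<n. real (c i) *\<^sub>R b i)"
      then show ?thesis
        using coef_nat by blast
    next
      assume "\<alpha> = - (\<Sum>i<n. real (c i) *\<^sub>R b i)"
      then have "- coef ?S \<alpha> x = coef ?S (\<Sum>i<n. real (c i) *\<^sub>R b i) x" for x
        using span by (simp add: representation_neg[OF ind])
      then show ?thesis
        using coef_nat by simp
    qed
  qed (use ind sub span in auto)
  then show ?thesis
    using that b(2) inj by blast
qed

text \<open>Reflecting in \<beta> keeps the part outside \<open>J\<close> and lowers the height. The
  part in \<open>J\<close> cannot disappear: the reflected root would then be orthogonal to \<beta>,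
  although their inner product is - (\<alpha> \<bullet> \<beta>).\<close>

lemma mixed_root_step:
  assumes S: "simple_system \<Delta> S" and J: "J \<subseteq> S" and orth: "\<And>b c. b \<in> J \<Longrightarrow> c \<in> S - J \<Longrightarrow> b \<bullet> c = 0"
    and \<alpha>: "\<alpha> \<in> positive_roots \<Delta> S" and \<beta>: "\<beta> \<in> J" "\<alpha> \<bullet> \<beta> > 0"
    and mixed: "b \<in> J" "coef S \<alpha> b \<noteq> 0" "c \<in> S - J" "coef S \<alpha> c \<noteq> 0"
  shows "reflection \<beta> \<alpha> \<in> positive_roots \<Delta> S" "\<exists>b\<in>J. coef S (reflection \<beta> \<alpha>) b \<noteq> 0"
    "\<exists>c\<in>S - J. coef S (reflection \<beta> \<alpha>) c \<noteq> 0"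
    "(\<Sum>b\<in>S. coef S (reflection \<beta> \<alpha>) b) < (\<Sum>b\<in>S. coef S \<alpha> b)"
proof -
  have \<beta>S: "\<beta> \<in> S"
    using J \<beta> by auto
  then have pos: "\<beta> \<bullet> \<beta> > 0" and root: "\<beta> \<in> \<Delta>"
    using simple_system_basis(1)[OF S] zero_notin_roots by auto
  have "c \<noteq> \<beta>"
    using mixed \<beta> by auto
  have coef_c: "coef S (reflection \<beta> \<alpha>) c = coef S \<alpha> c"
    using \<open>c \<noteq> \<beta>\<close> by (simp add: coef_reflection_simple[OF S \<beta>S])
  have "\<alpha> \<noteq> \<beta>"
    using mixed(4) \<open>c \<noteq> \<beta>\<close> by (auto simp: coef_simple[OF S \<beta>S])
  then show "reflection \<beta> \<alpha> \<in> positive_roots \<Delta> S"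
    by (rule reflection_simple_positive[OF S \<alpha> \<beta>S])
  show "\<exists>c\<in>S - J. coef S (reflection \<beta> \<alpha>) c \<noteq> 0"
    using mixed(3,4) coef_c by (intro bexI[of _ c]) auto
  show "\<exists>b\<in>J. coef S (reflection \<beta> \<alpha>) b \<noteq> 0"
  proof (rule ccontr)
    assume "\<not> ?thesis"
    then have "coef S (reflection \<beta> \<alpha>) b * (b \<bullet> \<beta>) = 0" if "b \<in> S" for b
      using orth[OF \<beta>(1), of b] that by (cases "b \<in> J") (auto simp: inner_commute)
    then have "reflection \<beta> \<alpha> \<bullet> \<beta> = 0"
      by (subst inner_sum_coef[OF S]) (intro sum.neutral, blast)
    then show False
      using \<beta>(2) by (simp add: inner_reflection_left)
  qed
  have "coef S (reflection \<beta> \<alpha>) \<beta> < coef S \<alpha> \<beta>"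
    using \<beta>(2) pos by (simp add: coef_reflection_simple[OF S \<beta>S] cartan_number_def)
  then show "(\<Sum>b\<in>S. coef S (reflection \<beta> \<alpha>) b) < (\<Sum>b\<in>S. coef S \<alpha> b)"
    using \<beta>S simple_system_basis(4)[OF S]
    by (intro sum_strict_mono_ex1) (auto simp: coef_reflection_simple[OF S \<beta>S] intro: less_imp_le)
qed

text \<open>If \<open>J\<close> were orthogonal to the rest, a positive root supported on both sides
  and of minimal height could be lowered further by \<open>mixed_root_step\<close>. So each root is
  supported on one side, contradicting irreducibility.\<close>

lemma simple_system_connected:
  assumes S: "simple_system \<Delta> S" and irr: "irreducible_roots \<Delta>" and J: "J \<subseteq> S" "J \<noteq> {}" "J \<noteq> S"
  shows "\<exists>b\<in>J. \<exists>c\<in>S - J. b \<bullet> c \<noteq> 0"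
proof (rule ccontr)
  assume "\<not> ?thesis"
  then have orth: "\<And>b c. b \<in> J \<Longrightarrow> c \<in> S - J \<Longrightarrow> b \<bullet> c = 0"
    by blast
  then have orth': "\<And>b c. b \<in> S - J \<Longrightarrow> c \<in> S - (S - J) \<Longrightarrow> b \<bullet> c = 0"
    by (metis Diff_iff inner_commute)
  define M where "M = {\<alpha>\<in>positive_roots \<Delta> S. (\<exists>b\<in>J. coef S \<alpha> b \<noteq> 0) \<and> (\<exists>c\<in>S - J. coef S \<alpha> c \<noteq> 0)}"
  define h where "h \<alpha> = (\<Sum>b\<in>S. coef S \<alpha> b)" for \<alpha>
  have "finite M"
    using finite_roots by (simp add: M_def positive_roots_def)
  have "M = {}"
  proof (rule ccontr)
    assume "M \<noteq> {}"
    then obtain \<alpha> where \<alpha>: "\<alpha> \<in> M" "\<And>\<gamma>. \<gamma> \<in> M \<Longrightarrow> h \<alpha> \<le> h \<gamma>"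
      using ex_is_arg_min_if_finite[OF \<open>finite M\<close>, of h] by (auto simp: is_arg_min_linorder)
    then obtain b c where bc: "\<alpha> \<in> positive_roots \<Delta> S" "b \<in> J" "coef S \<alpha> b \<noteq> 0" "c \<in> S - J" "coef S \<alpha> c \<noteq> 0"
      by (auto simp: M_def)
    obtain \<beta> where \<beta>: "\<beta> \<in> S" "\<alpha> \<bullet> \<beta> > 0"
      using simple_with_pos_inner[OF S bc(1)] by blast
    have "reflection \<beta> \<alpha> \<in> M \<and> h (reflection \<beta> \<alpha>) < h \<alpha>"
    proof (cases "\<beta> \<in> J")
      case True
      from mixed_root_step[OF S J(1) orth bc(1) True \<beta>(2) bc(2-5)] show ?thesis
        by (simp add: M_def h_def)
    next
      case False
      \<comment> \<open>The step lemma is applied with \<open>J\<close> and its complement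
        exchanged.\<close>
      then have "\<beta> \<in> S - J" "b \<in> S - (S - J)"
        using \<beta>(1) bc(2) J(1) by auto
      from mixed_root_step[OF S _ orth' bc(1) this(1) \<beta>(2) bc(4,5) this(2) bc(3)] show ?thesis
        using J(1) by (auto simp: M_def h_def double_diff)
    qed
    then show False
      using \<alpha>(2) by force
  qed
  define D1 where "D1 = {\<alpha>\<in>\<Delta>. \<forall>c\<in>S - J. coef S \<alpha> c = 0}"
  define D2 where "D2 = {\<alpha>\<in>\<Delta>. \<forall>b\<in>J. coef S \<alpha> b = 0}"
  have "\<Delta> \<subseteq> D1 \<union> D2"
  proof
    fix \<alpha> assume "\<alpha> \<in> \<Delta>"
    moreover have "\<alpha> \<notin> M" "- \<alpha> \<notin> M"
      using \<open>M = {}\<close> by auto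
    ultimately show "\<alpha> \<in> D1 \<union> D2"
      using positive_root_cases[OF S \<open>\<alpha> \<in> \<Delta>\<close>]
      by (auto simp: M_def D1_def D2_def coef_uminus[OF S])
  qed
  then have union: "\<Delta> = D1 \<union> D2"
    by (auto simp: D1_def D2_def)
  have "J \<subseteq> D1" "S - J \<subseteq> D2"
    using simple_system_basis(1)[OF S] J(1) by (auto simp: D1_def D2_def coef_simple[OF S])
  then have "D1 \<noteq> {}" "D2 \<noteq> {}"
    using J by auto
  moreover have "\<alpha> \<bullet> \<beta> = 0" if \<alpha>: "\<alpha> \<in> D1" and \<beta>: "\<beta> \<in> D2" for \<alpha> \<beta>
  proof -
    have "coef S \<alpha> b * (b \<bullet> \<beta>) = 0" if b: "b \<in> S" for b
    proof (cases "b \<in> J")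
      case True
      have "coef S \<beta> c * (c \<bullet> b) = 0" if "c \<in> S" for c
        using \<beta> orth[OF True, of c] that by (cases "c \<in> J") (auto simp: D2_def inner_commute)
      then have "\<beta> \<bullet> b = 0"
        by (subst inner_sum_coef[OF S]) (intro sum.neutral, blast)
      then show ?thesis
        by (simp add: inner_commute)
    qed (use \<alpha> b in \<open>auto simp: D1_def\<close>)
    then show ?thesis
      by (subst inner_sum_coef[OF S]) (intro sum.neutral, blast)
  qed
  ultimately show False
    using irr union unfolding irreducible_roots_def by blast
qed

lemma cartan_number_minus_one_cases:
  assumes S: "simple_system \<Delta> S" and "\<alpha> \<in> S" "\<beta> \<in> S" "\<alpha> \<noteq> \<beta>" "\<alpha> \<bullet> \<beta> \<noteq> 0"
    and "cartan_number \<alpha> \<beta> * cartan_number \<beta> \<alpha> < 2"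
  shows "cartan_number \<alpha> \<beta> = -1" "cartan_number \<beta> \<alpha> = -1"
proof -
  obtain j k :: int where jk: "cartan_number \<alpha> \<beta> = j" "cartan_number \<beta> \<alpha> = k"
    using cartan_number_simple(1)[OF S] assms by (metis Ints_cases)
  have "cartan_number \<alpha> \<beta> \<le> -1" "cartan_number \<beta> \<alpha> \<le> -1"
    using cartan_number_simple(3)[OF S] assms by (auto simp: inner_commute)
  then have le: "j \<le> -1" "k \<le> -1"
    unfolding jk by linarith+
  have "j * k < 2"
    using assms(6) unfolding jk by (metis of_int_less_iff of_int_mult of_int_numeral)
  then have less: "(- j) * (- k) < 2"
    by simp
  have "- j = 1" "- k = 1"
    using less le mult_mono[of 2 "- j" 1 "- k"] mult_mono[of 1 "- j" 2 "- k"] by linarith+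
  then show "cartan_number \<alpha> \<beta> = -1" "cartan_number \<beta> \<alpha> = -1"
    using jk by auto
qed

section \<open>Reading the type off the diagram\<close>

lemma type_A_1_if:
  assumes S: "simple_system \<Delta> {\<alpha>}"
  shows "type_A 1 \<Delta>"
  unfolding type_A_def
proof (rule has_cartan_matrixI[OF S])
  show "bij_betw (\<lambda>_. \<alpha>) {..<1::nat} {\<alpha>}"
    by (auto simp: bij_betw_def inj_on_def)
qed (use cartan_number_simple(5)[OF S, of \<alpha>] in \<open>simp add: cartan_A_def\<close>)

lemma bij_betw_nth_list: "distinct xs \<Longrightarrow> n = length xs \<Longrightarrow> bij_betw ((!) xs) {..<n} (set xs)"
  by (simp add: bij_betw_nth)

lemma rank_2_types:
  assumes S: "simple_system \<Delta> {\<alpha>, \<beta>}" and ne: "\<alpha> \<noteq> \<beta>" and split: "box_split \<Delta> {\<alpha>, \<beta>} q" and q: "q \<ge> 2"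
    and edge: "\<alpha> \<bullet> \<beta> \<noteq> 0"
  shows "type_A 2 \<Delta> \<or> (odd q \<and> type_B 2 \<Delta>)"
proof -
  note C = cartan_number_simple[OF S]
  have self: "cartan_number \<alpha> \<alpha> = 2" "cartan_number \<beta> \<beta> = 2"
    using C(5) by auto
  have bij: "bij_betw ((!) [\<alpha>, \<beta>]) {..<2} {\<alpha>, \<beta>}" "bij_betw ((!) [\<beta>, \<alpha>]) {..<2} {\<alpha>, \<beta>}"
    using bij_betw_nth_list[of "[\<alpha>, \<beta>]" 2] bij_betw_nth_list[of "[\<beta>, \<alpha>]" 2] ne
    by (auto simp: insert_commute)
  obtain j k :: int where jk: "cartan_number \<alpha> \<beta> = j" "cartan_number \<beta> \<alpha> = k"
    using C(1) by (metis Ints_cases insertI1 insertI2)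
  have le1: "cartan_number \<alpha> \<beta> \<le> -1" "cartan_number \<beta> \<alpha> \<le> -1"
    using C(3) ne edge by (auto simp: inner_commute)
  then have le: "j \<le> -1" "k \<le> -1"
    unfolding jk by linarith+
  have "cartan_number \<alpha> \<beta> * cartan_number \<beta> \<alpha> < 4"
    using cartan_number_product_less_4[OF S] ne by simp
  then have "j * k < 4"
    unfolding jk by (metis of_int_less_iff of_int_mult of_int_numeral)
  then have less: "(- j) * (- k) < 4"
    by simp
  have "real_of_int (\<bar>j\<bar> * int (q div 2)) < real_of_int (int q)"
    "real_of_int (\<bar>k\<bar> * int (q div 2)) < real_of_int (int q)"
    using cartan_number_bound[OF S split, of \<beta> \<alpha>] cartan_number_bound[OF S split, of \<alpha> \<beta>] q ne jk
    by simp_all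
  then have bound: "\<bar>j\<bar> * int (q div 2) < int q" "\<bar>k\<bar> * int (q div 2) < int q"
    unfolding of_int_less_iff by simp_all
  have small: "x > -3" if "\<bar>x\<bar> * int (q div 2) < int q" for x :: int
  proof (rule ccontr)
    assume "\<not> x > -3"
    then have "3 * int (q div 2) \<le> \<bar>x\<bar> * int (q div 2)"
      by (intro mult_right_mono) auto
    then show False
      using that q by linarith
  qed
  have even: "odd q" if "\<bar>x\<bar> * int (q div 2) < int q" "x = -2" for x :: int
    using that by auto
  have "j > -3" "k > -3"
    using small bound by auto
  then consider "j = -1" "k = -1" | "j = -2" "k = -1" | "j = -1" "k = -2" | "j = -2" "k = -2"
    using le by linarith
  then show ?thesis
  proof cases
    case 1
    have "type_A 2 \<Delta>"
      unfolding type_A_def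
      by (rule has_cartan_matrixI[OF S bij(1)])
        (use 1 jk self in \<open>auto simp: cartan_A_def less_2_cases_iff\<close>)
    then show ?thesis ..
  next
    case 2
    have "type_B 2 \<Delta>"
      unfolding type_B_def
      by (rule has_cartan_matrixI[OF S bij(1)])
        (use 2 jk self in \<open>auto simp: cartan_A_def cartan_B_def less_2_cases_iff\<close>)
    then show ?thesis
      using even[OF bound(1)] 2 by blast
  next
    case 3
    \<comment> \<open>Here \<alpha> is the short root, so the order is reversed:
      \<open>cartan_B\<close> expects the short root last.\<close>
    have "type_B 2 \<Delta>"
      unfolding type_B_def
      by (rule has_cartan_matrixI[OF S bij(2)])
        (use 3 jk self in \<open>auto simp: cartan_A_def cartan_B_def less_2_cases_iff\<close>)
    then show ?thesis
      using even[OF bound(2)] 3 by blast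
  qed (use less in simp)
qed

text \<open>Next to a path of three simple roots, any multiple edge or any further simple root would
  obstruct the splitting.\<close>

lemma path_type_A_3:
  assumes S: "simple_system \<Delta> S" and irr: "irreducible_roots \<Delta>"
    and split: "box_split \<Delta> S q" and q: "q \<ge> 2"
    and in_S: "\<alpha> \<in> S" "\<beta> \<in> S" "\<gamma> \<in> S" and ne: "\<alpha> \<noteq> \<beta>" "\<alpha> \<noteq> \<gamma>" "\<beta> \<noteq> \<gamma>"
    and edges: "\<alpha> \<bullet> \<beta> \<noteq> 0" "\<beta> \<bullet> \<gamma> \<noteq> 0"
  shows "odd q \<and> type_A 3 \<Delta>"
proof -
  have "q > 0"
    using q by simp
  note C = cartan_number_simple[OF S]
  have comm: "x \<bullet> y \<noteq> 0 \<longleftrightarrow> y \<bullet> x \<noteq> 0" for x y :: 'a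
    by (simp add: inner_commute)
  have odd_q: "odd q"
    using odd_if_path[OF S split \<open>q > 0\<close> in_S ne simple_no_triangle[OF S in_S ne edges] edges(1)]
      edges(2) comm by blast
  \<comment> \<open>The two products of Cartan numbers have sum below 4, so one of the edges is
    simple; the other is then simple too, since a multiple edge beside a simple one obstructs the
    splitting.\<close>
  have simply_laced: "cartan_number x y = -1 \<and> cartan_number y x = -1 \<and>
      cartan_number y z = -1 \<and> cartan_number z y = -1"
    if xyz: "x \<in> S" "y \<in> S" "z \<in> S" "x \<noteq> y" "x \<noteq> z" "y \<noteq> z" "x \<bullet> y \<noteq> 0" "y \<bullet> z \<noteq> 0" for x y z
  proof -
    have orth: "x \<bullet> z = 0" "z \<bullet> x = 0"
      using simple_no_triangle[OF S, of x y z] xyz by (auto simp: inner_commute)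
    have less: "cartan_number x y * cartan_number y x + cartan_number z y * cartan_number y z < 4"
      using cartan_number_path_less_4[OF S, of x y z] xyz orth by auto
    have xy: "cartan_number x y * cartan_number y x < 2" if "cartan_number y z * cartan_number z y < 2"
    proof (rule ccontr)
      assume "\<not> ?thesis"
      moreover have "cartan_number z y = -1" "cartan_number y z = -1"
        using cartan_number_minus_one_cases[OF S _ _ _ _ that] xyz by blast+
      ultimately show False
        using not_split_edge_beside_multiple_edge[OF S split odd_q q, of z y x] xyz orth
        by (auto simp: mult.commute)
    qed
    have yz: "cartan_number y z * cartan_number z y < 2" if "cartan_number x y * cartan_number y x < 2"
    proof (rule ccontr)
      assume "\<not> ?thesis"
      moreover have "cartan_number x y = -1" "cartan_number y x = -1"
        using cartan_number_minus_one_cases[OF S _ _ _ _ that] xyz by blast+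
      ultimately show False
        using not_split_edge_beside_multiple_edge[OF S split odd_q q, of x y z] xyz orth
        by auto
    qed
    have "cartan_number x y * cartan_number y x < 2 \<or> cartan_number y z * cartan_number z y < 2"
      using less mult.commute[of "cartan_number z y" "cartan_number y z"] by linarith
    then have "cartan_number x y * cartan_number y x < 2" "cartan_number y z * cartan_number z y < 2"
      using xy yz by blast+
    then show ?thesis
      using cartan_number_minus_one_cases[OF S, of x y] cartan_number_minus_one_cases[OF S, of y z] xyz
      by blast
  qed
  have no_branch: False
    if "x \<in> S" "y \<in> S" "z \<in> S" "d \<in> S" "x \<noteq> y" "x \<noteq> z" "y \<noteq> z" "d \<notin> {x, y, z}"
      "x \<bullet> y \<noteq> 0" "y \<bullet> z \<noteq> 0" "y \<bullet> d \<noteq> 0" for x y z d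
  proof -
    have "x \<bullet> z = 0" "x \<bullet> d = 0" "z \<bullet> d = 0"
      using simple_no_triangle[OF S, of x y z] simple_no_triangle[OF S, of x y d]
        simple_no_triangle[OF S, of z y d] that comm by auto
    then show False
      using not_split_branch[OF S split odd_q q, of x y z d] simply_laced[of x y z] that by auto
  qed
  have no_path: False
    if "x \<in> S" "y \<in> S" "z \<in> S" "d \<in> S" "x \<noteq> y" "x \<noteq> z" "y \<noteq> z" "d \<notin> {x, y, z}"
      "x \<bullet> y \<noteq> 0" "y \<bullet> z \<noteq> 0" "z \<bullet> d \<noteq> 0" for x y z d
  proof -
    have "x \<bullet> z = 0" "y \<bullet> d = 0" "x \<bullet> d = 0"
      using simple_no_triangle[OF S, of x y z] simple_no_triangle[OF S, of y z d]
        simple_no_4_cycle[OF S, of x y z d] that by auto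
    then show False
      using not_split_path4[OF S split odd_q q, of x y z d] simply_laced[of x y z] that by auto
  qed
  have S_eq: "S = {\<alpha>, \<beta>, \<gamma>}"
  proof (rule ccontr)
    assume "S \<noteq> {\<alpha>, \<beta>, \<gamma>}"
    then obtain x d where d: "x \<in> {\<alpha>, \<beta>, \<gamma>}" "d \<in> S - {\<alpha>, \<beta>, \<gamma>}" "x \<bullet> d \<noteq> 0"
      using simple_system_connected[OF S irr, of "{\<alpha>, \<beta>, \<gamma>}"] in_S by auto
    then consider "x = \<alpha>" | "x = \<beta>" | "x = \<gamma>"
      by blast
    then show False
    proof cases
      case 1
      then show False
        using no_path[of \<gamma> \<beta> \<alpha> d] d in_S ne edges comm by auto
    next
      case 2
      then show False
        using no_branch[of \<alpha> \<beta> \<gamma> d] d in_S ne edges by auto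
    next
      case 3
      then show False
        using no_path[of \<alpha> \<beta> \<gamma> d] d in_S ne edges by auto
    qed
  qed
  have "\<alpha> \<bullet> \<gamma> = 0"
    by (rule simple_no_triangle[OF S in_S ne edges])
  then have cartan: "cartan_number \<alpha> \<gamma> = 0" "cartan_number \<gamma> \<alpha> = 0"
    using C(4) in_S by (auto simp: inner_commute)
  have "type_A 3 \<Delta>"
    unfolding type_A_def
  proof (rule has_cartan_matrixI[OF S])
    show "bij_betw ((!) [\<alpha>, \<beta>, \<gamma>]) {..<3} S"
      using bij_betw_nth_list[of "[\<alpha>, \<beta>, \<gamma>]" 3] ne S_eq by simp
    fix i j :: nat assume "i < 3" "j < 3"
    then have "i \<in> {0, 1, 2}" "j \<in> {0, 1, 2}"
      by auto
    then show "cartan_number ([\<alpha>, \<beta>, \<gamma>] ! i) ([\<alpha>, \<beta>, \<gamma>] ! j) = of_int (cartan_A i j)"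
      using simply_laced[OF in_S ne edges] cartan C(5) in_S
      by (auto simp: cartan_A_def)
  qed
  then show ?thesis
    using odd_q by blast
qed

text \<open>The diagram is explored from one root by connectedness. A third root is joined to one of
  the first two, which becomes the centre of a path.\<close>

lemma split_types:
  assumes S: "simple_system \<Delta> S" and irr: "irreducible_roots \<Delta>"
    and split: "box_split \<Delta> S q" and q: "q \<ge> 2"
  shows "type_A 1 \<Delta> \<or> type_A 2 \<Delta> \<or> (odd q \<and> (type_A 3 \<Delta> \<or> type_B 2 \<Delta>))"
proof -
  have "S \<noteq> {}"
    using card_simple_system[OF S] by auto
  then obtain x where x: "x \<in> S"
    by blast
  show ?thesis
  proof (cases "S = {x}")
    case True
    then show ?thesis
      using type_A_1_if S by auto
  next
    case False
    then obtain y where y: "y \<in> S" "y \<noteq> x" "x \<bullet> y \<noteq> 0"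
      using simple_system_connected[OF S irr, of "{x}"] x by auto
    show ?thesis
    proof (cases "S = {x, y}")
      case True
      then show ?thesis
        using rank_2_types[of x y q] S split q y by auto
    next
      case False
      then obtain v z where v: "v \<in> {x, y}" "z \<in> S - {x, y}" "v \<bullet> z \<noteq> 0"
        using simple_system_connected[OF S irr, of "{x, y}"] x y by auto
      then consider "x \<bullet> z \<noteq> 0" | "y \<bullet> z \<noteq> 0"
        by blast
      then show ?thesis
      proof cases
        case 1
        then show ?thesis
          using path_type_A_3[OF S irr split q, of y x z] x y v by (auto simp: inner_commute)
      next
        case 2
        then show ?thesis
          using path_type_A_3[OF S irr split q, of x y z] x y v by auto
      qed
    qed
  qed
qed

end

section \<open>Splitting in the remaining types\<close>

lemma frac_diff_Ints: "frac x - x \<in> \<int>"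
  by (simp add: frac_def)

text \<open>Clearing denominators would make the even number 2 k equal to the odd number q (2 n +
  1). This is how oddness of \<open>q\<close> enters the constructions of representatives.\<close>

lemma odd_denominator_not_half:
  assumes "odd q"
  shows "of_int k / real q - of_int n \<noteq> 1/2"
proof
  assume "of_int k / real q - of_int n = 1/2"
  moreover have "q > 0"
    using assms by (rule odd_pos)
  ultimately have "real_of_int (2 * k) = real_of_int (int q * (2 * n + 1))"
    by (simp add: field_simps)
  then have "2 * k = int q * (2 * n + 1)"
    by (simp only: of_int_eq_iff)
  then have "even (int q * (2 * n + 1))"
    by (metis dvd_triv_left)
  then show False
    using assms by simp
qed

context reduced_root_system
begin

text \<open>Stability is assumed only for reflections in \<open>S\<close>, but the induction
  reflects in roots of other simple systems. The induction hypothesis therefore also carries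
  stability under the reflections of the current system.\<close>

lemma dual_vectors_in_invariant_set:
  assumes S: "simple_system \<Delta> S" and dual: "\<And>b. b \<in> S \<Longrightarrow> dual_vector S b \<in> X"
    and inv: "\<And>b x. b \<in> S \<Longrightarrow> x \<in> X \<Longrightarrow> reflection b x \<in> X"
    and T: "simple_system \<Delta> T" "t \<in> T"
  shows "dual_vector T t \<in> X"
proof -
  have "\<forall>t\<in>T. dual_vector T t \<in> X \<and> (\<forall>x\<in>X. reflection t x \<in> X)"
  proof (rule simple_system_induct[OF S _ _ T(1),
        where P = "\<lambda>T. \<forall>t\<in>T. dual_vector T t \<in> X \<and> (\<forall>x\<in>X. reflection t x \<in> X)"])
    fix T \<beta>
    assume T: "simple_system \<Delta> T" and \<beta>: "\<beta> \<in> T"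
      and IH: "\<forall>t\<in>reflection \<beta> ` T. dual_vector (reflection \<beta> ` T) t \<in> X \<and> (\<forall>x\<in>X. reflection t x \<in> X)"
    have \<beta>_inv: "reflection \<beta> x \<in> X" if "x \<in> X" for x
    proof -
      have "reflection (reflection \<beta> \<beta>) x \<in> X"
        using IH \<beta> that by blast
      then show ?thesis
        by simp
    qed
    have root: "\<beta> \<in> \<Delta>"
      using \<beta> simple_system_basis(1)[OF T] by auto
    show "\<forall>t\<in>T. dual_vector T t \<in> X \<and> (\<forall>x\<in>X. reflection t x \<in> X)"
    proof (intro ballI conjI)
      fix t assume t: "t \<in> T"
      have "dual_vector (reflection \<beta> ` T) (reflection \<beta> t) \<in> X"
        using IH t by blast
      then have "reflection \<beta> (reflection \<beta> (dual_vector T t)) \<in> X"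
        unfolding dual_vector_reflection[OF T root] by (rule \<beta>_inv)
      then show "dual_vector T t \<in> X"
        by simp
      fix x assume "x \<in> X"
      then have "reflection (reflection \<beta> t) (reflection \<beta> x) \<in> X"
        using IH t \<beta>_inv by blast
      then have "reflection \<beta> (reflection (reflection \<beta> t) (reflection \<beta> x)) \<in> X"
        by (rule \<beta>_inv)
      \<comment> \<open>The reflection in \<open>t\<close> is the conjugate by the reflection in
        \<beta> of the reflection in the image of \<open>t\<close>.\<close>
      then show "reflection t x \<in> X"
        by (simp add: reflection_conjugate)
    qed
  qed (use dual inv in blast)
  then show ?thesis
    using T(2) by blast
qed

lemma splitting_boxI:
  assumes S: "simple_system \<Delta> S" and dual: "\<And>b. b \<in> S \<Longrightarrow> dual_vector S b \<in> X"
    and inv: "\<And>b x. b \<in> S \<Longrightarrow> x \<in> X \<Longrightarrow> reflection b x \<in> X"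
    and u: "\<And>v. v \<in> X \<Longrightarrow> \<bar>u \<bullet> v\<bar> < 1"
  shows "u \<in> splitting_box \<Delta>"
  unfolding splitting_box_def
proof (intro CollectI allI impI)
  fix T t assume T: "simple_system \<Delta> T" "t \<in> T"
  then have "\<bar>u \<bullet> dual_vector T t\<bar> < 1"
    by (intro u dual_vectors_in_invariant_set[OF S dual inv])
  then show "\<bar>coef T u t\<bar> < 1"
    by (simp add: inner_dual_vector[OF T(1)])
qed

section \<open>Explicit representatives in the box\<close>

lemma box_split_A1:
  assumes S: "simple_system \<Delta> {\<alpha>}"
  shows "box_split \<Delta> {\<alpha>} q"
  unfolding box_split_def
proof
  fix k :: "'a \<Rightarrow> int"
  define x where "x = frac (of_int (k \<alpha>) / real q)"
  have x: "0 \<le> x" "x < 1"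
    by (simp_all add: x_def frac_lt_1)
  let ?X = "{v. \<alpha> \<bullet> v = 1 \<or> \<alpha> \<bullet> v = -1}"
  have C: "cartan_number \<alpha> \<alpha> = 2"
    using cartan_number_simple(5)[OF S] by simp
  have "x *\<^sub>R \<alpha> \<in> splitting_box \<Delta>"
  proof (rule splitting_boxI[OF S, of ?X])
    show "dual_vector {\<alpha>} b \<in> ?X" if "b \<in> {\<alpha>}" for b
      using that inner_simple_dual_vector[OF S] by simp
    show "reflection b v \<in> ?X" if "b \<in> {\<alpha>}" "v \<in> ?X" for b v
      using that C by (auto simp: inner_reflection_right)
  qed (use x in auto)
  moreover have "coef {\<alpha>} (x *\<^sub>R \<alpha>) \<alpha> - of_int (k \<alpha>) / real q \<in> \<int>"
    by (simp add: coef_scaleR[OF S] coef_simple[OF S] x_def frac_diff_Ints)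
  ultimately show "\<exists>u\<in>splitting_box \<Delta>. \<forall>b\<in>{\<alpha>}. coef {\<alpha>} u b - of_int (k b) / real q \<in> \<int>"
    by blast
qed

lemma box_split_A2:
  assumes S: "simple_system \<Delta> {\<alpha>, \<beta>}" and ne: "\<alpha> \<noteq> \<beta>"
    and C: "cartan_number \<alpha> \<beta> = -1" "cartan_number \<beta> \<alpha> = -1"
  shows "box_split \<Delta> {\<alpha>, \<beta>} q"
  unfolding box_split_def
proof
  fix k :: "'a \<Rightarrow> int"
  define x y where "x = frac (of_int (k \<alpha>) / real q)" and "y = frac (of_int (k \<beta>) / real q)"
  have xy: "0 \<le> x" "x < 1" "0 \<le> y" "y < 1"
    by (simp_all add: x_def y_def frac_lt_1)
  \<comment> \<open>Pairings with \<alpha> and \<beta> of the conjugates of the two fundamental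
    coweights, three each. On \<open>?u\<close> they take the values x, y and x - y up to sign, all
    below 1 in absolute value for coordinates in [0, 1).\<close>
  define L :: "(real \<times> real) set" where "L = {(1, 0), (0, 1), (1, -1), (-1, 0), (0, -1), (-1, 1)}"
  let ?X = "{v. (\<alpha> \<bullet> v, \<beta> \<bullet> v) \<in> L}"
  let ?u = "x *\<^sub>R \<alpha> + y *\<^sub>R \<beta>"
  have self: "cartan_number \<alpha> \<alpha> = 2" "cartan_number \<beta> \<beta> = 2"
    using cartan_number_simple(5)[OF S] by auto
  have L_refl: "(- a, b + a) \<in> L \<and> (a + b, - b) \<in> L" if "(a, b) \<in> L" for a b
    using that unfolding L_def by (elim insertE emptyE; simp)
  have L_bound: "\<bar>x * a + y * b\<bar> < 1" if "(a, b) \<in> L" for a b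
    using that xy unfolding L_def by (elim insertE emptyE; simp; linarith)
  have "?u \<in> splitting_box \<Delta>"
  proof (rule splitting_boxI[OF S, of ?X])
    show "dual_vector {\<alpha>, \<beta>} b \<in> ?X" if "b \<in> {\<alpha>, \<beta>}" for b
      using that ne inner_simple_dual_vector[OF S] by (auto simp: L_def)
    show "reflection b v \<in> ?X" if "b \<in> {\<alpha>, \<beta>}" "v \<in> ?X" for b v
    proof -
      have "(\<alpha> \<bullet> v, \<beta> \<bullet> v) \<in> L"
        using that(2) by simp
      then show ?thesis
        using that(1) L_refl C self by (auto simp: inner_reflection_right)
    qed
    show "\<bar>?u \<bullet> v\<bar> < 1" if "v \<in> ?X" for v
      using L_bound that by (simp add: inner_add_left)
  qed
  moreover have "coef {\<alpha>, \<beta>} ?u \<alpha> - of_int (k \<alpha>) / real q \<in> \<int>"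
    "coef {\<alpha>, \<beta>} ?u \<beta> - of_int (k \<beta>) / real q \<in> \<int>"
    using ne by (simp_all add: coef_add[OF S] coef_scaleR[OF S] coef_simple[OF S] x_def y_def frac_diff_Ints)
  ultimately show "\<exists>u\<in>splitting_box \<Delta>. \<forall>b\<in>{\<alpha>, \<beta>}. coef {\<alpha>, \<beta>} u b - of_int (k b) / real q \<in> \<int>"
    by blast
qed

lemma box_split_B2:
  assumes S: "simple_system \<Delta> {\<alpha>, \<beta>}" and ne: "\<alpha> \<noteq> \<beta>"
    and C: "cartan_number \<alpha> \<beta> = -2" "cartan_number \<beta> \<alpha> = -1" and q: "odd q"
  shows "box_split \<Delta> {\<alpha>, \<beta>} q"
  unfolding box_split_def
proof
  fix k :: "'a \<Rightarrow> int"
  text \<open>Orthonormal coordinates of \<open>B\<^sub>2\<close>, reduced to the interval \<open>(-1/2, 1/2)\<close>.\<close>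
  have near: "\<exists>x. \<bar>x\<bar> < 1/2 \<and> x - of_int j / real q \<in> \<int>" for j
  proof -
    let ?n = "round (of_int j / real q)"
    have "\<bar>of_int ?n - of_int j / real q\<bar> \<le> 1/2"
      by (rule of_int_round_abs_le)
    moreover have "of_int j / real q - of_int ?n \<noteq> 1/2" "of_int ?n - of_int j / real q \<noteq> 1/2"
      using odd_denominator_not_half[OF q, of j ?n] odd_denominator_not_half[OF q, of "- j" "- ?n"]
      by auto
    ultimately have "\<bar>of_int j / real q - of_int ?n\<bar> < 1/2"
      by linarith
    then show ?thesis
      by (intro exI[of _ "of_int j / real q - of_int ?n"]) auto
  qed
  obtain x where x: "\<bar>x\<bar> < 1/2" "x - of_int (k \<alpha>) / real q \<in> \<int>"
    using near by blast
  \<comment> \<open>The coordinate of \<open>?u\<close> at \<beta> is x + z, so \<open>z\<close>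
    represents the difference of the two given coordinates.\<close>
  obtain z where z: "\<bar>z\<bar> < 1/2" "z - of_int (k \<beta> - k \<alpha>) / real q \<in> \<int>"
    using near by blast
  \<comment> \<open>The conjugates of the coweight of \<alpha> take the values x and z on
    \<open>?u\<close> up to sign, those of the coweight of \<beta> the values x + z and x - z up to
    sign. The bound 1/2 on |x| and |z| is what the latter require.\<close>
  define L :: "(real \<times> real) set"
    where "L = {(1, 0), (0, 1), (2, -1), (-1, 1), (-1, 0), (0, -1), (-2, 1), (1, -1)}"
  let ?X = "{v. (\<alpha> \<bullet> v, \<beta> \<bullet> v) \<in> L}"
  let ?u = "x *\<^sub>R \<alpha> + (x + z) *\<^sub>R \<beta>"
  have self: "cartan_number \<alpha> \<alpha> = 2" "cartan_number \<beta> \<beta> = 2"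
    using cartan_number_simple(5)[OF S] by auto
  have L_refl: "(- a, b + a) \<in> L \<and> (a + b * 2, - b) \<in> L" if "(a, b) \<in> L" for a b
    using that unfolding L_def by (elim insertE emptyE; simp)
  have L_bound: "\<bar>x * a + (x + z) * b\<bar> < 1" if "(a, b) \<in> L" for a b
    using that x(1) z(1) unfolding L_def by (elim insertE emptyE; simp; linarith)
  have "?u \<in> splitting_box \<Delta>"
  proof (rule splitting_boxI[OF S, of ?X])
    show "dual_vector {\<alpha>, \<beta>} b \<in> ?X" if "b \<in> {\<alpha>, \<beta>}" for b
      using that ne inner_simple_dual_vector[OF S] by (auto simp: L_def)
    show "reflection b v \<in> ?X" if "b \<in> {\<alpha>, \<beta>}" "v \<in> ?X" for b v
    proof -
      have "(\<alpha> \<bullet> v, \<beta> \<bullet> v) \<in> L"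
        using that(2) by simp
      then show ?thesis
        using that(1) L_refl C self by (auto simp: inner_reflection_right)
    qed
    show "\<bar>?u \<bullet> v\<bar> < 1" if "v \<in> ?X" for v
      using L_bound that by (simp add: inner_add_left)
  qed
  moreover have "coef {\<alpha>, \<beta>} ?u \<alpha> - of_int (k \<alpha>) / real q \<in> \<int>"
    using ne x(2) by (simp add: coef_add[OF S] coef_scaleR[OF S] coef_simple[OF S])
  moreover have "coef {\<alpha>, \<beta>} ?u \<beta> - of_int (k \<beta>) / real q \<in> \<int>"
    using ne Ints_add[OF x(2) z(2)]
    by (simp add: coef_add[OF S] coef_scaleR[OF S] coef_simple[OF S] diff_divide_distrib add_diff_eq)
  ultimately show "\<exists>u\<in>splitting_box \<Delta>. \<forall>b\<in>{\<alpha>, \<beta>}. coef {\<alpha>, \<beta>} u b - of_int (k b) / real q \<in> \<int>"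
    by blast
qed

end

text \<open>The only possible violation is \<open>x - y + z \<ge> 1\<close>. It is repaired by lowering the larger of
  \<open>x\<close> and \<open>z\<close>, or both if they are equal, and then also \<open>y\<close> if \<open>y > 0\<close>.\<close>

lemma A3_representative:
  fixes x y z :: real
  assumes "0 \<le> x" "x < 1" "0 \<le> y" "y < 1" "0 \<le> z" "z < 1" and half: "x \<noteq> 1/2"
  obtains x' y' z' where "x' - x \<in> \<int>" "y' - y \<in> \<int>" "z' - z \<in> \<int>"
    "\<bar>x'\<bar> < 1" "\<bar>y'\<bar> < 1" "\<bar>z'\<bar> < 1" "\<bar>x' - y'\<bar> < 1" "\<bar>y' - z'\<bar> < 1" "\<bar>x' - z'\<bar> < 1" "\<bar>x' - y' + z'\<bar> < 1"
proof -
  \<comment> \<open>Lowering only \<open>x\<close> requires x > z, as |x - 1 - z| must stay below 1;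
    symmetrically for \<open>z\<close>. In the tie both are lowered, and if y > 0 also
    \<open>y\<close>, since 2x - 2 - y might equal -1.\<close>
  consider "x - y + z < 1" | "x - y + z \<ge> 1" "x > z" | "x - y + z \<ge> 1" "x < z"
    | "x - y + z \<ge> 1" "x = z" "y = 0" | "x - y + z \<ge> 1" "x = z" "y > 0"
    using assms by linarith
  then show ?thesis
  proof cases
    case 1
    then show ?thesis
      using assms by (intro that[of x y z]) (auto simp: abs_if)
  next
    case 2
    then show ?thesis
      using assms by (intro that[of "x - 1" y z]) (auto simp: abs_if)
  next
    case 3
    then show ?thesis
      using assms by (intro that[of x y "z - 1"]) (auto simp: abs_if)
  next
    case 4
    \<comment> \<open>With y = 0 the value y - 1 is not allowed. Now 2x \<ge> 1 and x \<noteq> 1/2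
      give |2x - 2| < 1; only here is oddness of the denominator felt.\<close>
    then show ?thesis
      using assms by (intro that[of "x - 1" y "z - 1"]) (auto simp: abs_if)
  next
    case 5
    then show ?thesis
      using assms by (intro that[of "x - 1" "y - 1" "z - 1"]) (auto simp: abs_if)
  qed
qed

context reduced_root_system
begin

lemma box_split_A3:
  assumes S: "simple_system \<Delta> {\<alpha>, \<beta>, \<gamma>}" and ne: "\<alpha> \<noteq> \<beta>" "\<alpha> \<noteq> \<gamma>" "\<beta> \<noteq> \<gamma>"
    and C: "cartan_number \<alpha> \<beta> = -1" "cartan_number \<beta> \<alpha> = -1" "cartan_number \<beta> \<gamma> = -1"
      "cartan_number \<gamma> \<beta> = -1" "cartan_number \<alpha> \<gamma> = 0" "cartan_number \<gamma> \<alpha> = 0" and q: "odd q"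
  shows "box_split \<Delta> {\<alpha>, \<beta>, \<gamma>} q"
  unfolding box_split_def
proof
  fix k :: "'a \<Rightarrow> int"
  let ?x = "\<lambda>b. frac (of_int (k b) / real q)"
  have range: "0 \<le> ?x b" "?x b < 1" for b
    by (simp_all add: frac_lt_1)
  have half: "?x \<alpha> \<noteq> 1/2"
    unfolding frac_def by (rule odd_denominator_not_half[OF q])
  obtain x y z where xyz: "x - ?x \<alpha> \<in> \<int>" "y - ?x \<beta> \<in> \<int>" "z - ?x \<gamma> \<in> \<int>"
    and bounds: "\<bar>x\<bar> < 1" "\<bar>y\<bar> < 1" "\<bar>z\<bar> < 1" "\<bar>x - y\<bar> < 1" "\<bar>y - z\<bar> < 1" "\<bar>x - z\<bar> < 1" "\<bar>x - y + z\<bar> < 1"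
    by (rule A3_representative[OF range[of \<alpha>] range[of \<beta>] range[of \<gamma>] half])
  have int: "x - of_int (k \<alpha>) / real q \<in> \<int>" "y - of_int (k \<beta>) / real q \<in> \<int>" "z - of_int (k \<gamma>) / real q \<in> \<int>"
    using Ints_add[OF xyz(1) frac_diff_Ints[of "of_int (k \<alpha>) / real q"]]
      Ints_add[OF xyz(2) frac_diff_Ints[of "of_int (k \<beta>) / real q"]]
      Ints_add[OF xyz(3) frac_diff_Ints[of "of_int (k \<gamma>) / real q"]] by simp_all
  \<comment> \<open>The orbits of the three fundamental coweights, of sizes 4, 6 and 4. Up to sign
    they give exactly the seven expressions bounded in \<open>A3_representative\<close>.\<close>
  define L :: "(real \<times> real \<times> real) set" where "L = {(1, 0, 0), (0, 1, 0), (0, 0, 1), (1, -1, 0),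
    (0, 1, -1), (1, 0, -1), (1, -1, 1), (-1, 0, 0), (0, -1, 0), (0, 0, -1), (-1, 1, 0), (0, -1, 1),
    (-1, 0, 1), (-1, 1, -1)}"
  let ?X = "{v. (\<alpha> \<bullet> v, \<beta> \<bullet> v, \<gamma> \<bullet> v) \<in> L}"
  let ?u = "x *\<^sub>R \<alpha> + y *\<^sub>R \<beta> + z *\<^sub>R \<gamma>"
  have self: "cartan_number \<alpha> \<alpha> = 2" "cartan_number \<beta> \<beta> = 2" "cartan_number \<gamma> \<gamma> = 2"
    using cartan_number_simple(5)[OF S] by auto
  have L_refl: "(- a, b + a, c) \<in> L \<and> (a + b, - b, c + b) \<in> L \<and> (a, b + c, - c) \<in> L" if "(a, b, c) \<in> L" for a b c
    using that unfolding L_def by (elim insertE emptyE; simp)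
  have L_bound: "\<bar>x * a + y * b + z * c\<bar> < 1" if "(a, b, c) \<in> L" for a b c
    using that bounds unfolding L_def by (elim insertE emptyE; simp; linarith)
  have "?u \<in> splitting_box \<Delta>"
  proof (rule splitting_boxI[OF S, of ?X])
    show "dual_vector {\<alpha>, \<beta>, \<gamma>} b \<in> ?X" if "b \<in> {\<alpha>, \<beta>, \<gamma>}" for b
      using that ne inner_simple_dual_vector[OF S] by (auto simp: L_def)
    show "reflection b v \<in> ?X" if "b \<in> {\<alpha>, \<beta>, \<gamma>}" "v \<in> ?X" for b v
    proof -
      have "(\<alpha> \<bullet> v, \<beta> \<bullet> v, \<gamma> \<bullet> v) \<in> L"
        using that(2) by simp
      then show ?thesis
        using that(1) L_refl C self by (auto simp: inner_reflection_right)
    qed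
    show "\<bar>?u \<bullet> v\<bar> < 1" if "v \<in> ?X" for v
      using L_bound that by (simp add: inner_add_left)
  qed
  moreover have "coef {\<alpha>, \<beta>, \<gamma>} ?u \<alpha> - of_int (k \<alpha>) / real q \<in> \<int>"
    "coef {\<alpha>, \<beta>, \<gamma>} ?u \<beta> - of_int (k \<beta>) / real q \<in> \<int>" "coef {\<alpha>, \<beta>, \<gamma>} ?u \<gamma> - of_int (k \<gamma>) / real q \<in> \<int>"
    using ne int by (simp_all add: coef_add[OF S] coef_scaleR[OF S] coef_simple[OF S])
  ultimately show "\<exists>u\<in>splitting_box \<Delta>. \<forall>b\<in>{\<alpha>, \<beta>, \<gamma>}. coef {\<alpha>, \<beta>, \<gamma>} u b - of_int (k b) / real q \<in> \<int>"
    by blast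
qed

section \<open>The four types\<close>

lemma type_A_1_split:
  assumes "ample_polytope \<Delta> P" "type_A 1 \<Delta>" "q > 0"
  shows "diagonally_split (root_lattice \<Delta>) P q"
proof -
  obtain b :: "nat \<Rightarrow> 'a" where S: "simple_system \<Delta> (b ` {..<1})"
    using has_cartan_matrixD[OF assms(2)[unfolded type_A_def]] by blast
  have "b ` {..<1} = {b 0}"
    by (auto simp: less_Suc_eq)
  then show ?thesis
    using diagonally_split_iff_box_split[OF assms(1) S assms(3)] box_split_A1[of "b 0" q] S by simp
qed

lemma type_A_2_split:
  assumes "ample_polytope \<Delta> P" "type_A 2 \<Delta>" "q > 0"
  shows "diagonally_split (root_lattice \<Delta>) P q"
proof -
  obtain b where S: "simple_system \<Delta> (b ` {..<2})" and inj: "inj_on b {..<2}"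
    and C: "\<And>i j. i < 2 \<Longrightarrow> j < 2 \<Longrightarrow> cartan_number (b i) (b j) = of_int (cartan_A i j)"
    using has_cartan_matrixD[OF assms(2)[unfolded type_A_def]] by blast
  have eq: "b ` {..<2} = {b 0, b 1}"
    by (auto simp: less_2_cases_iff)
  have "b 0 \<noteq> b 1"
    using inj_onD[OF inj, of 0 1] by auto
  then have "box_split \<Delta> {b 0, b 1} q"
    using box_split_A2[of "b 0" "b 1" q] S C[of 0 1] C[of 1 0] by (simp add: eq cartan_A_def)
  then show ?thesis
    using diagonally_split_iff_box_split[OF assms(1) S assms(3)] eq by simp
qed

lemma type_B_2_split_iff:
  assumes "ample_polytope \<Delta> P" "type_B 2 \<Delta>" "q > 0"
  shows "diagonally_split (root_lattice \<Delta>) P q \<longleftrightarrow> odd q"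
proof -
  obtain b where S: "simple_system \<Delta> (b ` {..<2})" and inj: "inj_on b {..<2}"
    and C: "\<And>i j. i < 2 \<Longrightarrow> j < 2 \<Longrightarrow> cartan_number (b i) (b j) = of_int (cartan_B 2 i j)"
    using has_cartan_matrixD[OF assms(2)[unfolded type_B_def]] by blast
  have eq: "b ` {..<2} = {b 0, b 1}"
    by (auto simp: less_2_cases_iff)
  note S' = S[unfolded eq]
  have ne: "b 0 \<noteq> b 1"
    using inj_onD[OF inj, of 0 1] by auto
  have Cs: "cartan_number (b 0) (b 1) = -2" "cartan_number (b 1) (b 0) = -1"
    using C[of 0 1] C[of 1 0] by (simp_all add: cartan_B_def cartan_A_def)
  \<comment> \<open>The Cartan number -2 turns the bound into 2 (\<open>q div 2\<close>) < q, which
    fails for even \<open>q\<close>.\<close>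
  have "odd q" if "box_split \<Delta> {b 0, b 1} q"
    using cartan_number_bound[OF S' that assms(3), of "b 1" "b 0"] ne Cs by auto
  moreover have "box_split \<Delta> {b 0, b 1} q" if "odd q"
    by (rule box_split_B2[OF S' ne Cs that])
  ultimately show ?thesis
    using diagonally_split_iff_box_split[OF assms(1) S' assms(3)] by blast
qed

lemma type_A_3_split_iff:
  assumes "ample_polytope \<Delta> P" "type_A 3 \<Delta>" "q > 0"
  shows "diagonally_split (root_lattice \<Delta>) P q \<longleftrightarrow> odd q"
proof -
  obtain b where S: "simple_system \<Delta> (b ` {..<3})" and inj: "inj_on b {..<3}"
    and C: "\<And>i j. i < 3 \<Longrightarrow> j < 3 \<Longrightarrow> cartan_number (b i) (b j) = of_int (cartan_A i j)"
    using has_cartan_matrixD[OF assms(2)[unfolded type_A_def]] by blast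
  have "{..<3::nat} = {0, 1, 2}"
    by auto
  then have eq: "b ` {..<3} = {b 0, b 1, b 2}"
    by auto
  note S' = S[unfolded eq]
  have ne: "b 0 \<noteq> b 1" "b 0 \<noteq> b 2" "b 1 \<noteq> b 2"
    using inj_onD[OF inj, of 0 1] inj_onD[OF inj, of 0 2] inj_onD[OF inj, of 1 2] by auto
  have Cs: "cartan_number (b 0) (b 1) = -1" "cartan_number (b 1) (b 0) = -1"
    "cartan_number (b 1) (b 2) = -1" "cartan_number (b 2) (b 1) = -1"
    "cartan_number (b 0) (b 2) = 0" "cartan_number (b 2) (b 0) = 0"
    using C[of 0 1] C[of 1 0] C[of 1 2] C[of 2 1] C[of 0 2] C[of 2 0] by (simp_all add: cartan_A_def)
  have inner: "b 0 \<bullet> b 2 = 0" "b 0 \<bullet> b 1 \<noteq> 0" "b 2 \<bullet> b 1 \<noteq> 0"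
    using cartan_number_simple(4)[OF S', of "b 0" "b 2"] cartan_number_simple(4)[OF S', of "b 0" "b 1"]
      cartan_number_simple(4)[OF S', of "b 2" "b 1"] Cs by auto
  have "odd q" if "box_split \<Delta> {b 0, b 1, b 2} q"
    by (rule odd_if_path[OF S' that assms(3) _ _ _ ne inner]) auto
  moreover have "box_split \<Delta> {b 0, b 1, b 2} q" if "odd q"
    by (rule box_split_A3[OF S' ne Cs that])
  ultimately show ?thesis
    using diagonally_split_iff_box_split[OF assms(1) S' assms(3)] by blast
qed

end

theorem proposition6p2:
  fixes \<Delta> P :: "'a::euclidean_space set"
  assumes "root_system \<Delta>" and "reduced_roots \<Delta>" and "irreducible_roots \<Delta>"
    and "ample_polytope \<Delta> P"
  shows "((\<exists>q\<ge>2. diagonally_split (root_lattice \<Delta>) P q) \<longleftrightarrow>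
            type_A 1 \<Delta> \<or> type_A 2 \<Delta> \<or> type_A 3 \<Delta> \<or> type_B 2 \<Delta>) \<and>
         (type_A 1 \<Delta> \<or> type_A 2 \<Delta> \<longrightarrow>
            (\<forall>q\<ge>2. diagonally_split (root_lattice \<Delta>) P q)) \<and>
         (type_A 3 \<Delta> \<or> type_B 2 \<Delta> \<longrightarrow>
            (\<forall>q\<ge>2. diagonally_split (root_lattice \<Delta>) P q \<longleftrightarrow> odd q))"
proof -
  interpret reduced_root_system \<Delta>
    by unfold_locales (use assms in auto)
  obtain S where S: "simple_system \<Delta> S"
    using exists_chamber_containing by blast
  have A: "\<forall>q\<ge>2. diagonally_split (root_lattice \<Delta>) P q" if "type_A 1 \<Delta> \<or> type_A 2 \<Delta>"
    using that type_A_1_split[OF assms(4)] type_A_2_split[OF assms(4)] by auto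
  have B: "\<forall>q\<ge>2. diagonally_split (root_lattice \<Delta>) P q \<longleftrightarrow> odd q" if "type_A 3 \<Delta> \<or> type_B 2 \<Delta>"
    using that type_A_3_split_iff[OF assms(4)] type_B_2_split_iff[OF assms(4)] by auto
  have "type_A 1 \<Delta> \<or> type_A 2 \<Delta> \<or> type_A 3 \<Delta> \<or> type_B 2 \<Delta>"
    if "q \<ge> 2" "diagonally_split (root_lattice \<Delta>) P q" for q
    using split_types[OF S assms(3), of q] diagonally_split_iff_box_split[OF assms(4) S, of q] that by auto
  moreover have "\<exists>q\<ge>2. diagonally_split (root_lattice \<Delta>) P q"
    if "type_A 1 \<Delta> \<or> type_A 2 \<Delta> \<or> type_A 3 \<Delta> \<or> type_B 2 \<Delta>"
    \<comment> \<open>The smallest odd q \<ge> 2 serves all four types.\<close>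
    using A B that by (intro exI[of _ 3]) auto
  ultimately show ?thesis
    using A B by blast
qed

end
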